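(* Let $M$ be a smooth $n$-dimensional manifold, let $k\ge 1$, and let $K^{(k)}$ be a connection tower of order $k$ in $M$, with associated connection maps $K^{(\alpha)}=(K^{(\alpha)}_1,\ldots,K^{(\alpha)}_\alpha)$ on $T^{(\alpha)}M$, $\alpha=1,\ldots,k$. For each $\alpha=1,\ldots,k$ let $\sigma:(TM)_\oplus^{\alpha}\to M$ be the natural projection and define $F^{(\alpha)}:T^{(\alpha)}M\to (TM)_\oplus^{\alpha}$ by $$F^{(\alpha)}(u)=\Big(d_T^{(1)}(\tau^{(\alpha)}_1(u)),\ K^{(1)}_1\big(d_T^{(2)}(\tau^{(\alpha)}_2(u))\big),\ 2!\,K^{(2)}_2\big(d_T^{(3)}(\tau^{(\alpha)}_3(u))\big),\ \ldots,\ (\alpha-1)!\,K^{(\alpha-1)}_{\alpha-1}\big(d_T^{(\alpha)}(u)\big)\Big).$$ Then $F^{(\alpha)}$ is a diffeomorphism for all $\alpha=1,\ldots,k$. Moreover $\sigma\circ F^{(\alpha)}=\tau_\alpha$. Consequently, the vector bundle structure of $(TM)_\oplus^{\alpha}$ over $M$ pulls back through $F^{(\alpha)}$ to a vector bundle structure on $T^{(\alpha)}M$.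
   Context: $T^{(k)}M$ is the tangent bundle of order $k$: the manifold of $k$-jets $u=j^k_0(q)$ at $0$ of smooth curves $q$ in $M$ (two curves with the same initial point are equivalent if their derivatives up to order $k$ at $0$ agree in a chart), with $T^{(0)}M=M$, $T^{(1)}M=TM$. Projections: $\tau_k:T^{(k)}M\to M$, $\tau_k(j^k_0q)=q(0)$, and $\tau^{(k)}_\alpha:T^{(k)}M\to T^{(\alpha)}M$, $\tau^{(k)}_\alpha(j^k_0q)=j^\alpha_0q$ for $0\le\alpha\le k$. Local coordinates $(q^i)$ on $M$ induce coordinates $q^{(\alpha)i}(j^k_0q)=\frac1{\alpha!}\frac{d^\alpha q^i}{dt^\alpha}(0)$, $0\le\alpha\le k$. The almost-tangent structure $J$ on $T^{(k)}M$ is the $(1,1)$-tensor field with $J(\partial/\partial q^{(\alpha)i})=\partial/\partial q^{(\alpha+1)i}$ for $\alpha<k$ and $J(\partial/\partial q^{(k)i})=0$. $(TM)_\oplus^{k}$ denotes the Whitney sum of $k$ copies of $TM$. A connection map on $T^{(k)}M$ is a smooth bundle morphism $K=(K_1,\ldots,K_k):TT^{(k)}M\to (TM)_\oplus^{k}$ over $\tau_k$ such that (1) $K_\alpha:T_uT^{(k)}M\to T_{\tau_k(u)}M$ is linear for $\alpha=1,\ldots,k$; (2) $K_{\alpha+1}\circ J=K_\alpha$ for $\alpha=1,\ldots,k-1$; (3) $K_1\circ J=\tau_{k*}$. A connection map $K^{(k)}=(K^{(k)}_1,\ldots,K^{(k)}_k)$ on $T^{(k)}M$ is a connection tower of order $k$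 if for each $\alpha=1,\ldots,k$ there is a unique map $K^{(\alpha)}_\alpha:TT^{(\alpha)}M\to TM$ with $K^{(k)}_\alpha=K^{(\alpha)}_\alpha\circ\tau^{(k)}_{\alpha *}$. Its associated connection maps on $T^{(\alpha)}M$ are $K^{(\alpha)}=(K^{(\alpha)}_1,\ldots,K^{(\alpha)}_\alpha)$ with $K^{(\alpha)}_\mu=K^{(\mu)}_\mu\circ\tau^{(\alpha)}_{\mu *}$. The Tulczyjew operator $d_T^{(\alpha)}:T^{(\alpha)}M\to TT^{(\alpha-1)}M$, $\alpha\ge1$, is $d_T^{(\alpha)}(j^\alpha_0q)=\frac{d}{dt}\big|_{t=0}(j^{\alpha-1}q)(t)$, where $(j^{\alpha-1}q)(t)=j^{\alpha-1}_0(q_t)$, $q_t(s)=q(t+s)$. *)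

theory Defs
  imports "HOL-Analysis.Analysis"
begin

section \<open>Smooth functions on open subsets of Euclidean spaces\<close>

text \<open>
  All model spaces are the library's \<^term>\<open>Euclidean_space m\<close>, i.e. the sequences vanishing
  from index \<open>m\<close> on.  The dimension is thus a term, and the bundles of all orders over one
  manifold live in the same framework.
\<close>

definition partial_deriv :: "nat \<Rightarrow> ((nat \<Rightarrow> real) \<Rightarrow> real) \<Rightarrow> (nat \<Rightarrow> real) \<Rightarrow> real" where
  "partial_deriv i f x = deriv (\<lambda>t. f (x(i := t))) (x i)"

fun C_diff_on :: "nat \<Rightarrow> nat \<Rightarrow> (nat \<Rightarrow> real) set \<Rightarrow> ((nat \<Rightarrow> real) \<Rightarrow> real) \<Rightarrow> bool" where
  "C_diff_on 0 m U f \<longleftrightarrow> continuous_map (subtopology (Euclidean_space m) U) euclideanreal f"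
| "C_diff_on (Suc r) m U f \<longleftrightarrow>
     continuous_map (subtopology (Euclidean_space m) U) euclideanreal f \<and>
     (\<forall>i<m. (\<forall>x\<in>U. (\<lambda>t. f (x(i := t))) field_differentiable (at (x i))) \<and>
            C_diff_on r m U (partial_deriv i f))"

definition smooth_fun_on :: "nat \<Rightarrow> (nat \<Rightarrow> real) set \<Rightarrow> ((nat \<Rightarrow> real) \<Rightarrow> real) \<Rightarrow> bool" where
  "smooth_fun_on m U f \<longleftrightarrow> openin (Euclidean_space m) U \<and> (\<forall>r. C_diff_on r m U f)"


section \<open>Smooth manifolds\<close>

text \<open>
  A manifold is given by a (not necessarily maximal) atlas on a set; its topology is the one
  for which all charts are homeomorphisms onto open sets.
\<close>

type_synonym 'a chart = "'a set \<times> ('a \<Rightarrow> nat \<Rightarrow> real)"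

record 'a mfd =
  mdim :: nat
  atlas :: "'a chart set"

definition points :: "'a mfd \<Rightarrow> 'a set" where
  "points M = (\<Union>(U, \<phi>)\<in>atlas M. U)"

definition mfd_open :: "'a mfd \<Rightarrow> 'a set \<Rightarrow> bool" where
  "mfd_open M W \<longleftrightarrow> W \<subseteq> points M \<and>
     (\<forall>(U, \<phi>)\<in>atlas M. openin (Euclidean_space (mdim M)) (\<phi> ` (U \<inter> W)))"

definition mfd_topology :: "'a mfd \<Rightarrow> 'a topology" where
  "mfd_topology M = topology (mfd_open M)"

definition smooth_manifold :: "'a mfd \<Rightarrow> bool" where
  "smooth_manifold M \<longleftrightarrow>
     (\<forall>(U, \<phi>)\<in>atlas M. inj_on \<phi> U \<and> openin (Euclidean_space (mdim M)) (\<phi> ` U)) \<and>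
     (\<forall>(U, \<phi>)\<in>atlas M. \<forall>(V, \<psi>)\<in>atlas M. \<forall>j<mdim M.
        smooth_fun_on (mdim M) (\<phi> ` (U \<inter> V)) (\<lambda>x. \<psi> (inv_into U \<phi> x) j)) \<and>
     (\<forall>(U, \<phi>)\<in>atlas M. \<forall>(V, \<psi>)\<in>atlas M.
        openin (Euclidean_space (mdim M)) (\<phi> ` (U \<inter> V))) \<and>
     Hausdorff_space (mfd_topology M) \<and> second_countable (mfd_topology M)"

lemma istopology_mfd_open:
  assumes "\<forall>(U, \<phi>)\<in>atlas M. inj_on \<phi> U"
  shows "istopology (mfd_open M)"
  unfolding istopology_def
proof (intro conjI allI impI)
  fix S T assume S: "mfd_open M S" and T: "mfd_open M T"
  have "openin (Euclidean_space (mdim M)) (\<phi> ` (U \<inter> (S \<inter> T)))" if "(U, \<phi>) \<in> atlas M" for U \<phi>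
  proof -
    have "inj_on \<phi> U" using assms that by auto
    then have "\<phi> ` (U \<inter> (S \<inter> T)) = \<phi> ` (U \<inter> S) \<inter> \<phi> ` (U \<inter> T)"
      by (auto simp: inj_on_def)
    then show ?thesis
      using S T that by (auto simp: mfd_open_def intro!: openin_Int)
  qed
  then show "mfd_open M (S \<inter> T)"
    using S by (auto simp: mfd_open_def)
next
  fix \<K> assume K: "\<forall>S\<in>\<K>. mfd_open M S"
  have "openin (Euclidean_space (mdim M)) (\<phi> ` (U \<inter> \<Union>\<K>))" if "(U, \<phi>) \<in> atlas M" for U \<phi>
  proof -
    have "\<phi> ` (U \<inter> \<Union>\<K>) = \<Union>((\<lambda>S. \<phi> ` (U \<inter> S)) ` \<K>)" by blast
    then show ?thesis
      using K that by (auto simp: mfd_open_def intro!: openin_Union)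
  qed
  then show "mfd_open M (\<Union>\<K>)"
    using K by (auto simp: mfd_open_def)
qed

lemma openin_mfd_topology:
  assumes "smooth_manifold M"
  shows "openin (mfd_topology M) W \<longleftrightarrow> mfd_open M W"
proof -
  have "istopology (mfd_open M)"
    using assms by (intro istopology_mfd_open) (auto simp: smooth_manifold_def)
  then show ?thesis by (simp add: mfd_topology_def)
qed

definition smooth_map :: "'a mfd \<Rightarrow> 'b mfd \<Rightarrow> ('a \<Rightarrow> 'b) \<Rightarrow> bool" where
  "smooth_map M N f \<longleftrightarrow> f \<in> points M \<rightarrow> points N \<and>
     (\<forall>(U, \<phi>)\<in>atlas M. \<forall>(V, \<psi>)\<in>atlas N.
        openin (Euclidean_space (mdim M)) (\<phi> ` (U \<inter> f -` V)) \<and>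
        (\<forall>j<mdim N. smooth_fun_on (mdim M) (\<phi> ` (U \<inter> f -` V)) (\<lambda>x. \<psi> (f (inv_into U \<phi> x)) j)))"

definition diffeomorphism :: "'a mfd \<Rightarrow> 'b mfd \<Rightarrow> ('a \<Rightarrow> 'b) \<Rightarrow> bool" where
  "diffeomorphism M N f \<longleftrightarrow> bij_betw f (points M) (points N) \<and>
     smooth_map M N f \<and> smooth_map N M (inv_into (points M) f)"

definition restrict_mfd :: "'a mfd \<Rightarrow> 'a set \<Rightarrow> 'a mfd" where
  "restrict_mfd M W = \<lparr>mdim = mdim M, atlas = {(U \<inter> W, \<phi>) | U \<phi>. (U, \<phi>) \<in> atlas M}\<rparr>"

definition times_euclidean :: "'a mfd \<Rightarrow> nat \<Rightarrow> ('a \<times> (nat \<Rightarrow> real)) mfd" where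
  "times_euclidean M r = \<lparr>mdim = mdim M + r,
     atlas = {(U \<times> topspace (Euclidean_space r),
               \<lambda>(x, a) j. if j < mdim M then \<phi> x j else a (j - mdim M)) | U \<phi>. (U, \<phi>) \<in> atlas M}\<rparr>"


section \<open>Smooth vector bundles\<close>

definition real_vector_space_on ::
  "'e set \<Rightarrow> ('e \<Rightarrow> 'e \<Rightarrow> 'e) \<Rightarrow> (real \<Rightarrow> 'e \<Rightarrow> 'e) \<Rightarrow> bool" where
  "real_vector_space_on V add smul \<longleftrightarrow>
     (\<forall>v\<in>V. \<forall>w\<in>V. add v w \<in> V \<and> add v w = add w v) \<and>
     (\<forall>u\<in>V. \<forall>v\<in>V. \<forall>w\<in>V. add (add u v) w = add u (add v w)) \<and>
     (\<exists>z\<in>V. \<forall>v\<in>V. add z v = v \<and> (\<exists>w\<in>V. add v w = z)) \<and>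
     (\<forall>c. \<forall>v\<in>V. smul c v \<in> V) \<and>
     (\<forall>v\<in>V. smul 1 v = v) \<and>
     (\<forall>c d. \<forall>v\<in>V. smul c (smul d v) = smul (c * d) v) \<and>
     (\<forall>c d. \<forall>v\<in>V. smul (c + d) v = add (smul c v) (smul d v)) \<and>
     (\<forall>c. \<forall>v\<in>V. \<forall>w\<in>V. smul c (add v w) = add (smul c v) (smul c w))"

definition fibre :: "'e mfd \<Rightarrow> ('e \<Rightarrow> 'a) \<Rightarrow> 'a \<Rightarrow> 'e set" where
  "fibre E p x = {u \<in> points E. p u = x}"

definition local_trivialization ::
  "'e mfd \<Rightarrow> 'a mfd \<Rightarrow> ('e \<Rightarrow> 'a) \<Rightarrow> nat \<Rightarrow> ('e \<Rightarrow> 'e \<Rightarrow> 'e) \<Rightarrow> (real \<Rightarrow> 'e \<Rightarrow> 'e) \<Rightarrow>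
    'a set \<Rightarrow> ('e \<Rightarrow> 'a \<times> (nat \<Rightarrow> real)) \<Rightarrow> bool" where
  "local_trivialization E M p r add smul W \<Phi> \<longleftrightarrow>
     diffeomorphism (restrict_mfd E (p -` W)) (times_euclidean (restrict_mfd M W) r) \<Phi> \<and>
     (\<forall>u\<in>points E. p u \<in> W \<longrightarrow> fst (\<Phi> u) = p u) \<and>
     (\<forall>x\<in>W. \<forall>u\<in>fibre E p x.
        (\<forall>w\<in>fibre E p x. snd (\<Phi> (add u w)) = (\<lambda>i. snd (\<Phi> u) i + snd (\<Phi> w) i)) \<and>
        (\<forall>c. snd (\<Phi> (smul c u)) = (\<lambda>i. c * snd (\<Phi> u) i)))"

definition smooth_vector_bundle ::
  "'e mfd \<Rightarrow> 'a mfd \<Rightarrow> ('e \<Rightarrow> 'a) \<Rightarrow> nat \<Rightarrow> ('e \<Rightarrow> 'e \<Rightarrow> 'e) \<Rightarrow> (real \<Rightarrow> 'e \<Rightarrow> 'e) \<Rightarrow> bool" where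
  "smooth_vector_bundle E M p r add smul \<longleftrightarrow>
     smooth_manifold E \<and> smooth_manifold M \<and>
     smooth_map E M p \<and> p ` points E = points M \<and>
     (\<forall>x\<in>points M. real_vector_space_on (fibre E p x) add smul) \<and>
     (\<forall>x\<in>points M. \<exists>W \<Phi>. openin (mfd_topology M) W \<and> x \<in> W \<and>
        local_trivialization E M p r add smul W \<Phi>)"

text \<open>Transport of fibrewise operations along a bijection \<open>f\<close> defined on \<open>A\<close>.\<close>

definition pullback_add :: "'e set \<Rightarrow> ('e \<Rightarrow> 'f) \<Rightarrow> ('f \<Rightarrow> 'f \<Rightarrow> 'f) \<Rightarrow> 'e \<Rightarrow> 'e \<Rightarrow> 'e" where
  "pullback_add A f add u w = inv_into A f (add (f u) (f w))"

definition pullback_scale :: "'e set \<Rightarrow> ('e \<Rightarrow> 'f) \<Rightarrow> (real \<Rightarrow> 'f \<Rightarrow> 'f) \<Rightarrow> real \<Rightarrow> 'e \<Rightarrow> 'e" where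
  "pullback_scale A f smul c u = inv_into A f (smul c (f u))"


section \<open>Jets of curves and higher order tangent bundles\<close>

definition smooth_curve_on :: "'a mfd \<Rightarrow> real set \<Rightarrow> (real \<Rightarrow> 'a) \<Rightarrow> bool" where
  "smooth_curve_on M I q \<longleftrightarrow> (\<forall>t\<in>I. q t \<in> points M \<and>
     (\<forall>(U, \<phi>)\<in>atlas M. q t \<in> U \<longrightarrow>
        (\<exists>\<delta>>0. \<forall>s. \<bar>s - t\<bar> < \<delta> \<longrightarrow> q s \<in> U \<and>
           (\<forall>r. \<forall>i<mdim M. (deriv ^^ r) (\<lambda>s. \<phi> (q s) i) field_differentiable (at s)))))"

text \<open>A curve has to be smooth on some open interval around \<open>0\<close> only; its values far from \<open>0\<close>
  are irrelevant.\<close>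

definition curve :: "'a mfd \<Rightarrow> (real \<Rightarrow> 'a) \<Rightarrow> bool" where
  "curve M q \<longleftrightarrow> (\<exists>\<epsilon>>0. smooth_curve_on M {-\<epsilon><..<\<epsilon>} q)"

definition jet_equiv :: "'a mfd \<Rightarrow> nat \<Rightarrow> (real \<Rightarrow> 'a) \<Rightarrow> (real \<Rightarrow> 'a) \<Rightarrow> bool" where
  "jet_equiv M k q r \<longleftrightarrow> q 0 = r 0 \<and>
     (\<exists>(U, \<phi>)\<in>atlas M. q 0 \<in> U \<and>
        (\<forall>\<alpha>\<le>k. \<forall>i<mdim M.
           (deriv ^^ \<alpha>) (\<lambda>t. \<phi> (q t) i) 0 = (deriv ^^ \<alpha>) (\<lambda>t. \<phi> (r t) i) 0))"

type_synonym 'a jet = "(real \<Rightarrow> 'a) set"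

definition jet :: "'a mfd \<Rightarrow> nat \<Rightarrow> (real \<Rightarrow> 'a) \<Rightarrow> 'a jet" where
  "jet M k q = {r. curve M r \<and> jet_equiv M k q r}"

definition rep :: "'a jet \<Rightarrow> real \<Rightarrow> 'a" where
  "rep u = (SOME q. q \<in> u)"

definition jet_base :: "'a jet \<Rightarrow> 'a" where
  "jet_base u = rep u 0"

definition jet_proj :: "'a mfd \<Rightarrow> nat \<Rightarrow> 'a jet \<Rightarrow> 'a jet" where
  "jet_proj M \<alpha> u = jet M \<alpha> (rep u)"

text \<open>Coordinate \<open>q\<^sup>(\<^sup>\<alpha>\<^sup>)\<^sup>i\<close> is stored at index \<open>\<alpha> * n + i\<close>, where \<open>n\<close> is the dimension of \<open>M\<close>.\<close>

definition jet_chart :: "'a mfd \<Rightarrow> nat \<Rightarrow> ('a \<Rightarrow> nat \<Rightarrow> real) \<Rightarrow> 'a jet \<Rightarrow> nat \<Rightarrow> real" where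
  "jet_chart M k \<phi> u j =
     (if j < (k + 1) * mdim M
      then (deriv ^^ (j div mdim M)) (\<lambda>t. \<phi> (rep u t) (j mod mdim M)) 0 / fact (j div mdim M)
      else 0)"

definition jet_bundle :: "'a mfd \<Rightarrow> nat \<Rightarrow> 'a jet mfd" where
  "jet_bundle M k = \<lparr>mdim = (k + 1) * mdim M,
     atlas = {({jet M k q | q. curve M q \<and> q 0 \<in> U}, jet_chart M k \<phi>) | U \<phi>. (U, \<phi>) \<in> atlas M}\<rparr>"


section \<open>Tangent spaces\<close>

abbreviation tangent_bundle :: "'a mfd \<Rightarrow> 'a jet mfd" where
  "tangent_bundle M \<equiv> jet_bundle M 1"

definition tangent_space :: "'a mfd \<Rightarrow> 'a \<Rightarrow> 'a jet set" where
  "tangent_space M x = fibre (tangent_bundle M) jet_base x"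

definition tangent_map :: "'b mfd \<Rightarrow> ('a \<Rightarrow> 'b) \<Rightarrow> 'a jet \<Rightarrow> 'b jet" where
  "tangent_map N f v = jet N 1 (f \<circ> rep v)"

definition tangent_coord :: "('a \<Rightarrow> nat \<Rightarrow> real) \<Rightarrow> 'a jet \<Rightarrow> nat \<Rightarrow> real" where
  "tangent_coord \<phi> v i = deriv (\<lambda>t. \<phi> (rep v t) i) 0"

text \<open>The tangent vector at \<open>x\<close> whose components in each chart are given by \<open>a\<close>.\<close>

definition tangent_vector :: "'a mfd \<Rightarrow> 'a \<Rightarrow> (('a \<Rightarrow> nat \<Rightarrow> real) \<Rightarrow> nat \<Rightarrow> real) \<Rightarrow> 'a jet" where
  "tangent_vector M x a = (THE v. v \<in> tangent_space M x \<and>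
     (\<forall>(U, \<phi>)\<in>atlas M. x \<in> U \<longrightarrow> (\<forall>i<mdim M. tangent_coord \<phi> v i = a \<phi> i)))"

definition tangent_add :: "'a mfd \<Rightarrow> 'a jet \<Rightarrow> 'a jet \<Rightarrow> 'a jet" where
  "tangent_add M v w =
     tangent_vector M (jet_base v) (\<lambda>\<phi> i. tangent_coord \<phi> v i + tangent_coord \<phi> w i)"

definition tangent_scale :: "'a mfd \<Rightarrow> real \<Rightarrow> 'a jet \<Rightarrow> 'a jet" where
  "tangent_scale M c v = tangent_vector M (jet_base v) (\<lambda>\<phi> i. c * tangent_coord \<phi> v i)"

definition tangent_linear :: "'a mfd \<Rightarrow> 'a \<Rightarrow> 'b mfd \<Rightarrow> 'b \<Rightarrow> ('a jet \<Rightarrow> 'b jet) \<Rightarrow> bool" where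
  "tangent_linear M x N y f \<longleftrightarrow> f \<in> tangent_space M x \<rightarrow> tangent_space N y \<and>
     (\<forall>v\<in>tangent_space M x. \<forall>w\<in>tangent_space M x.
        f (tangent_add M v w) = tangent_add N (f v) (f w)) \<and>
     (\<forall>c. \<forall>v\<in>tangent_space M x. f (tangent_scale M c v) = tangent_scale N c (f v))"

text \<open>
  The almost tangent structure on the jet bundle of order \<open>k\<close>.  With the indexing of
  \<^const>\<open>jet_chart\<close>, sending \<open>\<partial>/\<partial>q\<^sup>(\<^sup>\<alpha>\<^sup>)\<^sup>i\<close> to \<open>\<partial>/\<partial>q\<^sup>(\<^sup>\<alpha>\<^sup>+\<^sup>1\<^sup>)\<^sup>i\<close> (and to \<open>0\<close> for \<open>\<alpha> = k\<close>) shifts the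
  components of a tangent vector by \<open>n\<close> places.
\<close>

definition almost_tangent :: "'a mfd \<Rightarrow> nat \<Rightarrow> 'a jet jet \<Rightarrow> 'a jet jet" where
  "almost_tangent M k v = tangent_vector (jet_bundle M k) (jet_base v)
     (\<lambda>\<phi> j. if j < mdim M then 0 else tangent_coord \<phi> v (j - mdim M))"


section \<open>Whitney sums of the tangent bundle\<close>

text \<open>
  For \<open>k \<ge> 1\<close>, the Whitney sum of \<open>k\<close> copies of the tangent bundle consists of the lists of \<open>k\<close>
  tangent vectors with a common base point.
\<close>

definition whitney_proj :: "'a jet list \<Rightarrow> 'a" where
  "whitney_proj vs = jet_base (hd vs)"

definition whitney_chart :: "'a mfd \<Rightarrow> nat \<Rightarrow> ('a \<Rightarrow> nat \<Rightarrow> real) \<Rightarrow> 'a jet list \<Rightarrow> nat \<Rightarrow> real" where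
  "whitney_chart M k \<phi> vs j =
     (if j < mdim M then \<phi> (whitney_proj vs) j
      else if j < (k + 1) * mdim M
        then tangent_coord \<phi> (vs ! (j div mdim M - 1)) (j mod mdim M)
      else 0)"

definition whitney_sum :: "'a mfd \<Rightarrow> nat \<Rightarrow> 'a jet list mfd" where
  "whitney_sum M k = \<lparr>mdim = (k + 1) * mdim M,
     atlas = {({vs. length vs = k \<and> (\<exists>x\<in>U. set vs \<subseteq> tangent_space M x)}, whitney_chart M k \<phi>)
              | U \<phi>. (U, \<phi>) \<in> atlas M}\<rparr>"

definition whitney_add :: "'a mfd \<Rightarrow> 'a jet list \<Rightarrow> 'a jet list \<Rightarrow> 'a jet list" where
  "whitney_add M vs ws = map2 (tangent_add M) vs ws"

definition whitney_scale :: "'a mfd \<Rightarrow> real \<Rightarrow> 'a jet list \<Rightarrow> 'a jet list" where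
  "whitney_scale M c vs = map (tangent_scale M c) vs"


section \<open>Connection maps and connection towers\<close>

text \<open>A connection map is represented by the family of its components \<open>K 1, \<dots>, K k\<close>.\<close>

definition connection_map ::
  "'a mfd \<Rightarrow> nat \<Rightarrow> (nat \<Rightarrow> 'a jet jet \<Rightarrow> 'a jet) \<Rightarrow> bool" where
  "connection_map M k K \<longleftrightarrow>
     smooth_map (tangent_bundle (jet_bundle M k)) (whitney_sum M k)
       (\<lambda>v. map (\<lambda>\<alpha>. K \<alpha> v) [1..<Suc k]) \<and>
     (\<forall>\<alpha>\<in>{1..k}. \<forall>u\<in>points (jet_bundle M k).
        tangent_linear (jet_bundle M k) u M (jet_base u) (K \<alpha>)) \<and>
     (\<forall>\<alpha>\<in>{1..<k}. \<forall>v\<in>points (tangent_bundle (jet_bundle M k)).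
        K (Suc \<alpha>) (almost_tangent M k v) = K \<alpha> v) \<and>
     (\<forall>v\<in>points (tangent_bundle (jet_bundle M k)).
        K 1 (almost_tangent M k v) = tangent_map M jet_base v)"

text \<open>\<open>L\<close> is a map, defined on the tangent bundle of the order \<open>\<alpha>\<close> jet bundle, through which
  the component \<open>K \<alpha>\<close> factors.\<close>

definition tower_factor ::
  "'a mfd \<Rightarrow> nat \<Rightarrow> (nat \<Rightarrow> 'a jet jet \<Rightarrow> 'a jet) \<Rightarrow> nat \<Rightarrow> ('a jet jet \<Rightarrow> 'a jet) \<Rightarrow> bool" where
  "tower_factor M k K \<alpha> L \<longleftrightarrow>
     L \<in> points (tangent_bundle (jet_bundle M \<alpha>)) \<rightarrow>\<^sub>E points (tangent_bundle M) \<and>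
     (\<forall>v\<in>points (tangent_bundle (jet_bundle M k)).
        K \<alpha> v = L (tangent_map (jet_bundle M \<alpha>) (jet_proj M \<alpha>) v))"

definition connection_tower ::
  "'a mfd \<Rightarrow> nat \<Rightarrow> (nat \<Rightarrow> 'a jet jet \<Rightarrow> 'a jet) \<Rightarrow> bool" where
  "connection_tower M k K \<longleftrightarrow> connection_map M k K \<and>
     (\<forall>\<alpha>\<in>{1..k}. \<exists>!L. tower_factor M k K \<alpha> L)"

text \<open>For a tower, \<open>tower_top M k K \<alpha>\<close> is the last component of the associated connection map of
  order \<open>\<alpha>\<close>; the other components are compositions of the \<open>tower_top M k K \<mu>\<close> with tangent maps.\<close>

definition tower_top ::
  "'a mfd \<Rightarrow> nat \<Rightarrow> (nat \<Rightarrow> 'a jet jet \<Rightarrow> 'a jet) \<Rightarrow> nat \<Rightarrow> 'a jet jet \<Rightarrow> 'a jet" where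
  "tower_top M k K \<alpha> = (THE L. tower_factor M k K \<alpha> L)"


section \<open>The Tulczyjew operator and the maps \<open>F\<close>\<close>

definition tulczyjew :: "'a mfd \<Rightarrow> nat \<Rightarrow> 'a jet \<Rightarrow> 'a jet jet" where
  "tulczyjew M \<alpha> u =
     jet (jet_bundle M (\<alpha> - 1)) 1 (\<lambda>t. jet M (\<alpha> - 1) (\<lambda>s. rep u (t + s)))"

text \<open>
  In the first component the order \<open>0\<close> jet bundle is identified with \<open>M\<close> by means of
  \<^const>\<open>jet_base\<close>, whose tangent map turns the value of \<^term>\<open>tulczyjew M 1\<close> into a tangent vector
  of \<open>M\<close>.
\<close>

definition tower_F ::
  "'a mfd \<Rightarrow> nat \<Rightarrow> (nat \<Rightarrow> 'a jet jet \<Rightarrow> 'a jet) \<Rightarrow> nat \<Rightarrow> 'a jet \<Rightarrow> 'a jet list" where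
  "tower_F M k K \<alpha> u = map (\<lambda>\<mu>.
     let w = tulczyjew M (Suc \<mu>) (jet_proj M (Suc \<mu>) u)
     in if \<mu> = 0 then tangent_map M jet_base w
        else tangent_scale M (fact \<mu>) (tower_top M k K \<mu> w)) [0..<\<alpha>]"

end

theory Submission
  imports Defs
begin

text \<open>
  Everything is done in the coordinates of a chart.  The conditions \<open>K\<^sub>\<alpha>\<^sub>+\<^sub>1 \<circ> J = K\<^sub>\<alpha>\<close> and
  \<open>K\<^sub>1 \<circ> J = \<tau>\<^sub>*\<close> force \<open>K\<^sub>\<mu>\<close> to read off the \<open>\<mu>\<close>-th component of a vector whose components of lower
  order vanish, and the tower condition makes \<open>K\<^sub>\<mu>\<close> blind to the components of order above \<open>\<mu>\<close>.
  As the top component of the Tulczyjew operator is \<open>(\<mu> + 1) * q\<^sup>(\<^sup>\<mu>\<^sup>+\<^sup>1\<^sup>)\<close>, component \<open>\<mu> + 1\<close> of \<open>F\<close>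
  is \<open>(\<mu> + 1)! * q\<^sup>(\<^sup>\<mu>\<^sup>+\<^sup>1\<^sup>)\<close> plus a smooth function of \<open>q\<^sup>(\<^sup>0\<^sup>), \<dots>, q\<^sup>(\<^sup>\<mu>\<^sup>)\<close>.  So \<open>F\<close> is triangular with
  constant invertible diagonal, and its inverse is found, and seen to be smooth, by solving for
  one coordinate after the other.
\<close>

section \<open>Smooth functions of finitely many coordinates\<close>

text \<open>Three points shape the proof. \<open>tangent_vector\<close>, and with it
  \<open>almost_tangent\<close>, is a definite description that prescribes components in all charts
  at once; before \<open>J\<close> can be used, the prescription must be shown compatible with chart
  changes. This leads to the transition functions of jets, whose Jacobian has to commute with the
  shift by one block. Next, \<open>connection_map\<close> gives smoothness of \<open>K\<close> over
  the bundle of order \<open>k\<close> only, while \<open>tower_top\<close> is merely a map of sets.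
  So \<open>K \<mu>\<close> is always evaluated over a \<open>k\<close>-jet that is filled up with
  zeros, which also makes the result independent of the coordinates above \<mu>. Its argument splits
  into the blocks below \<mu>, which yield the remainder, and block \<mu>, the only one in which
  \<open>q\<^sup>(\<^sup>\<mu>\<^sup>+\<^sup>1\<^sup>)\<close> occurs. Finally, jets are sets of
  curves, so a jet with given coordinates has to be produced by an actual curve: a polynomial in a
  chart. The vector bundle structure costs little after that, since the fibre blocks of the Whitney
  charts, composed with \<open>F\<close>, are linear for the pulled back operations.\<close>

abbreviation esp :: "nat \<Rightarrow> (nat \<Rightarrow> real) set" where
  "esp m \<equiv> topspace (Euclidean_space m)"

section \<open>Open sets and continuity in terms of finitely many coordinates\<close>

lemma mem_esp: "x \<in> esp m \<longleftrightarrow> (\<forall>i\<ge>m. x i = 0)"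
  by (simp add: topspace_Euclidean_space)

lemma Euclidean_space_top_of_set: "Euclidean_space m = top_of_set (esp m)"
  unfolding topspace_Euclidean_space by (simp add: Euclidean_space_def euclidean_product_topology)

lemma openin_Euclidean_space_open: "openin (Euclidean_space m) U \<longleftrightarrow> (\<exists>T. open T \<and> U = T \<inter> esp m)"
  by (subst Euclidean_space_top_of_set) (auto simp: openin_open)

lemma open_box: "open {y :: nat \<Rightarrow> real. \<forall>i<m. \<bar>y i - x i\<bar> < e}"
proof -
  have "{y :: nat \<Rightarrow> real. \<forall>i<m. \<bar>y i - x i\<bar> < e} = (\<Inter>i\<in>{..<m}. {y. \<bar>y i - x i\<bar> < e})"
    by auto
  moreover have "open {y :: nat \<Rightarrow> real. \<bar>y i - x i\<bar> < e}" for i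
    by (intro open_Collect_less continuous_intros continuous_on_product_coordinates)
  ultimately show ?thesis by (metis (no_types, lifting) finite_lessThan open_INT)
qed

text \<open>An open set of the product topology contains, around each point, a box restricting only
  finitely many coordinates, and on \<open>esp m\<close> all coordinates from \<open>m\<close> on
  are 0. So boxes in the first \<open>m\<close> coordinates are enough, and the later epsilon
  arguments run with these boxes.\<close>

lemma openin_Euclidean_space_iff:
  "openin (Euclidean_space m) U \<longleftrightarrow> U \<subseteq> esp m \<and>
     (\<forall>x\<in>U. \<exists>e>0. \<forall>y\<in>esp m. (\<forall>i<m. \<bar>y i - x i\<bar> < e) \<longrightarrow> y \<in> U)" (is "?l \<longleftrightarrow> ?r")
proof
  assume ?l
  then obtain T where T: "open T" "U = T \<inter> esp m"
    by (auto simp: openin_Euclidean_space_open)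
  have "\<exists>e>0. \<forall>y\<in>esp m. (\<forall>i<m. \<bar>y i - x i\<bar> < e) \<longrightarrow> y \<in> U" if x: "x \<in> U" for x
  proof -
    have "x \<in> T" using x T by auto
    have "openin (product_topology (\<lambda>i. euclidean) UNIV) T"
      using T by (metis euclidean_product_topology open_openin)
    then obtain V where V: "finite {i. V i \<noteq> UNIV}" "\<And>i. open (V i)" "x \<in> Pi\<^sub>E UNIV V" "Pi\<^sub>E UNIV V \<subseteq> T"
      using \<open>x \<in> T\<close> unfolding openin_product_topology_alt by auto
    \<comment> \<open>Only finitely many \<open>V i\<close> differ from \<open>UNIV\<close>, so one
      radius can serve all of them.\<close>
    have "\<exists>e>0. \<forall>i\<in>F. \<forall>y. \<bar>y - x i\<bar> < e \<longrightarrow> y \<in> V i" if "finite F" for F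
      using that
    proof induction
      case (insert j F)
      then obtain e where e: "e > 0" "\<forall>i\<in>F. \<forall>y. \<bar>y - x i\<bar> < e \<longrightarrow> y \<in> V i" by blast
      have "x j \<in> V j" using V(3) by auto
      then obtain d where d: "d > 0" "\<forall>y. dist y (x j) < d \<longrightarrow> y \<in> V j"
        using V(2)[of j] unfolding open_dist by blast
      show ?case
        using e d by (intro exI[of _ "min e d"]) (auto simp: dist_real_def)
    next
      case empty
      show ?case by (rule exI[of _ 1]) simp
    qed
    from this[OF V(1)] obtain e where e: "e > 0" and e': "\<forall>i\<in>{i. V i \<noteq> UNIV}. \<forall>y. \<bar>y - x i\<bar> < e \<longrightarrow> y \<in> V i"
      by (elim exE conjE)
    have "y \<in> U" if y: "y \<in> esp m" "\<forall>i<m. \<bar>y i - x i\<bar> < e" for y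
    proof -
      \<comment> \<open>From index \<open>m\<close> on both \<open>x\<close> and \<open>y\<close>
        vanish.\<close>
      have "\<bar>y i - x i\<bar> < e" for i
        using y x T e by (cases "i < m") (auto simp: mem_esp)
      then have "y i \<in> V i" for i using e' by (cases "V i = UNIV") simp_all
      then have "y \<in> T" using V(4) by auto
      then show ?thesis using T y by auto
    qed
    then show ?thesis using e by blast
  qed
  then show ?r using T by auto
next
  assume r: ?r
  show ?l
  proof (subst openin_subopen, intro ballI)
    fix x assume x: "x \<in> U"
    then obtain e where e: "e > 0" "\<forall>y\<in>esp m. (\<forall>i<m. \<bar>y i - x i\<bar> < e) \<longrightarrow> y \<in> U" using r by blast
    have "openin (Euclidean_space m) ({y. \<forall>i<m. \<bar>y i - x i\<bar> < e} \<inter> esp m)"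
      using open_box by (auto simp: openin_Euclidean_space_open)
    then show "\<exists>T. openin (Euclidean_space m) T \<and> x \<in> T \<and> T \<subseteq> U"
      using e x r by (intro exI[of _ "{y. \<forall>i<m. \<bar>y i - x i\<bar> < e} \<inter> esp m"]) auto
  qed
qed

lemma continuous_map_Euclidean_sub_iff:
  assumes "U \<subseteq> esp m"
  shows "continuous_map (subtopology (Euclidean_space m) U) euclideanreal f \<longleftrightarrow> continuous_on U f"
  using assms by (subst Euclidean_space_top_of_set) (simp add: subtopology_subtopology inf.absorb2)

lemma continuous_on_boxD:
  fixes f :: "(nat \<Rightarrow> real) \<Rightarrow> real"
  assumes "continuous_on U f" "openin (Euclidean_space m) U" "x \<in> U" "e > 0"
  obtains d where "d > 0" "\<And>y. y \<in> esp m \<Longrightarrow> (\<forall>i<m. \<bar>y i - x i\<bar> < d) \<Longrightarrow> y \<in> U \<and> \<bar>f y - f x\<bar> < e"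
proof -
  have "openin (top_of_set U) (U \<inter> f -` {f x - e <..< f x + e})"
    using assms(1) by (intro continuous_openin_preimage_gen) auto
  then have "openin (Euclidean_space m) (U \<inter> f -` {f x - e <..< f x + e})"
    using openin_trans[of U _ "esp m"] assms(2) unfolding Euclidean_space_top_of_set[symmetric] by blast
  moreover have "x \<in> U \<inter> f -` {f x - e <..< f x + e}" using assms by auto
  ultimately obtain d where "d > 0" "\<forall>y\<in>esp m. (\<forall>i<m. \<bar>y i - x i\<bar> < d) \<longrightarrow> y \<in> U \<inter> f -` {f x - e <..< f x + e}"
    unfolding openin_Euclidean_space_iff by blast
  then show ?thesis by (intro that[of d]) (auto simp: abs_less_iff)
qed

section \<open>Functions of class C^r: congruence and locality\<close>

lemma C_diff_on_continuous:
  assumes "C_diff_on r m U f" "U \<subseteq> esp m" shows "continuous_on U f"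
  using assms by (cases r) (simp_all add: continuous_map_Euclidean_sub_iff)

lemma C_diff_on_mono: "C_diff_on r m U f \<Longrightarrow> s \<le> r \<Longrightarrow> C_diff_on s m U f"
proof (induction s arbitrary: r f)
  case 0
  then show ?case by (cases r) auto
next
  case (Suc s)
  then show ?case by (cases r) auto
qed

lemma eventually_update_in:
  assumes "openin (Euclidean_space m) U" "x \<in> U" "i < m"
  shows "\<forall>\<^sub>F t in nhds (x i). x(i := t) \<in> U"
proof -
  obtain e where e: "e > 0" "\<forall>y\<in>esp m. (\<forall>i<m. \<bar>y i - x i\<bar> < e) \<longrightarrow> y \<in> U"
    using assms unfolding openin_Euclidean_space_iff by blast
  have "x \<in> esp m" using assms unfolding openin_Euclidean_space_iff by auto
  then have "x(i := t) \<in> U" if "dist t (x i) < e" for t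
    using e that assms(3) by (auto simp: dist_real_def mem_esp)
  then show ?thesis using e(1) unfolding eventually_nhds_metric by blast
qed

lemma partial_deriv_cong:
  assumes "openin (Euclidean_space m) U" "x \<in> U" "i < m" "\<And>x. x \<in> U \<Longrightarrow> f x = g x"
  shows "partial_deriv i f x = partial_deriv i g x"
  unfolding partial_deriv_def
  by (intro deriv_cong_ev eventually_mono[OF eventually_update_in[OF assms(1-3)]]) (use assms in auto)

lemma field_differentiable_cong_ev:
  assumes "\<forall>\<^sub>F t in nhds x. f t = g t"
  shows "f field_differentiable (at x) \<longleftrightarrow> g field_differentiable (at x)"
  unfolding field_differentiable_def using DERIV_cong_ev[OF refl assms refl] by simp

text \<open>By openness the coordinate lines through a point of \<open>U\<close> stay in
  \<open>U\<close> for nearby parameters, so agreement on \<open>U\<close> passes to the partial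
  derivatives.\<close>

lemma C_diff_on_cong:
  assumes "openin (Euclidean_space m) U" "C_diff_on r m U f" "\<And>x. x \<in> U \<Longrightarrow> f x = g x"
  shows "C_diff_on r m U g"
  using assms(2,3)
proof (induction r arbitrary: f g)
  case 0
  then show ?case
    by (auto intro: continuous_map_eq)
next
  case (Suc r)
  have c: "continuous_map (subtopology (Euclidean_space m) U) euclideanreal g"
    using Suc.prems by (auto intro: continuous_map_eq)
  have "(\<lambda>t. g (x(i := t))) field_differentiable (at (x i))" if "i < m" "x \<in> U" for i x
  proof -
    have "\<forall>\<^sub>F t in nhds (x i). f (x(i := t)) = g (x(i := t))"
      using eventually_update_in[OF assms(1) that(2,1)] by eventually_elim (rule Suc.prems(2))
    from field_differentiable_cong_ev[OF this] show ?thesis using Suc.prems(1) that by auto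
  qed
  moreover have "C_diff_on r m U (partial_deriv i g)" if "i < m" for i
  proof (rule Suc.IH)
    show "C_diff_on r m U (partial_deriv i f)" using Suc.prems(1) that by simp
    show "\<And>x. x \<in> U \<Longrightarrow> partial_deriv i f x = partial_deriv i g x"
      by (rule partial_deriv_cong[OF assms(1) _ that Suc.prems(2)])
  qed
  ultimately show ?case using c by simp
qed

lemma C_diff_on_subset: "C_diff_on r m U f \<Longrightarrow> V \<subseteq> U \<Longrightarrow> C_diff_on r m V f"
proof (induction r arbitrary: f)
  case 0
  then show ?case
    by (metis C_diff_on.simps(1) continuous_map_from_subtopology inf.absorb2 subtopology_subtopology)
next
  case (Suc r)
  then show ?case
    by (auto intro: continuous_map_from_subtopology_mono)
qed

lemma continuous_on_openin_local:
  assumes U: "openin (Euclidean_space m) U"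
    and *: "\<And>x. x \<in> U \<Longrightarrow> \<exists>V. openin (Euclidean_space m) V \<and> x \<in> V \<and> continuous_on V f"
  shows "continuous_on U f"
proof -
  have "continuous (at x within U) f" if x: "x \<in> U" for x
  proof -
    obtain V where V: "openin (Euclidean_space m) V" "x \<in> V" "continuous_on V f"
      using *[OF x] by (elim exE conjE)
    then have c: "continuous (at x within V) f" by (simp add: continuous_on_eq_continuous_within)
    obtain T where T: "open T" "V = T \<inter> esp m"
      using V(1) unfolding openin_Euclidean_space_open by (elim exE conjE)
    obtain S where S: "open S" "U = S \<inter> esp m"
      using U unfolding openin_Euclidean_space_open by (elim exE conjE)
    \<comment> \<open>Both sets are open in \<open>esp m\<close>, so they coincide near
      \<open>x\<close>.\<close>
    have "at x within V = at x within U"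
    proof (rule at_within_nhd)
      show "x \<in> S \<inter> T" using x V(2) unfolding T(2) S(2) by blast
      show "open (S \<inter> T)" using T(1) S(1) by (rule open_Int[rotated])
      show "V \<inter> (S \<inter> T) - {x} = U \<inter> (S \<inter> T) - {x}" unfolding T(2) S(2) by blast
    qed
    with c show ?thesis by simp
  qed
  then show ?thesis by (simp add: continuous_on_eq_continuous_within)
qed

lemma C_diff_on_local:
  assumes U: "openin (Euclidean_space m) U"
    and "\<And>x. x \<in> U \<Longrightarrow> \<exists>V. openin (Euclidean_space m) V \<and> x \<in> V \<and> C_diff_on r m V f"
  shows "C_diff_on r m U f"
  using assms(2)
proof (induction r arbitrary: f)
  case 0
  have "continuous_on U f"
  proof (rule continuous_on_openin_local[OF U])
    fix x assume "x \<in> U"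
    from 0[OF this] show "\<exists>V. openin (Euclidean_space m) V \<and> x \<in> V \<and> continuous_on V f"
      using C_diff_on_continuous[OF _ openin_subset] by metis
  qed
  then show ?case
    by (simp add: continuous_map_Euclidean_sub_iff[OF openin_subset[OF U]])
next
  case (Suc r)
  have "continuous_on U f"
  proof (rule continuous_on_openin_local[OF U])
    fix x assume "x \<in> U"
    from Suc.prems[OF this] show "\<exists>V. openin (Euclidean_space m) V \<and> x \<in> V \<and> continuous_on V f"
      using C_diff_on_continuous[OF _ openin_subset] by metis
  qed
  moreover have "C_diff_on r m U (partial_deriv i f)" if "i < m" for i
  proof (rule Suc.IH)
    fix x assume "x \<in> U"
    from Suc.prems[OF this] show "\<exists>V. openin (Euclidean_space m) V \<and> x \<in> V \<and> C_diff_on r m V (partial_deriv i f)"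
      using that by auto
  qed
  moreover have "(\<lambda>t. f (x(i := t))) field_differentiable (at (x i))" if "i < m" "x \<in> U" for i x
    using Suc.prems[OF that(2)] that by auto
  ultimately show ?case
    by (simp add: continuous_map_Euclidean_sub_iff[OF openin_subset[OF U]])
qed

section \<open>Mean value theorem and chain rule\<close>

lemma partial_deriv_DERIV:
  assumes "C_diff_on (Suc r) m U f" "x \<in> U" "i < m" "s = x i"
  shows "((\<lambda>t. f (x(i := t))) has_real_derivative partial_deriv i f x) (at s)"
  using assms by (auto simp: partial_deriv_def field_differentiable_derivI)

lemma partial_MVT:
  assumes f: "C_diff_on (Suc r) m U f" and i: "i < m"
    and seg: "\<And>s. s \<in> closed_segment a b \<Longrightarrow> w(i := s) \<in> U"
  obtains s where "s \<in> closed_segment a b"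
    "f (w(i := b)) - f (w(i := a)) = (b - a) * partial_deriv i f (w(i := s))"
proof -
  let ?g = "\<lambda>s. f (w(i := s))"
  have D: "(?g has_real_derivative partial_deriv i f (w(i := s))) (at s)" if "s \<in> closed_segment a b" for s
    using partial_deriv_DERIV[OF f seg[OF that] i, of s] by simp
  consider "a = b" | "a < b" | "b < a" by linarith
  then show ?thesis
  proof cases
    case 1 then show ?thesis by (intro that[of a]) auto
  next
    case 2
    then obtain z where "a < z" "z < b" "?g b - ?g a = (b - a) * partial_deriv i f (w(i := z))"
      using MVT2[of a b ?g "\<lambda>s. partial_deriv i f (w(i := s))"] D by (auto simp: closed_segment_eq_real_ivl)
    then show ?thesis by (intro that[of z]) (auto simp: closed_segment_eq_real_ivl)
  next
    case 3
    then obtain z where "b < z" "z < a" "?g a - ?g b = (a - b) * partial_deriv i f (w(i := z))"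
      using MVT2[of b a ?g "\<lambda>s. partial_deriv i f (w(i := s))"] D by (auto simp: closed_segment_eq_real_ivl)
    then show ?thesis by (intro that[of z]) (auto simp: closed_segment_eq_real_ivl algebra_simps)
  qed
qed

text \<open>The limit step of the chain rule: \<open>h\<close> is \<open>d\<close> times a factor
  tending to \<open>L\<close>. The factor will come from the mean value theorem, separately for each
  \<open>t\<close>, so the hypothesis asks only for its existence.\<close>

lemma DERIV_quotient_limit:
  fixes h d :: "real \<Rightarrow> real"
  assumes d: "(d has_real_derivative d') (at t0)" "d t0 = 0" and h0: "h t0 = 0"
    and *: "\<And>e. e > 0 \<Longrightarrow> \<forall>\<^sub>F t in at t0. \<exists>l. \<bar>l - L\<bar> < e \<and> h t = d t * l"
  shows "(h has_real_derivative L * d') (at t0)"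
proof -
  \<comment> \<open>Where \<open>d t\<close> vanishes, the quotient is replaced by its limit; near
    \<open>t0\<close> also \<open>h t\<close> vanishes there, so \<open>h t = d t * a t\<close>
    still holds.\<close>
  define a where "a t = (if d t = 0 then L else h t / d t)" for t
  have "(a \<longlongrightarrow> L) (at t0)"
  proof (rule tendstoI)
    fix e :: real assume "e > 0"
    from *[OF this] show "\<forall>\<^sub>F t in at t0. dist (a t) L < e"
      by eventually_elim (use \<open>e > 0\<close> in \<open>auto simp: a_def dist_real_def\<close>)
  qed
  moreover have "((\<lambda>t. (d t - d t0) / (t - t0)) \<longlongrightarrow> d') (at t0)"
    using d(1) by (simp add: has_field_derivative_iff)
  ultimately have "((\<lambda>t. a t * ((d t - d t0) / (t - t0))) \<longlongrightarrow> L * d') (at t0)"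
    by (rule tendsto_mult)
  moreover have "\<forall>\<^sub>F t in at t0. a t * ((d t - d t0) / (t - t0)) = (h t - h t0) / (t - t0)"
    using *[of 1, simplified]
    by eventually_elim (auto simp: a_def d(2) h0)
  ultimately show ?thesis
    unfolding has_field_derivative_iff by (rule Lim_transform_eventually)
qed

text \<open>The increment of \<open>f\<close> telescopes over the points \<open>z j t\<close>, whose
  first \<open>j\<close> coordinates come from \<open>c t\<close> and the others from
  \<open>c t0\<close>. Each summand changes a single coordinate, so the mean value theorem and
  continuity of one partial derivative give its derivative at \<open>t0\<close>.\<close>

lemma C_diff_chain_curve:
  assumes U: "openin (Euclidean_space p) U" and f: "C_diff_on (Suc 0) p U f"
    and c: "\<And>j. j < p \<Longrightarrow> ((\<lambda>t. c t j) has_real_derivative c' j) (at t0)"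
    and ev: "\<forall>\<^sub>F t in nhds t0. c t \<in> U"
  shows "((\<lambda>t. f (c t)) has_real_derivative (\<Sum>j<p. partial_deriv j f (c t0) * c' j)) (at t0)"
proof -
  define x where "x = c t0"
  have UE: "U \<subseteq> esp p" using U openin_subset by blast
  have xU: "x \<in> U" using eventually_nhds_x_imp_x[OF ev] by (simp add: x_def)
  define z where "z j t = (\<lambda>i. if i < j then c t i else x i)" for j :: nat and t
  have z0: "z 0 t = x" for t by (simp add: z_def)
  have zp: "z p t = c t" if "c t \<in> U" for t
  proof -
    have "c t \<in> esp p" "x \<in> esp p" using that UE xU by auto
    then show ?thesis by (auto simp: z_def fun_eq_iff mem_esp)
  qed
  have zS: "z (Suc j) t = (z j t)(j := c t j)" for j t
    by (auto simp: z_def)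
  have zz: "(z j t)(j := x j) = z j t" for j t by (auto simp: z_def)
  have D: "((\<lambda>t. f (z (Suc j) t) - f (z j t)) has_real_derivative partial_deriv j f x * c' j) (at t0)" if j: "j < p" for j
  proof (rule DERIV_quotient_limit[where d="\<lambda>t. c t j - x j"])
    show "((\<lambda>t. c t j - x j) has_real_derivative c' j) (at t0)"
      using DERIV_diff[OF c[OF j] DERIV_const[of "x j"]] by simp
    show "c t0 j - x j = 0" by (simp add: x_def)
    show "f (z (Suc j) t0) - f (z j t0) = 0"
    proof -
      have "z i t0 = x" for i by (auto simp: z_def x_def)
      then show ?thesis by simp
    qed
    fix e :: real assume e: "e > 0"
    have "C_diff_on 0 p U (partial_deriv j f)" using f j by auto
    then have "continuous_on U (partial_deriv j f)" using C_diff_on_continuous UE by blast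
    then obtain d where d: "d > 0" "\<And>y. y \<in> esp p \<Longrightarrow> (\<forall>i<p. \<bar>y i - x i\<bar> < d) \<Longrightarrow>
        y \<in> U \<and> \<bar>partial_deriv j f y - partial_deriv j f x\<bar> < e"
      using continuous_on_boxD[OF _ U xU e] by metis
    have "\<forall>\<^sub>F t in at t0. \<forall>i\<in>{..<p}. \<bar>c t i - x i\<bar> < d"
    proof (subst eventually_ball_finite_distrib, simp, intro ballI)
      fix i assume "i \<in> {..<p}"
      then have "isCont (\<lambda>t. c t i) t0" using DERIV_isCont[OF c] by auto
      then have "((\<lambda>t. c t i) \<longlongrightarrow> x i) (at t0)" by (simp add: isCont_def x_def)
      from tendstoD[OF this d(1)] show "\<forall>\<^sub>F t in at t0. \<bar>c t i - x i\<bar> < d"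
        by (simp add: dist_real_def)
    qed
    then show "\<forall>\<^sub>F t in at t0. \<exists>l. \<bar>l - partial_deriv j f x\<bar> < e \<and>
       f (z (Suc j) t) - f (z j t) = (c t j - x j) * l"
    proof eventually_elim
      case (elim t)
      have seg: "(z j t)(j := s) \<in> esp p \<and> (\<forall>i<p. \<bar>((z j t)(j := s)) i - x i\<bar> < d)"
        if "s \<in> closed_segment (x j) (c t j)" for s
      proof
        show "(z j t)(j := s) \<in> esp p" using xU UE j by (auto simp: z_def mem_esp subset_iff)
        have "\<bar>s - x j\<bar> \<le> \<bar>c t j - x j\<bar>"
          using that by (auto simp: closed_segment_eq_real_ivl split: if_splits)
        then show "\<forall>i<p. \<bar>((z j t)(j := s)) i - x i\<bar> < d"
          using elim d(1) j by (auto simp: z_def intro: le_less_trans)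
      qed
      obtain s where s: "s \<in> closed_segment (x j) (c t j)"
        "f ((z j t)(j := c t j)) - f ((z j t)(j := x j)) = (c t j - x j) * partial_deriv j f ((z j t)(j := s))"
        using partial_MVT[OF f j, of "x j" "c t j" "z j t"] seg d(2) by blast
      then show ?case
        using seg[OF s(1)] d(2) by (intro exI[of _ "partial_deriv j f ((z j t)(j := s))"]) (auto simp: zS zz)
    qed
  qed
  have "((\<lambda>t. f x + (\<Sum>j<p. f (z (Suc j) t) - f (z j t))) has_real_derivative
      0 + (\<Sum>j<p. partial_deriv j f x * c' j)) (at t0)"
    by (intro DERIV_add DERIV_const DERIV_sum D) auto
  moreover have "\<forall>\<^sub>F t in nhds t0. f x + (\<Sum>j<p. f (z (Suc j) t) - f (z j t)) = f (c t)"
    using ev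
  proof eventually_elim
    case (elim t)
    then show ?case using sum_lessThan_telescope[of "\<lambda>j. f (z j t)" p] by (simp add: z0 zp)
  qed
  ultimately show ?thesis
    using DERIV_cong_ev[OF refl _ refl] unfolding x_def by fastforce
qed

section \<open>Stability of class C^r under sums, products and composition\<close>

lemma C_diff_on_const: "U \<subseteq> esp m \<Longrightarrow> C_diff_on r m U (\<lambda>x. a)"
proof (induction r arbitrary: a)
  case (Suc r)
  have "partial_deriv i (\<lambda>x. a) = (\<lambda>x. 0)" for i by (simp add: partial_deriv_def fun_eq_iff)
  then show ?case using Suc by auto
qed auto

lemma C_diff_on_coord: "U \<subseteq> esp m \<Longrightarrow> C_diff_on r m U (\<lambda>x. x i)"
proof (cases r)
  case 0
  then show "U \<subseteq> esp m \<Longrightarrow> C_diff_on r m U (\<lambda>x. x i)"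
    using continuous_on_subset[OF continuous_on_product_coordinates]
    by (simp add: continuous_map_Euclidean_sub_iff)
next
  case (Suc s)
  assume U: "U \<subseteq> esp m"
  have "partial_deriv j (\<lambda>x. x i) = (\<lambda>x. if i = j then 1 else 0)" for j
    by (auto simp: partial_deriv_def fun_eq_iff)
  moreover have "continuous_on U (\<lambda>x. x i)"
    by (rule continuous_on_subset[OF continuous_on_product_coordinates]) simp
  moreover have "(\<lambda>t. (x(j := t)) i) field_differentiable at (x j)" for x :: "nat \<Rightarrow> real" and j
    by (cases "i = j") auto
  ultimately show ?thesis
    using C_diff_on_const[OF U] U Suc by (auto simp: continuous_map_Euclidean_sub_iff)
qed

lemma C_diff_on_add:
  assumes U: "openin (Euclidean_space m) U"
  shows "C_diff_on r m U f \<Longrightarrow> C_diff_on r m U g \<Longrightarrow> C_diff_on r m U (\<lambda>x. f x + g x)"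
proof (induction r arbitrary: f g)
  case 0
  then show ?case by (auto intro: continuous_map_add)
next
  case (Suc r)
  have "C_diff_on r m U (partial_deriv i (\<lambda>x. f x + g x))" if i: "i < m" for i
  proof (rule C_diff_on_cong[OF U])
    show "C_diff_on r m U (\<lambda>x. partial_deriv i f x + partial_deriv i g x)"
      using Suc i by auto
    fix x assume x: "x \<in> U"
    show "partial_deriv i f x + partial_deriv i g x = partial_deriv i (\<lambda>x. f x + g x) x"
      using DERIV_add[OF partial_deriv_DERIV[OF Suc.prems(1) x i refl] partial_deriv_DERIV[OF Suc.prems(2) x i refl]]
      unfolding partial_deriv_def[of i "\<lambda>x. f x + g x"] by (metis DERIV_imp_deriv)
  qed
  then show ?case using Suc.prems by (auto intro: continuous_map_add field_differentiable_add)
qed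

lemma C_diff_on_mult:
  assumes U: "openin (Euclidean_space m) U"
  shows "C_diff_on r m U f \<Longrightarrow> C_diff_on r m U g \<Longrightarrow> C_diff_on r m U (\<lambda>x. f x * g x)"
proof (induction r arbitrary: f g)
  case 0
  then show ?case by (auto intro: continuous_map_real_mult)
next
  case (Suc r)
  have "C_diff_on r m U (partial_deriv i (\<lambda>x. f x * g x))" if i: "i < m" for i
  proof (rule C_diff_on_cong[OF U])
    show "C_diff_on r m U (\<lambda>x. partial_deriv i f x * g x + f x * partial_deriv i g x)"
      using Suc.prems i C_diff_on_mono[OF Suc.prems(1), of r] C_diff_on_mono[OF Suc.prems(2), of r]
      by (intro C_diff_on_add[OF U] Suc.IH) auto
    fix x assume x: "x \<in> U"
    show "partial_deriv i f x * g x + f x * partial_deriv i g x = partial_deriv i (\<lambda>x. f x * g x) x"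
      unfolding partial_deriv_def[of i "\<lambda>x. f x * g x"]
      by (rule DERIV_imp_deriv[symmetric], rule DERIV_cong[OF DERIV_mult[OF partial_deriv_DERIV[OF Suc.prems(1) x i refl]
          partial_deriv_DERIV[OF Suc.prems(2) x i refl]]]) simp
  qed
  then show ?case using Suc.prems by (auto intro: continuous_map_real_mult field_differentiable_mult)
qed

lemma C_diff_on_sum:
  assumes U: "openin (Euclidean_space m) U"
  shows "(\<And>j. j \<in> A \<Longrightarrow> C_diff_on r m U (f j)) \<Longrightarrow> C_diff_on r m U (\<lambda>x. \<Sum>j\<in>A. f j x)"
  using openin_subset[OF U]
  by (induction A rule: infinite_finite_induct) (auto intro: C_diff_on_const C_diff_on_add[OF U])

lemma continuous_on_compose_coords:
  assumes V: "V \<subseteq> esp p" and f: "continuous_on V f"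
    and G: "\<And>j. j < p \<Longrightarrow> continuous_on U (\<lambda>x. G x j)" and GV: "G \<in> U \<rightarrow> V"
  shows "continuous_on U (\<lambda>x. f (G x))"
proof -
  have "continuous_on U (\<lambda>x. G x j)" for j
  proof (cases "j < p")
    case False
    then have "\<And>x. x \<in> U \<Longrightarrow> G x j = 0" using GV V by (auto simp: mem_esp subset_iff Pi_iff)
    then show ?thesis by (metis continuous_on_cong continuous_on_const)
  qed (rule G)
  then have "continuous_on U G" by (rule continuous_on_coordinatewise_then_product)
  then show ?thesis using GV by (intro continuous_on_compose2[OF f]) auto
qed

lemma partial_deriv_compose:
  assumes U: "openin (Euclidean_space m) U" and V: "openin (Euclidean_space p) V"
    and f: "C_diff_on (Suc 0) p V f" and G: "\<And>j. j < p \<Longrightarrow> C_diff_on (Suc 0) m U (\<lambda>x. G x j)"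
    and GV: "G \<in> U \<rightarrow> V" and i: "i < m" and x: "x \<in> U"
  shows "((\<lambda>t. f (G (x(i := t)))) has_real_derivative
      (\<Sum>j<p. partial_deriv j f (G x) * partial_deriv i (\<lambda>x. G x j) x)) (at (x i))"
proof -
  have "\<forall>\<^sub>F t in nhds (x i). G (x(i := t)) \<in> V"
    using eventually_update_in[OF U x i] by eventually_elim (use GV in auto)
  from C_diff_chain_curve[OF V f partial_deriv_DERIV[OF G x i refl] this]
  show ?thesis by simp
qed

text \<open>By the chain rule, a partial derivative of the composition is a sum of products of
  \<open>partial_deriv j f\<close> composed with \<open>G\<close> and partial derivatives of
  \<open>G\<close>. The first factor is handled by the induction hypothesis for the same
  \<open>G\<close>, which is why only \<open>f\<close> is generalised.\<close>

lemma C_diff_on_compose: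
  assumes U: "openin (Euclidean_space m) U" and V: "openin (Euclidean_space p) V"
    and GV: "G \<in> U \<rightarrow> V"
  shows "C_diff_on r p V f \<Longrightarrow> (\<And>j. j < p \<Longrightarrow> C_diff_on r m U (\<lambda>x. G x j)) \<Longrightarrow>
    C_diff_on r m U (\<lambda>x. f (G x))"
proof (induction r arbitrary: f)
  case 0
  then show ?case
    using continuous_on_compose_coords[OF openin_subset[OF V] _ _ GV] openin_subset[OF U] openin_subset[OF V]
    by (auto simp: continuous_map_Euclidean_sub_iff)
next
  case (Suc r)
  have f1: "C_diff_on (Suc 0) p V f" and G1: "\<And>j. j < p \<Longrightarrow> C_diff_on (Suc 0) m U (\<lambda>x. G x j)"
    by (rule C_diff_on_mono[OF Suc.prems(1)], simp, rule C_diff_on_mono[OF Suc.prems(2)]) auto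
  have "C_diff_on r m U (partial_deriv i (\<lambda>x. f (G x)))" if i: "i < m" for i
  proof (rule C_diff_on_cong[OF U])
    show "C_diff_on r m U (\<lambda>x. \<Sum>j<p. partial_deriv j f (G x) * partial_deriv i (\<lambda>x. G x j) x)"
    proof (intro C_diff_on_sum[OF U] C_diff_on_mult[OF U])
      fix j assume "j \<in> {..<p}"
      then show "C_diff_on r m U (partial_deriv i (\<lambda>x. G x j))"
        using Suc.prems(2)[of j] i by simp
      show "C_diff_on r m U (\<lambda>x. partial_deriv j f (G x))"
      proof (rule Suc.IH)
        show "C_diff_on r p V (partial_deriv j f)"
          using Suc.prems(1) \<open>j \<in> {..<p}\<close> by simp
        show "C_diff_on r m U (\<lambda>x. G x k)" if "k < p" for k
          by (rule C_diff_on_mono[OF Suc.prems(2)[OF that]]) simp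
      qed
    qed
    fix x assume x: "x \<in> U"
    show "(\<Sum>j<p. partial_deriv j f (G x) * partial_deriv i (\<lambda>x. G x j) x) = partial_deriv i (\<lambda>x. f (G x)) x"
      using partial_deriv_compose[OF U V f1 G1 GV i x]
      unfolding partial_deriv_def[of i "\<lambda>x. f (G x)"] by (simp add: DERIV_imp_deriv)
  qed
  moreover have "(\<lambda>t. f (G (x(i := t)))) field_differentiable at (x i)" if "i < m" "x \<in> U" for i x
    using partial_deriv_compose[OF U V f1 G1 GV that] field_differentiable_def by blast
  moreover have "continuous_on U (\<lambda>x. f (G x))"
    using continuous_on_compose_coords[OF openin_subset[OF V] _ _ GV]
      C_diff_on_continuous[OF f1 openin_subset[OF V]] C_diff_on_continuous[OF G1 openin_subset[OF U]] by auto
  ultimately show ?case by (simp add: continuous_map_Euclidean_sub_iff[OF openin_subset[OF U]])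
qed

text \<open>Schwarz' theorem. The second difference \<open>D i j h\<close> is symmetric in
  \<open>i\<close> and \<open>j\<close>, and two mean value steps turn it into
  \<open>h\<^sup>2\<close> times a mixed derivative at a point within distance \<open>h\<close> of
  \<open>x\<close>. Continuity of both mixed derivatives then leaves no gap between the two
  orders.\<close>

lemma partial_deriv_commute:
  assumes U: "openin (Euclidean_space m) U" and f: "C_diff_on (Suc (Suc 0)) m U f"
    and i: "i < m" and j: "j < m" and x: "x \<in> U"
  shows "partial_deriv i (partial_deriv j f) x = partial_deriv j (partial_deriv i f) x"
proof (cases "i = j")
  case ij: False
  have UE: "U \<subseteq> esp m" using U openin_subset by blast
  define D where "D i j h = f (x(i := x i + h, j := x j + h)) - f (x(i := x i + h)) - f (x(j := x j + h)) + f x"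
    for i j and h :: real
  have sym: "D i j h = D j i h" for h
    using ij by (simp add: D_def fun_upd_twist)
  have key: "\<exists>y\<in>esp m. (\<forall>k<m. \<bar>y k - x k\<bar> \<le> h) \<and> D i j h = h\<^sup>2 * partial_deriv i (partial_deriv j f) y"
    if i: "i < m" and j: "j < m" and ij: "i \<noteq> j" and h: "h > 0"
      and box: "\<And>y. y \<in> esp m \<Longrightarrow> (\<forall>k<m. \<bar>y k - x k\<bar> \<le> h) \<Longrightarrow> y \<in> U" for i j h
  proof -
    have xE: "x \<in> esp m" using x UE by auto
    have in_box: "x(i := a, j := b) \<in> U" if "a \<in> {x i..x i + h}" "b \<in> {x j..x j+h}" for a b
      using that ij h xE i j by (intro box) (auto simp: mem_esp)
    define g where "g s = f (x(i := x i + h, j := s)) - f (x(j := s))" for s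
    \<comment> \<open>The first mean value step varies coordinate \<open>j\<close>; the second one,
      further down, varies coordinate \<open>i\<close>.\<close>
    have "\<exists>z>x j. z < x j + h \<and> g (x j + h) - g (x j) = (x j + h - x j) *
      (partial_deriv j f (x(i := x i + h, j := z)) - partial_deriv j f (x(j := z)))"
    proof (rule MVT2)
      fix s assume s: "x j \<le> s" "s \<le> x j + h"
      have "x(j := s) = x(i := x i, j := s)" by auto
      then have "x(j := s) \<in> U" using in_box[of "x i" s] s h by auto
      moreover have "x(i := x i + h, j := s) \<in> U" using in_box s h by auto
      ultimately show "(g has_real_derivative partial_deriv j f (x(i := x i + h, j := s)) - partial_deriv j f (x(j := s))) (at s)"
        unfolding g_def
        using DERIV_diff[OF partial_deriv_DERIV[OF f _ j, of "x(i := x i + h, j := s)" s] partial_deriv_DERIV[OF f _ j, of "x(j := s)" s]]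
        by simp
    qed (use h in auto)
    then obtain s where s: "s > x j" "s < x j + h" "g (x j + h) - g (x j) = h *
      (partial_deriv j f (x(i := x i + h, j := s)) - partial_deriv j f (x(j := s)))" by auto
    have f': "C_diff_on (Suc 0) m U (partial_deriv j f)" using f j by auto
    have tw: "(x(j := s))(i := a) = x(i := a, j := s)" for a using ij by (auto simp: fun_upd_twist)
    have same: "(x(j := s))(i := x i) = x(j := s)" using ij by auto
    obtain a where a: "a \<in> closed_segment (x i) (x i + h)"
      "partial_deriv j f ((x(j := s))(i := x i + h)) - partial_deriv j f ((x(j := s))(i := x i)) =
       (x i + h - x i) * partial_deriv i (partial_deriv j f) ((x(j := s))(i := a))"
      using partial_MVT[OF f' i, of "x i" "x i + h" "x(j := s)"] in_box[of _ s] s h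
      unfolding tw by (auto simp: closed_segment_eq_real_ivl)
    have "D i j h = g (x j + h) - g (x j)" using ij by (simp add: D_def g_def) (metis fun_upd_triv fun_upd_twist)
    also have "\<dots> = h\<^sup>2 * partial_deriv i (partial_deriv j f) (x(i := a, j := s))"
      unfolding s(3) using a(2) unfolding same tw by (simp add: power2_eq_square)
    finally show ?thesis
      using a(1) s h ij xE i j
      by (intro bexI[of _ "x(i := a, j := s)"]) (auto simp: closed_segment_eq_real_ivl mem_esp)
  qed
  show ?thesis
  proof (rule ccontr)
    assume ne: "partial_deriv i (partial_deriv j f) x \<noteq> partial_deriv j (partial_deriv i f) x"
    \<comment> \<open>Half the gap, because each of the two mixed derivatives may be off by less
      than \<open>e\<close>.\<close>
    define e where "e = \<bar>partial_deriv i (partial_deriv j f) x - partial_deriv j (partial_deriv i f) x\<bar> / 2"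
    have e: "e > 0" using ne by (simp add: e_def)
    have "C_diff_on 0 m U (partial_deriv i (partial_deriv j f))" "C_diff_on 0 m U (partial_deriv j (partial_deriv i f))"
      using f i j by auto
    then have c: "continuous_on U (partial_deriv i (partial_deriv j f))" "continuous_on U (partial_deriv j (partial_deriv i f))"
      using C_diff_on_continuous UE by blast+
    obtain d1 where d1: "d1 > 0" "\<And>y. y \<in> esp m \<Longrightarrow> (\<forall>i<m. \<bar>y i - x i\<bar> < d1) \<Longrightarrow>
        y \<in> U \<and> \<bar>partial_deriv i (partial_deriv j f) y - partial_deriv i (partial_deriv j f) x\<bar> < e"
      using continuous_on_boxD[OF c(1) U x e] by metis
    obtain d2 where d2: "d2 > 0" "\<And>y. y \<in> esp m \<Longrightarrow> (\<forall>i<m. \<bar>y i - x i\<bar> < d2) \<Longrightarrow>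
        y \<in> U \<and> \<bar>partial_deriv j (partial_deriv i f) y - partial_deriv j (partial_deriv i f) x\<bar> < e"
      using continuous_on_boxD[OF c(2) U x e] by metis
    define h where "h = min d1 d2 / 2"
    have h: "h > 0" "h < d1" "h < d2" using d1(1) d2(1) by (auto simp: h_def)
    have box: "y \<in> U" if "y \<in> esp m" "\<forall>k<m. \<bar>y k - x k\<bar> \<le> h" for y
      using d1(2)[OF that(1)] that(2) h(2) by (meson le_less_trans)
    obtain y1 where y1: "y1 \<in> esp m" "\<forall>k<m. \<bar>y1 k - x k\<bar> \<le> h" "D i j h = h\<^sup>2 * partial_deriv i (partial_deriv j f) y1"
      using key[OF i j ij h(1) box] by blast
    obtain y2 where y2: "y2 \<in> esp m" "\<forall>k<m. \<bar>y2 k - x k\<bar> \<le> h" "D j i h = h\<^sup>2 * partial_deriv j (partial_deriv i f) y2"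
      using key[OF j i ij[symmetric] h(1) box] by blast
    have "partial_deriv i (partial_deriv j f) y1 = partial_deriv j (partial_deriv i f) y2"
      using y1(3) y2(3) sym[of h] h(1) by simp
    moreover have "\<bar>partial_deriv i (partial_deriv j f) y1 - partial_deriv i (partial_deriv j f) x\<bar> < e"
      using d1(2)[OF y1(1)] y1(2) h(2) by (meson le_less_trans)
    moreover have "\<bar>partial_deriv j (partial_deriv i f) y2 - partial_deriv j (partial_deriv i f) x\<bar> < e"
      using d2(2)[OF y2(1)] y2(2) h(3) by (meson le_less_trans)
    ultimately have "\<bar>partial_deriv i (partial_deriv j f) x - partial_deriv j (partial_deriv i f) x\<bar> < e + e"
      by linarith
    then show False unfolding e_def by simp
  qed
qed simp


section \<open>Closure properties of smooth functions\<close>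

lemma smooth_fun_on_openin: "smooth_fun_on m U f \<Longrightarrow> openin (Euclidean_space m) U"
  by (simp add: smooth_fun_on_def)

lemma smooth_fun_on_C_diff: "smooth_fun_on m U f \<Longrightarrow> C_diff_on r m U f"
  by (simp add: smooth_fun_on_def)

lemma smooth_fun_on_const: "openin (Euclidean_space m) U \<Longrightarrow> smooth_fun_on m U (\<lambda>x. a)"
  using C_diff_on_const[OF openin_subset] by (simp add: smooth_fun_on_def)

lemma smooth_fun_on_coord: "openin (Euclidean_space m) U \<Longrightarrow> smooth_fun_on m U (\<lambda>x. x i)"
  using C_diff_on_coord[OF openin_subset] by (simp add: smooth_fun_on_def)

lemma smooth_fun_on_add:
  "smooth_fun_on m U f \<Longrightarrow> smooth_fun_on m U g \<Longrightarrow> smooth_fun_on m U (\<lambda>x. f x + g x)"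
  by (simp add: smooth_fun_on_def C_diff_on_add)

lemma smooth_fun_on_mult:
  "smooth_fun_on m U f \<Longrightarrow> smooth_fun_on m U g \<Longrightarrow> smooth_fun_on m U (\<lambda>x. f x * g x)"
  by (simp add: smooth_fun_on_def C_diff_on_mult)

lemma smooth_fun_on_cmult: "smooth_fun_on m U f \<Longrightarrow> smooth_fun_on m U (\<lambda>x. a * f x)"
  by (intro smooth_fun_on_mult smooth_fun_on_const smooth_fun_on_openin)

lemma smooth_fun_on_divide: "smooth_fun_on m U f \<Longrightarrow> smooth_fun_on m U (\<lambda>x. f x / a)"
  using smooth_fun_on_cmult[of m U f "1 / a"] by simp

lemma smooth_fun_on_diff:
  "smooth_fun_on m U f \<Longrightarrow> smooth_fun_on m U g \<Longrightarrow> smooth_fun_on m U (\<lambda>x. f x - g x)"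
  using smooth_fun_on_add[of m U f "\<lambda>x. -1 * g x"] smooth_fun_on_cmult[of m U g "-1"] by simp

lemma smooth_fun_on_sum:
  "openin (Euclidean_space m) U \<Longrightarrow> (\<And>j. j \<in> A \<Longrightarrow> smooth_fun_on m U (f j)) \<Longrightarrow>
    smooth_fun_on m U (\<lambda>x. \<Sum>j\<in>A. f j x)"
  by (simp add: smooth_fun_on_def C_diff_on_sum)

lemma smooth_fun_on_cong:
  assumes "smooth_fun_on m U f" "\<And>x. x \<in> U \<Longrightarrow> f x = g x"
  shows "smooth_fun_on m U g"
  unfolding smooth_fun_on_def
proof (intro conjI allI)
  show U: "openin (Euclidean_space m) U" using assms(1) by (rule smooth_fun_on_openin)
  show "C_diff_on r m U g" for r
    by (rule C_diff_on_cong[OF U smooth_fun_on_C_diff[OF assms(1)] assms(2)])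
qed

lemma smooth_fun_on_subset:
  "smooth_fun_on m U f \<Longrightarrow> V \<subseteq> U \<Longrightarrow> openin (Euclidean_space m) V \<Longrightarrow> smooth_fun_on m V f"
  unfolding smooth_fun_on_def using C_diff_on_subset by metis

lemma smooth_fun_on_local:
  assumes "\<And>x. x \<in> U \<Longrightarrow> \<exists>V\<subseteq>U. x \<in> V \<and> smooth_fun_on m V f"
  shows "smooth_fun_on m U f"
  unfolding smooth_fun_on_def
proof (intro conjI allI)
  show U: "openin (Euclidean_space m) U"
  proof (subst openin_subopen, intro ballI)
    fix x assume "x \<in> U"
    from assms[OF this] show "\<exists>T. openin (Euclidean_space m) T \<and> x \<in> T \<and> T \<subseteq> U"
      by (metis smooth_fun_on_openin)
  qed
  show "C_diff_on r m U f" for r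
  proof (rule C_diff_on_local[OF U])
    fix x assume "x \<in> U"
    from assms[OF this] show "\<exists>V. openin (Euclidean_space m) V \<and> x \<in> V \<and> C_diff_on r m V f"
      by (metis smooth_fun_on_openin smooth_fun_on_C_diff)
  qed
qed

lemma smooth_fun_on_compose:
  assumes "smooth_fun_on p V f" "openin (Euclidean_space m) U"
    "\<And>j. j < p \<Longrightarrow> smooth_fun_on m U (\<lambda>x. G x j)" "G \<in> U \<rightarrow> V"
  shows "smooth_fun_on m U (\<lambda>x. f (G x))"
  using assms C_diff_on_compose[OF assms(2) smooth_fun_on_openin[OF assms(1)] assms(4)]
  by (simp add: smooth_fun_on_def)

lemma smooth_fun_on_partial_deriv:
  assumes "smooth_fun_on m U f" "i < m" shows "smooth_fun_on m U (partial_deriv i f)"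
  unfolding smooth_fun_on_def
proof (intro conjI allI)
  show "C_diff_on r m U (partial_deriv i f)" for r
    using smooth_fun_on_C_diff[OF assms(1), of "Suc r"] assms(2) by simp
qed (rule smooth_fun_on_openin[OF assms(1)])

lemma openin_smooth_preimage:
  assumes U: "openin (Euclidean_space m) U" and V: "openin (Euclidean_space p) V"
    and G: "\<And>j. j < p \<Longrightarrow> smooth_fun_on m U (\<lambda>x. G x j)" and GE: "G \<in> U \<rightarrow> esp p"
  shows "openin (Euclidean_space m) {x \<in> U. G x \<in> V}"
  unfolding openin_Euclidean_space_iff
proof (intro conjI ballI)
  show "{x \<in> U. G x \<in> V} \<subseteq> esp m" using openin_subset[OF U] by auto
  fix x assume "x \<in> {x \<in> U. G x \<in> V}"
  then have x: "x \<in> U" "G x \<in> V" by auto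
  obtain e where e: "e > 0" "\<forall>y\<in>esp p. (\<forall>i<p. \<bar>y i - G x i\<bar> < e) \<longrightarrow> y \<in> V"
    using V x(2) unfolding openin_Euclidean_space_iff by metis
  \<comment> \<open>Only \<open>p\<close> coordinates of \<open>G\<close> have to be controlled, so
    the radius is found by induction on their number.\<close>
  have "\<exists>d>0. \<forall>y\<in>esp m. (\<forall>i<m. \<bar>y i - x i\<bar> < d) \<longrightarrow> y \<in> U \<and> (\<forall>j<q. \<bar>G y j - G x j\<bar> < e)"
    if "q \<le> p" for q
    using that
  proof (induction q)
    case 0
    then show ?case using U x(1) unfolding openin_Euclidean_space_iff by simp
  next
    case (Suc q)
    then obtain d1 where d1: "d1 > 0" "\<forall>y\<in>esp m. (\<forall>i<m. \<bar>y i - x i\<bar> < d1) \<longrightarrow> y \<in> U \<and> (\<forall>j<q. \<bar>G y j - G x j\<bar> < e)"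
      by (metis Suc_leD)
    have "continuous_on U (\<lambda>x. G x q)"
      using C_diff_on_continuous[OF smooth_fun_on_C_diff[OF G[of q]] openin_subset[OF U]] Suc.prems by simp
    then obtain d2 where d2: "d2 > 0" "\<And>y. y \<in> esp m \<Longrightarrow> (\<forall>i<m. \<bar>y i - x i\<bar> < d2) \<Longrightarrow> y \<in> U \<and> \<bar>G y q - G x q\<bar> < e"
      using continuous_on_boxD[OF _ U x(1) e(1)] by metis
    show ?case
      using d1 d2 by (intro exI[of _ "min d1 d2"]) (auto simp: less_Suc_eq)
  qed
  from this[OF order_refl] obtain d where d: "d > 0"
    "\<forall>y\<in>esp m. (\<forall>i<m. \<bar>y i - x i\<bar> < d) \<longrightarrow> y \<in> U \<and> (\<forall>j<p. \<bar>G y j - G x j\<bar> < e)" by (elim exE conjE)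
  show "\<exists>e>0. \<forall>y\<in>esp m. (\<forall>i<m. \<bar>y i - x i\<bar> < e) \<longrightarrow> y \<in> {x \<in> U. G x \<in> V}"
    using d e(2) GE by (intro exI[of _ d]) (auto simp: Pi_iff)
qed


section \<open>Smooth curves and Taylor coefficients\<close>

text \<open>Phrased with iterated \<open>deriv\<close> to fit \<open>smooth_curve_on\<close> and
  \<open>jet_equiv\<close>, which speak about curves in the same way.\<close>

definition smooth_real :: "real set \<Rightarrow> (real \<Rightarrow> real) \<Rightarrow> bool" where
  "smooth_real I h \<longleftrightarrow> open I \<and> (\<forall>r. \<forall>s\<in>I. (deriv ^^ r) h field_differentiable (at s))"

lemma smooth_real_open: "smooth_real I h \<Longrightarrow> open I"
  by (simp add: smooth_real_def)

lemma smooth_real_subset: "smooth_real I h \<Longrightarrow> open J \<Longrightarrow> J \<subseteq> I \<Longrightarrow> smooth_real J h"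
  by (auto simp: smooth_real_def)

lemma smooth_real_deriv: "smooth_real I h \<Longrightarrow> smooth_real I (deriv h)"
  unfolding smooth_real_def by (metis funpow_Suc_right comp_apply)

lemma smooth_real_has_deriv: "smooth_real I h \<Longrightarrow> s \<in> I \<Longrightarrow> (h has_real_derivative deriv h s) (at s)"
  unfolding smooth_real_def by (metis funpow_0 field_differentiable_derivI)

lemma openin_line: "open I \<Longrightarrow> openin (Euclidean_space 1) {x \<in> esp 1. x 0 \<in> I}"
proof -
  assume "open I"
  then have "open ((\<lambda>x::nat \<Rightarrow> real. x 0) -` I)"
    by (intro open_vimage continuous_on_product_coordinates)
  then show ?thesis by (auto simp: openin_Euclidean_space_open)
qed

lemma partial_deriv_line: "partial_deriv 0 (\<lambda>x. h (x 0)) = (\<lambda>x. deriv h (x 0))"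
  by (simp add: partial_deriv_def fun_eq_iff)

text \<open>Identifies the line with \<open>Euclidean_space 1\<close>, so that sums, products and
  compositions of curves inherit smoothness from functions of several variables.\<close>

lemma smooth_real_iff_smooth_fun_on:
  assumes I: "open I"
  shows "smooth_real I h \<longleftrightarrow> smooth_fun_on 1 {x \<in> esp 1. x 0 \<in> I} (\<lambda>x. h (x 0))" (is "_ \<longleftrightarrow> smooth_fun_on 1 ?X _")
proof
  have X: "openin (Euclidean_space 1) ?X" using I by (rule openin_line)
  assume h: "smooth_real I h"
  have "C_diff_on r 1 ?X (\<lambda>x. h (x 0))" if "smooth_real I h" for r h
    using that
  proof (induction r arbitrary: h)
    case 0
    have "continuous_on I h"
      by (rule continuous_at_imp_continuous_on) (metis 0 DERIV_isCont smooth_real_has_deriv)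
    then have "continuous_on ?X (\<lambda>x. h (x 0))"
      by (rule continuous_on_compose2) (auto intro: continuous_on_subset[OF continuous_on_product_coordinates])
    then show ?case using continuous_map_Euclidean_sub_iff[OF openin_subset[OF X]] by simp
  next
    case (Suc r)
    have "continuous_on I h"
      by (rule continuous_at_imp_continuous_on) (metis Suc.prems DERIV_isCont smooth_real_has_deriv)
    then have "continuous_on ?X (\<lambda>x. h (x 0))"
      by (rule continuous_on_compose2) (auto intro: continuous_on_subset[OF continuous_on_product_coordinates])
    moreover have "C_diff_on r 1 ?X (\<lambda>x. deriv h (x 0))"
      by (intro Suc.IH smooth_real_deriv Suc.prems)
    moreover have "h field_differentiable at (x 0)" if "x \<in> ?X" for x
      using that Suc.prems field_differentiable_def smooth_real_has_deriv by blast
    ultimately show ?case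
      using continuous_map_Euclidean_sub_iff[OF openin_subset[OF X]] by (simp add: partial_deriv_line)
  qed
  then show "smooth_fun_on 1 ?X (\<lambda>x. h (x 0))" using X h by (simp add: smooth_fun_on_def)
next
  assume h: "smooth_fun_on 1 ?X (\<lambda>x. h (x 0))"
  have "(deriv ^^ r) h field_differentiable at s" if "s \<in> I" "smooth_fun_on 1 ?X (\<lambda>x. h (x 0))" for r s h
    using that
  proof (induction r arbitrary: h)
    case 0
    let ?x = "(\<lambda>i. if i = 0 then s else 0) :: nat \<Rightarrow> real"
    have "?x \<in> ?X" using that by (auto simp: mem_esp)
    then have "(\<lambda>t. h ((?x(0 := t)) 0)) field_differentiable at (?x 0)"
      using smooth_fun_on_C_diff[OF 0(2), of 1] by (auto simp del: fun_upd_apply)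
    then show ?case by simp
  next
    case (Suc r)
    have "smooth_fun_on 1 ?X (\<lambda>x. deriv h (x 0))"
      using smooth_fun_on_partial_deriv[OF Suc.prems(2), of 0] by (simp add: partial_deriv_line)
    from Suc.IH[OF Suc.prems(1) this] show ?case by (simp only: funpow_Suc_right comp_apply)
  qed
  then show "smooth_real I h" using I h by (simp add: smooth_real_def)
qed

lemma smooth_real_compose:
  assumes f: "smooth_fun_on p V f" and I: "open I"
    and c: "\<And>j. j < p \<Longrightarrow> smooth_real I (\<lambda>t. c t j)" and cV: "\<And>t. t \<in> I \<Longrightarrow> c t \<in> V"
  shows "smooth_real I (\<lambda>t. f (c t))"
  unfolding smooth_real_iff_smooth_fun_on[OF I]
  using c cV I by (intro smooth_fun_on_compose[OF f openin_line]) (auto simp: smooth_real_iff_smooth_fun_on[OF I])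

lemma smooth_real_const: "open I \<Longrightarrow> smooth_real I (\<lambda>t. a)"
  by (simp add: smooth_real_iff_smooth_fun_on smooth_fun_on_const openin_line[simplified])

lemma smooth_real_ident: "open I \<Longrightarrow> smooth_real I (\<lambda>t. t)"
  by (simp add: smooth_real_iff_smooth_fun_on smooth_fun_on_coord openin_line[simplified])

lemma smooth_real_add:
  assumes "smooth_real I f" "smooth_real I g" shows "smooth_real I (\<lambda>t. f t + g t)"
proof -
  have I: "open I" using assms(1) by (rule smooth_real_open)
  show ?thesis
    using assms unfolding smooth_real_iff_smooth_fun_on[OF I] by (rule smooth_fun_on_add)
qed

lemma smooth_real_mult:
  assumes "smooth_real I f" "smooth_real I g" shows "smooth_real I (\<lambda>t. f t * g t)"
proof -
  have I: "open I" using assms(1) by (rule smooth_real_open)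
  show ?thesis
    using assms unfolding smooth_real_iff_smooth_fun_on[OF I] by (rule smooth_fun_on_mult)
qed

lemma smooth_real_sum: "open I \<Longrightarrow> (\<And>j. j \<in> A \<Longrightarrow> smooth_real I (f j)) \<Longrightarrow> smooth_real I (\<lambda>t. \<Sum>j\<in>A. f j t)"
  by (induction A rule: infinite_finite_induct) (simp_all add: smooth_real_const smooth_real_add)

lemma smooth_real_power: "open I \<Longrightarrow> smooth_real I (\<lambda>t. t ^ n)"
  by (induction n) (simp_all add: smooth_real_const smooth_real_mult smooth_real_ident)

lemma smooth_real_shift:
  assumes "smooth_real I h"
  shows "smooth_real {s. t + s \<in> I} (\<lambda>s. h (t + s))"
proof -
  have I: "open I" using assms by (simp add: smooth_real_def)
  have "{s. t + s \<in> I} = (\<lambda>s. t + s) -` I" by auto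
  then have J: "open {s. t + s \<in> I}" using I by (simp add: open_vimage continuous_intros)
  \<comment> \<open>The shift is written as a curve in the one-dimensional model space, so that the
    composition lemma applies.\<close>
  have "smooth_real {s. t + s \<in> I} (\<lambda>s. h (if 0 = (0::nat) then t + s else 0))"
  proof (rule smooth_real_compose[where f="\<lambda>x. h (x 0)" and c="\<lambda>s i. if i = 0 then t + s else 0"])
    show "smooth_fun_on 1 {x \<in> esp 1. x 0 \<in> I} (\<lambda>x. h (x 0))"
      using assms unfolding smooth_real_iff_smooth_fun_on[OF I] .
    show "smooth_real {s. t + s \<in> I} (\<lambda>s. if j = 0 then t + s else 0)" if "j < 1" for j :: nat
      using that smooth_real_add[OF smooth_real_const[OF J] smooth_real_ident[OF J]] by simp
  qed (use J in \<open>auto simp: mem_esp\<close>)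
  then show ?thesis by simp
qed


text \<open>The normalisation of the jet coordinates. With it Leibniz' rule becomes a convolution
  without binomial coefficients.\<close>

definition taylor :: "nat \<Rightarrow> (real \<Rightarrow> real) \<Rightarrow> real \<Rightarrow> real" where
  "taylor b h s = (deriv ^^ b) h s / fact b"

lemma taylor_0 [simp]: "taylor 0 h s = h s"
  by (simp add: taylor_def)

lemma taylor_deriv: "taylor b (deriv h) s = real (Suc b) * taylor (Suc b) h s"
proof -
  have "(deriv ^^ Suc b) h = (deriv ^^ b) (deriv h)" by (simp only: funpow_Suc_right comp_apply)
  then show ?thesis unfolding taylor_def fact_Suc by (simp only:) (simp del: of_nat_Suc)
qed

lemma taylor_cong_ev:
  assumes "\<forall>\<^sub>F t in nhds s. g t = h t" shows "taylor b g s = taylor b h s"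
proof -
  have "\<forall>\<^sub>F t in nhds s. (deriv ^^ b) g t = (deriv ^^ b) h t" for b
  proof (induction b)
    case (Suc b)
    then have "\<forall>\<^sub>F t in nhds s. \<forall>\<^sub>F u in nhds t. (deriv ^^ b) g u = (deriv ^^ b) h u"
      by (simp add: eventually_eventually)
    then show ?case
      by eventually_elim (simp add: deriv_cong_ev)
  qed (use assms in simp)
  from eventually_nhds_x_imp_x[OF this] show ?thesis by (simp add: taylor_def)
qed

lemma taylor_cong:
  assumes "open I" "s \<in> I" "\<And>t. t \<in> I \<Longrightarrow> g t = h t" shows "taylor b g s = taylor b h s"
  using assms by (intro taylor_cong_ev) (auto simp: eventually_nhds)

lemma taylor_add:
  assumes "smooth_real I g" "smooth_real I h" "s \<in> I"
  shows "taylor b (\<lambda>t. g t + h t) s = taylor b g s + taylor b h s"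
  using assms
proof (induction b arbitrary: g h)
  case (Suc b)
  have I: "open I" using Suc.prems by (simp add: smooth_real_def)
  have "taylor b (deriv (\<lambda>t. g t + h t)) s = taylor b (\<lambda>t. deriv g t + deriv h t) s"
    by (rule taylor_cong[OF I Suc.prems(3)], rule DERIV_imp_deriv, rule DERIV_add; rule smooth_real_has_deriv)
      (use Suc.prems in simp_all)
  also have "\<dots> = taylor b (deriv g) s + taylor b (deriv h) s"
    by (intro Suc.IH smooth_real_deriv Suc.prems)
  finally have "real (Suc b) * taylor (Suc b) (\<lambda>t. g t + h t) s = real (Suc b) * (taylor (Suc b) g s + taylor (Suc b) h s)"
    by (simp only: taylor_deriv distrib_left)
  then show ?case by (rule mult_left_cancel[OF of_nat_neq_0, THEN iffD1])
qed simp

lemma taylor_zero: "taylor b (\<lambda>t. 0) s = 0"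
proof (induction b)
  case (Suc b)
  have "deriv (\<lambda>t::real. 0::real) = (\<lambda>t. 0)" by (simp add: fun_eq_iff)
  then show ?case using taylor_deriv[of b "\<lambda>t. 0" s] Suc by simp
qed simp

lemma taylor_sum:
  assumes "open I" "\<And>j. j \<in> A \<Longrightarrow> smooth_real I (f j)" "s \<in> I"
  shows "taylor b (\<lambda>t. \<Sum>j\<in>A. f j t) s = (\<Sum>j\<in>A. taylor b (f j) s)"
  using assms(2)
proof (induction A rule: infinite_finite_induct)
  case (insert x A)
  then show ?case
    by (simp add: taylor_add[OF _ smooth_real_sum[OF assms(1)] assms(3)])
qed (simp_all add: taylor_zero)

text \<open>After multiplication by \<open>Suc b\<close> the product rule gives two convolutions, in
  which the term of index \<gamma> carries the weights \<gamma> and \<open>Suc b - \<gamma>\<close>.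
  The weights add up to \<open>Suc b\<close>, which is then cancelled.\<close>

lemma taylor_mult:
  assumes "smooth_real I g" "smooth_real I h" "s \<in> I"
  shows "taylor b (\<lambda>t. g t * h t) s = (\<Sum>\<gamma>\<le>b. taylor \<gamma> g s * taylor (b - \<gamma>) h s)"
  using assms
proof (induction b arbitrary: g h)
  case (Suc b)
  have I: "open I" using Suc.prems by (simp add: smooth_real_def)
  let ?a = "\<lambda>\<gamma>. taylor \<gamma> g s" and ?b = "\<lambda>\<gamma>. taylor \<gamma> h s"
  have "real (Suc b) * taylor (Suc b) (\<lambda>t. g t * h t) s = taylor b (deriv (\<lambda>t. g t * h t)) s"
    by (simp only: taylor_deriv)
  also have "\<dots> = taylor b (\<lambda>t. deriv g t * h t + g t * deriv h t) s"
  proof (rule taylor_cong[OF I Suc.prems(3)])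
    fix t assume "t \<in> I"
    then show "deriv (\<lambda>t. g t * h t) t = deriv g t * h t + g t * deriv h t"
      using Suc.prems by (intro DERIV_imp_deriv DERIV_cong[OF DERIV_mult[OF smooth_real_has_deriv smooth_real_has_deriv]]) auto
  qed
  also have "\<dots> = taylor b (\<lambda>t. deriv g t * h t) s + taylor b (\<lambda>t. g t * deriv h t) s"
    using Suc.prems by (intro taylor_add[of I] smooth_real_mult smooth_real_deriv) auto
  also have "\<dots> = (\<Sum>\<gamma>\<le>b. taylor \<gamma> (deriv g) s * ?b (b - \<gamma>)) + (\<Sum>\<gamma>\<le>b. ?a \<gamma> * taylor (b - \<gamma>) (deriv h) s)"
    using Suc.IH[of "deriv g" h] Suc.IH[of g "deriv h"] Suc.prems smooth_real_deriv by simp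
  \<comment> \<open>Both sums are extended to \<open>{..Suc b}\<close>; the term added at either end
    has weight 0.\<close>
  also have "(\<Sum>\<gamma>\<le>b. taylor \<gamma> (deriv g) s * ?b (b - \<gamma>)) = (\<Sum>\<gamma>\<le>Suc b. real \<gamma> * (?a \<gamma> * ?b (Suc b - \<gamma>)))"
    unfolding sum.atMost_Suc_shift by (simp add: taylor_deriv algebra_simps)
  also have "(\<Sum>\<gamma>\<le>b. ?a \<gamma> * taylor (b - \<gamma>) (deriv h) s) = (\<Sum>\<gamma>\<le>Suc b. real (Suc b - \<gamma>) * (?a \<gamma> * ?b (Suc b - \<gamma>)))"
    by (simp add: taylor_deriv Suc_diff_le algebra_simps)
  also have "(\<Sum>\<gamma>\<le>Suc b. real \<gamma> * (?a \<gamma> * ?b (Suc b - \<gamma>))) + \<dots> = (\<Sum>\<gamma>\<le>Suc b. real (Suc b) * (?a \<gamma> * ?b (Suc b - \<gamma>)))"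
    unfolding sum.distrib[symmetric]
  proof (rule sum.cong[OF refl])
    fix \<gamma> assume "\<gamma> \<in> {..Suc b}"
    then have "real (Suc b) = real \<gamma> + real (Suc b - \<gamma>)" by (simp add: of_nat_diff)
    then show "real \<gamma> * (?a \<gamma> * ?b (Suc b - \<gamma>)) + real (Suc b - \<gamma>) * (?a \<gamma> * ?b (Suc b - \<gamma>)) =
      real (Suc b) * (?a \<gamma> * ?b (Suc b - \<gamma>))" by (simp only: distrib_right)
  qed
  also have "\<dots> = real (Suc b) * (\<Sum>\<gamma>\<le>Suc b. ?a \<gamma> * ?b (Suc b - \<gamma>))"
    by (simp only: sum_distrib_left)
  finally show ?case by (rule mult_left_cancel[OF of_nat_neq_0, THEN iffD1])
qed simp

text \<open>The tool for realising prescribed jet coordinates: differentiation shifts the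
  coefficients of a polynomial, so its Taylor coefficients at 0 are the given ones.\<close>

lemma taylor_polynomial:
  "taylor b (\<lambda>t. \<Sum>\<alpha><k. x \<alpha> * t ^ \<alpha>) 0 = (if b < k then x b else 0)"
proof (induction b arbitrary: x k)
  case 0
  show ?case by (cases k) (simp_all add: sum.lessThan_Suc_shift)
next
  case (Suc b)
  have "deriv (\<lambda>t. \<Sum>\<alpha><k. x \<alpha> * t ^ \<alpha>) = (\<lambda>t. \<Sum>\<alpha><k - 1. (real (Suc \<alpha>) * x (Suc \<alpha>)) * t ^ \<alpha>)"
  proof
    fix t :: real
    have "((\<lambda>t. \<Sum>\<alpha><k. x \<alpha> * t ^ \<alpha>) has_real_derivative (\<Sum>\<alpha><k. x \<alpha> * (real \<alpha> * t ^ (\<alpha> - 1)))) (at t)"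
      by (rule DERIV_sum) (auto intro!: derivative_eq_intros)
    moreover have "(\<Sum>\<alpha><k. x \<alpha> * (real \<alpha> * t ^ (\<alpha> - 1))) = (\<Sum>\<alpha><k - 1. (real (Suc \<alpha>) * x (Suc \<alpha>)) * t ^ \<alpha>)"
      by (cases k) (simp_all only: sum.lessThan_Suc_shift, simp_all add: algebra_simps)
    ultimately show "deriv (\<lambda>t. \<Sum>\<alpha><k. x \<alpha> * t ^ \<alpha>) t = (\<Sum>\<alpha><k - 1. (real (Suc \<alpha>) * x (Suc \<alpha>)) * t ^ \<alpha>)"
      by (simp add: DERIV_imp_deriv)
  qed
  then have "real (Suc b) * taylor (Suc b) (\<lambda>t. \<Sum>\<alpha><k. x \<alpha> * t ^ \<alpha>) 0 =
    (if b < k - 1 then real (Suc b) * x (Suc b) else 0)"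
    by (simp only: Suc.IH flip: taylor_deriv)
  then show ?case by (auto split: if_splits simp: less_diff_conv)
qed

lemma deriv_compose_curve:
  assumes f: "smooth_fun_on n U f" and c: "\<And>j. j < n \<Longrightarrow> smooth_real I (\<lambda>t. c t j)"
    and I: "open I" and cU: "\<And>t. t \<in> I \<Longrightarrow> c t \<in> U" and t: "t \<in> I"
  shows "deriv (\<lambda>t. f (c t)) t = (\<Sum>j<n. partial_deriv j f (c t) * deriv (\<lambda>t. c t j) t)"
proof -
  have "\<forall>\<^sub>F t in nhds t. c t \<in> U" using I cU t eventually_nhds by blast
  then show ?thesis
    by (intro DERIV_imp_deriv C_diff_chain_curve[OF smooth_fun_on_openin[OF f] smooth_fun_on_C_diff[OF f]]
        smooth_real_has_deriv[OF c t])
qed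


section \<open>Truncation, cylinders, and Taylor coefficients of compositions\<close>

definition trunc :: "nat \<Rightarrow> (nat \<Rightarrow> real) \<Rightarrow> nat \<Rightarrow> real" where
  "trunc n x = (\<lambda>i. if i < n then x i else 0)"

lemma trunc_apply [simp]: "i < n \<Longrightarrow> trunc n x i = x i" "\<not> i < n \<Longrightarrow> trunc n x i = 0"
  by (simp_all add: trunc_def)

lemma trunc_esp [simp]: "trunc n x \<in> esp n" by (simp add: mem_esp)

lemma trunc_id: "x \<in> esp n \<Longrightarrow> trunc n x = x" by (auto simp: mem_esp trunc_def fun_eq_iff)

lemma trunc_trunc [simp]: "trunc m (trunc n x) = trunc (min m n) x"
  by (auto simp: trunc_def)

lemma trunc_eqI: "(\<And>i. i < n \<Longrightarrow> x i = y i) \<Longrightarrow> trunc n x = trunc n y"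
  by (auto simp: trunc_def)

text \<open>The shape of the image of a bundle chart over a chart of the base: base coordinates come
  first and lie in \<open>U\<close>, fibre coordinates are arbitrary.\<close>

definition cyl :: "nat \<Rightarrow> nat \<Rightarrow> (nat \<Rightarrow> real) set \<Rightarrow> (nat \<Rightarrow> real) set" where
  "cyl n m U = {x \<in> esp m. trunc n x \<in> U}"

lemma openin_cyl:
  assumes "openin (Euclidean_space n) U" "n \<le> m" shows "openin (Euclidean_space m) (cyl n m U)"
proof -
  have "smooth_fun_on m (esp m) (\<lambda>x. trunc n x j)" if "j < n" for j
    using that by (simp add: smooth_fun_on_coord)
  then show ?thesis
    using openin_smooth_preimage[of m "esp m" n U "trunc n"] assms
    by (simp add: cyl_def)
qed

text \<open>\<open>jet_taylor n \<beta> f x\<close> is the \<open>\<beta>\<close>-th Taylor coefficient of \<open>f\<close> along a curve whose own Taylor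
  coefficients are stored in \<open>x\<close>.  The recursion is Leibniz' rule applied to the derivative
  of \<open>f \<circ> c\<close>, which is the sum of the \<open>(\<partial>\<^sub>i f \<circ> c) \<cdot> c\<^sub>i'\<close>.\<close>

function jet_taylor :: "nat \<Rightarrow> nat \<Rightarrow> ((nat \<Rightarrow> real) \<Rightarrow> real) \<Rightarrow> (nat \<Rightarrow> real) \<Rightarrow> real" where
  "jet_taylor n 0 f x = f (trunc n x)"
| "jet_taylor n (Suc \<beta>) f x = (\<Sum>\<gamma>\<le>\<beta>. \<Sum>i<n. real (Suc \<gamma>) * x (Suc \<gamma> * n + i) *
      jet_taylor n (\<beta> - \<gamma>) (partial_deriv i f) x) / real (Suc \<beta>)"
  by pat_completeness auto
termination by (relation "Wellfounded.measure (\<lambda>(n, \<beta>, f, x). \<beta>)") auto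

declare jet_taylor.simps(2) [simp del]

lemma index_less: "i < n \<Longrightarrow> \<gamma> \<le> \<beta> \<Longrightarrow> Suc \<beta> * n \<le> m \<Longrightarrow> \<gamma> * n + i < (m::nat)"
proof -
  assume i: "i < n" and "\<gamma> \<le> \<beta>" and m: "Suc \<beta> * n \<le> m"
  then have "\<gamma> * n \<le> \<beta> * n" by simp
  then show "\<gamma> * n + i < m" using i m unfolding mult_Suc by linarith
qed

lemma index_eq_iff: "i < n \<Longrightarrow> j < n \<Longrightarrow> a * n + i = b * n + j \<longleftrightarrow> a = b \<and> i = (j::nat)"
proof -
  assume "i < n" "j < n"
  then have "(a * n + i) div n = a" "(a * n + i) mod n = i" "(b * n + j) div n = b" "(b * n + j) mod n = j"
    by simp_all
  then show ?thesis by metis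
qed

text \<open>Faa di Bruno's formula in recursive form. The Leibniz sum for the derivative of the
  composition involves all lower orders and the partial derivatives of \<open>f\<close>, hence
  strong induction with \<open>f\<close> generalised.\<close>

lemma taylor_compose_curve:
  assumes f: "smooth_fun_on n U f" and c: "\<And>j. j < n \<Longrightarrow> smooth_real I (\<lambda>t. c t j)"
    and I: "open I" and cU: "\<And>t. t \<in> I \<Longrightarrow> c t \<in> U" and s: "s \<in> I"
    and x: "\<And>\<gamma> i. \<gamma> \<le> \<beta> \<Longrightarrow> i < n \<Longrightarrow> x (\<gamma> * n + i) = taylor \<gamma> (\<lambda>t. c t i) s"
  shows "taylor \<beta> (\<lambda>t. f (c t)) s = jet_taylor n \<beta> f x"
  using f x
proof (induction \<beta> arbitrary: f rule: less_induct)
  case (less \<beta>)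
  have cE: "c s \<in> esp n" using cU[OF s] openin_subset[OF smooth_fun_on_openin[OF less.prems(1)]] by auto
  show ?case
  proof (cases \<beta>)
    case 0
    have "trunc n x = c s"
      using less.prems(2)[of 0] cE by (auto simp: trunc_def fun_eq_iff mem_esp)
    then show ?thesis using 0 by simp
  next
    case (Suc b)
    have sm: "smooth_real I (\<lambda>t. partial_deriv i f (c t))" if "i < n" for i
      using smooth_real_compose[OF smooth_fun_on_partial_deriv[OF less.prems(1) that] I c cU] by simp
    have "real (Suc b) * taylor (Suc b) (\<lambda>t. f (c t)) s = taylor b (deriv (\<lambda>t. f (c t))) s"
      by (simp only: taylor_deriv)
    also have "\<dots> = taylor b (\<lambda>t. \<Sum>i<n. deriv (\<lambda>t. c t i) t * partial_deriv i f (c t)) s"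
      by (rule taylor_cong[OF I s]) (simp add: deriv_compose_curve[OF less.prems(1) c I cU] mult.commute)
    also have "\<dots> = (\<Sum>i<n. taylor b (\<lambda>t. deriv (\<lambda>t. c t i) t * partial_deriv i f (c t)) s)"
      using sm c by (intro taylor_sum[OF I _ s] smooth_real_mult smooth_real_deriv) auto
    also have "\<dots> = (\<Sum>i<n. \<Sum>\<gamma>\<le>b. taylor \<gamma> (deriv (\<lambda>t. c t i)) s * taylor (b - \<gamma>) (\<lambda>t. partial_deriv i f (c t)) s)"
      using sm c s by (intro sum.cong refl taylor_mult smooth_real_deriv) auto
    also have "\<dots> = (\<Sum>i<n. \<Sum>\<gamma>\<le>b. real (Suc \<gamma>) * x (Suc \<gamma> * n + i) * jet_taylor n (b - \<gamma>) (partial_deriv i f) x)"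
    proof (intro sum.cong refl)
      fix i \<gamma> assume i: "i \<in> {..<n}" and \<gamma>: "\<gamma> \<in> {..b}"
      have "taylor (b - \<gamma>) (\<lambda>t. partial_deriv i f (c t)) s = jet_taylor n (b - \<gamma>) (partial_deriv i f) x"
        using i Suc by (intro less.IH smooth_fun_on_partial_deriv[OF less.prems(1)] less.prems(2)) auto
      moreover have "x (Suc \<gamma> * n + i) = taylor (Suc \<gamma>) (\<lambda>t. c t i) s"
        using i \<gamma> Suc by (intro less.prems(2)) auto
      ultimately show "taylor \<gamma> (deriv (\<lambda>t. c t i)) s * taylor (b - \<gamma>) (\<lambda>t. partial_deriv i f (c t)) s =
         real (Suc \<gamma>) * x (Suc \<gamma> * n + i) * jet_taylor n (b - \<gamma>) (partial_deriv i f) x"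
        by (simp only: taylor_deriv)
    qed
    also have "\<dots> = real (Suc b) * jet_taylor n (Suc b) f x"
      unfolding jet_taylor.simps by (subst sum.swap) simp
    finally show ?thesis unfolding Suc by (rule mult_left_cancel[OF of_nat_neq_0, THEN iffD1])
  qed
qed

text \<open>Allows partial derivatives of \<open>f\<close> to be interchanged under
  \<open>jet_taylor\<close>, since symmetry of second derivatives is available on \<open>U\<close>
  only.\<close>

lemma jet_taylor_cong:
  assumes U: "openin (Euclidean_space n) U" and x: "trunc n x \<in> U" and "\<And>x. x \<in> U \<Longrightarrow> f x = g x"
  shows "jet_taylor n \<beta> f x = jet_taylor n \<beta> g x"
  using assms(3)
proof (induction \<beta> arbitrary: f g rule: less_induct)
  case (less \<beta>)
  show ?case
  proof (cases \<beta>)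
    case 0
    then show ?thesis using less.prems x by simp
  next
    case (Suc b)
    have "jet_taylor n (b - \<gamma>) (partial_deriv i f) x = jet_taylor n (b - \<gamma>) (partial_deriv i g) x" if "i < n" for i \<gamma>
      using Suc partial_deriv_cong[OF U _ that less.prems] by (intro less.IH) auto
    then show ?thesis unfolding Suc jet_taylor.simps by simp
  qed
qed

lemma smooth_jet_taylor:
  assumes "smooth_fun_on n U f" "Suc \<beta> * n \<le> m"
  shows "smooth_fun_on m (cyl n m U) (jet_taylor n \<beta> f)"
  using assms
proof (induction \<beta> arbitrary: f rule: less_induct)
  case (less \<beta>)
  have "n \<le> m" using less.prems(2) by simp
  then have X: "openin (Euclidean_space m) (cyl n m U)"
    by (rule openin_cyl[OF smooth_fun_on_openin[OF less.prems(1)]])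
  show ?case
  proof (cases \<beta>)
    case 0
    have "smooth_fun_on m (cyl n m U) (\<lambda>x. f (trunc n x))"
      using X by (intro smooth_fun_on_compose[OF less.prems(1) X]) (auto simp: cyl_def smooth_fun_on_coord)
    then show ?thesis unfolding 0 by (simp add: eta_contract_eq)
  next
    case (Suc b)
    have "smooth_fun_on m (cyl n m U) (\<lambda>x. (\<Sum>\<gamma>\<le>b. \<Sum>i<n. real (Suc \<gamma>) * x (Suc \<gamma> * n + i) *
      jet_taylor n (b - \<gamma>) (partial_deriv i f) x) / real (Suc b))"
    proof (intro smooth_fun_on_divide smooth_fun_on_sum[OF X] smooth_fun_on_mult smooth_fun_on_const[OF X] smooth_fun_on_coord[OF X])
      fix \<gamma> i assume "i \<in> {..<n}"
      have "Suc (b - \<gamma>) * n \<le> Suc \<beta> * n" using Suc by (intro mult_le_mono1) simp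
      then show "smooth_fun_on m (cyl n m U) (jet_taylor n (b - \<gamma>) (partial_deriv i f))"
        using Suc less.prems \<open>i \<in> {..<n}\<close> by (intro less.IH smooth_fun_on_partial_deriv) auto
    qed
    then show ?thesis
      unfolding Suc by (rule smooth_fun_on_cong) (simp only: jet_taylor.simps)
  qed
qed

lemma partial_deriv_has_deriv:
  assumes "smooth_fun_on m U f" "x \<in> U" "i < m"
  shows "((\<lambda>t. f (x(i := t))) has_real_derivative partial_deriv i f x) (at (x i))"
  by (rule partial_deriv_DERIV[OF smooth_fun_on_C_diff[OF assms(1), of "Suc 0"] assms(2,3) refl])

text \<open>This Toeplitz shape of the Jacobian is what makes the almost tangent structure independent
  of the chart.\<close>

lemma partial_deriv_jet_taylor:
  assumes "smooth_fun_on n U f" "Suc \<beta> * n \<le> m" "i < n" "\<alpha> * n + i < m" "x \<in> cyl n m U"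
  shows "partial_deriv (\<alpha> * n + i) (jet_taylor n \<beta> f) x =
    (if \<alpha> \<le> \<beta> then jet_taylor n (\<beta> - \<alpha>) (partial_deriv i f) x else 0)"
  using assms
proof (induction \<beta> arbitrary: f rule: less_induct)
  case (less \<beta>)
  note f = less.prems(1) and m = less.prems(2) and i = less.prems(3) and \<alpha> = less.prems(4) and x = less.prems(5)
  have U: "openin (Euclidean_space n) U" using f by (rule smooth_fun_on_openin)
  have xU: "trunc n x \<in> U" using x by (simp add: cyl_def)
  show ?case
  proof (cases \<beta>)
    case 0
    show ?thesis
    proof (cases "\<alpha> = 0")
      case True
      have "(\<lambda>t. jet_taylor n 0 f (x(i := t))) = (\<lambda>t. f ((trunc n x)(i := t)))"
        using i by (auto simp: fun_eq_iff trunc_def intro!: arg_cong[of _ _ f])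
      then show ?thesis using 0 True i by (simp add: partial_deriv_def)
    next
      case False
      have "trunc n (x(\<alpha> * n + i := t)) = trunc n x" for t
      proof -
        \<comment> \<open>For \<alpha> at least 1 the varied coordinate lies outside the block that
          \<open>f\<close> sees.\<close>
        have "n \<le> \<alpha> * n" using False by (cases \<alpha>) auto
        then have "\<alpha> * n + i \<noteq> k" if "k < n" for k using that by linarith
        then show ?thesis by (intro trunc_eqI) (metis fun_upd_other)
      qed
      then show ?thesis using 0 False by (simp add: partial_deriv_def)
    qed
  next
    case (Suc b)
    let ?j = "\<alpha> * n + i" and ?T = "jet_taylor n"
    have IH: "partial_deriv ?j (?T (b - \<gamma>) (partial_deriv j f)) x =
        (if \<alpha> \<le> b - \<gamma> then ?T (b - \<gamma> - \<alpha>) (partial_deriv j (partial_deriv i f)) x else 0)" if j: "j < n" for j \<gamma>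
    proof -
      have "Suc (b - \<gamma>) * n \<le> Suc \<beta> * n" using Suc by (intro mult_le_mono1) simp
      then have "partial_deriv ?j (?T (b - \<gamma>) (partial_deriv j f)) x =
        (if \<alpha> \<le> b - \<gamma> then ?T (b - \<gamma> - \<alpha>) (partial_deriv i (partial_deriv j f)) x else 0)"
        using Suc m by (intro less.IH smooth_fun_on_partial_deriv[OF f j] i \<alpha> x) auto
      \<comment> \<open>The recursion differentiates \<open>f\<close> by \<open>j\<close> first,
        while the claim is about \<open>partial_deriv i f\<close>; symmetry of second derivatives
        reorders them.\<close>
      also have "?T (b - \<gamma> - \<alpha>) (partial_deriv i (partial_deriv j f)) x = ?T (b - \<gamma> - \<alpha>) (partial_deriv j (partial_deriv i f)) x"
        by (rule jet_taylor_cong[OF U xU partial_deriv_commute[OF U smooth_fun_on_C_diff[OF f] i j]])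
      finally show ?thesis .
    qed
    define A where "A \<gamma> j = ?T (b - \<gamma>) (partial_deriv j f) x" for \<gamma> j
    define B where "B \<gamma> j = (if \<alpha> \<le> b - \<gamma> then ?T (b - \<gamma> - \<alpha>) (partial_deriv j (partial_deriv i f)) x else 0)" for \<gamma> j
    \<comment> \<open>Product rule for one summand of the recursion. The coordinate factor
      contributes only if the varied coordinate is the one it reads.\<close>
    have D1: "((\<lambda>t. real (Suc \<gamma>) * (x(?j := t)) (Suc \<gamma> * n + j) * ?T (b - \<gamma>) (partial_deriv j f) (x(?j := t)))
       has_real_derivative (real (Suc \<gamma>) * (if Suc \<gamma> = \<alpha> \<and> j = i then 1 else 0)) * A \<gamma> j +
          real (Suc \<gamma>) * x (Suc \<gamma> * n + j) * B \<gamma> j) (at (x ?j))"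
      if j: "j < n" and \<gamma>: "\<gamma> \<le> b" for \<gamma> j
    proof -
      have "Suc (b - \<gamma>) * n \<le> Suc \<beta> * n" using Suc by (intro mult_le_mono1) simp
      then have "Suc (b - \<gamma>) * n \<le> m" using m by (rule order_trans)
      then have sm: "smooth_fun_on m (cyl n m U) (?T (b - \<gamma>) (partial_deriv j f))"
        by (intro smooth_jet_taylor smooth_fun_on_partial_deriv[OF f j])
      have *: "((\<lambda>t. ?T (b - \<gamma>) (partial_deriv j f) (x(?j := t))) has_real_derivative B \<gamma> j) (at (x ?j))"
        using partial_deriv_has_deriv[OF sm x \<alpha>] unfolding IH[OF j] B_def .
      have "((\<lambda>t. (x(?j := t)) (Suc \<gamma> * n + j)) has_real_derivative (if Suc \<gamma> = \<alpha> \<and> j = i then 1 else 0)) (at (x ?j))"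
      proof (cases "Suc \<gamma> = \<alpha> \<and> j = i")
        case True
        then show ?thesis by auto
      next
        case False
        then have "Suc \<gamma> * n + j \<noteq> ?j" unfolding index_eq_iff[OF j i] .
        then show ?thesis using False by (simp only: fun_upd_def if_False DERIV_const)
      qed
      from DERIV_mult[OF DERIV_cmult[OF this, of "real (Suc \<gamma>)"] *]
      show ?thesis by (simp add: A_def algebra_simps)
    qed
    have "((\<lambda>t. ?T \<beta> f (x(?j := t))) has_real_derivative
      (\<Sum>\<gamma>\<le>b. \<Sum>j<n. (real (Suc \<gamma>) * (if Suc \<gamma> = \<alpha> \<and> j = i then 1 else 0)) * A \<gamma> j +
          real (Suc \<gamma>) * x (Suc \<gamma> * n + j) * B \<gamma> j) / real (Suc b)) (at (x ?j))"
      unfolding Suc jet_taylor.simps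
      by (intro DERIV_cdivide DERIV_sum D1) auto
    then have "real (Suc b) * partial_deriv ?j (?T \<beta> f) x =
       (\<Sum>\<gamma>\<le>b. \<Sum>j<n. (real (Suc \<gamma>) * (if Suc \<gamma> = \<alpha> \<and> j = i then 1 else 0)) * A \<gamma> j +
          real (Suc \<gamma>) * x (Suc \<gamma> * n + j) * B \<gamma> j)"
      by (simp add: partial_deriv_def DERIV_imp_deriv)
    also have "\<dots> = (\<Sum>\<gamma>\<le>b. \<Sum>j<n. if \<gamma> = \<alpha> - 1 \<and> j = i \<and> \<alpha> \<ge> 1 then real \<alpha> * A (\<alpha> - 1) i else 0) +
       (\<Sum>\<gamma>\<le>b. \<Sum>j<n. real (Suc \<gamma>) * x (Suc \<gamma> * n + j) * B \<gamma> j)"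
      unfolding sum.distrib by (intro arg_cong2[where f="(+)"] sum.cong refl) auto
    also have "(\<Sum>\<gamma>\<le>b. \<Sum>j<n. if \<gamma> = \<alpha> - 1 \<and> j = i \<and> \<alpha> \<ge> 1 then real \<alpha> * A (\<alpha> - 1) i else 0) =
       (\<Sum>\<gamma>\<le>b. if \<gamma> = \<alpha> - 1 then (if \<alpha> \<ge> 1 then real \<alpha> * A (\<alpha> - 1) i else 0) else 0)"
    proof (rule sum.cong[OF refl])
      fix \<gamma>
      have "(\<Sum>j<n. if \<gamma> = \<alpha> - 1 \<and> j = i \<and> \<alpha> \<ge> 1 then real \<alpha> * A (\<alpha> - 1) i else 0) =
        (\<Sum>j<n. if j = i then (if \<gamma> = \<alpha> - 1 \<and> \<alpha> \<ge> 1 then real \<alpha> * A (\<alpha> - 1) i else 0) else 0)"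
        by (intro sum.cong) auto
      then show "(\<Sum>j<n. if \<gamma> = \<alpha> - 1 \<and> j = i \<and> \<alpha> \<ge> 1 then real \<alpha> * A (\<alpha> - 1) i else 0) =
        (if \<gamma> = \<alpha> - 1 then (if \<alpha> \<ge> 1 then real \<alpha> * A (\<alpha> - 1) i else 0) else 0)"
        using i by simp
    qed
    also have "\<dots> = (if 1 \<le> \<alpha> \<and> \<alpha> \<le> \<beta> then real \<alpha> * ?T (\<beta> - \<alpha>) (partial_deriv i f) x else 0)"
      using Suc by (auto simp: A_def Suc_diff_le)
    also have "(\<Sum>\<gamma>\<le>b. \<Sum>j<n. real (Suc \<gamma>) * x (Suc \<gamma> * n + j) * B \<gamma> j) =
       (if \<alpha> \<le> b then real (Suc (b - \<alpha>)) * ?T (Suc (b - \<alpha>)) (partial_deriv i f) x else 0)"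
    proof (cases "\<alpha> \<le> b")
      case True
      \<comment> \<open>The terms beyond \<open>b - \<alpha>\<close> vanish, and the others are the
        recursion for order \<open>Suc (b - \<alpha>)\<close> of
        \<open>partial_deriv i f\<close>.\<close>
      have "(\<Sum>\<gamma>\<le>b. \<Sum>j<n. real (Suc \<gamma>) * x (Suc \<gamma> * n + j) * B \<gamma> j) =
        (\<Sum>\<gamma>\<le>b - \<alpha>. \<Sum>j<n. real (Suc \<gamma>) * x (Suc \<gamma> * n + j) * ?T (b - \<alpha> - \<gamma>) (partial_deriv j (partial_deriv i f)) x)"
      proof (rule sum.mono_neutral_cong_right)
        show "\<forall>\<gamma>\<in>{..b} - {..b - \<alpha>}. (\<Sum>j<n. real (Suc \<gamma>) * x (Suc \<gamma> * n + j) * B \<gamma> j) = 0"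
        proof
          fix \<gamma> assume "\<gamma> \<in> {..b} - {..b - \<alpha>}"
          then have "\<not> \<alpha> \<le> b - \<gamma>" by auto
          then show "(\<Sum>j<n. real (Suc \<gamma>) * x (Suc \<gamma> * n + j) * B \<gamma> j) = 0" by (simp add: B_def)
        qed
        fix \<gamma> assume "\<gamma> \<in> {..b - \<alpha>}"
        then have "\<alpha> \<le> b - \<gamma>" "b - \<gamma> - \<alpha> = b - \<alpha> - \<gamma>" using True by auto
        then show "(\<Sum>j<n. real (Suc \<gamma>) * x (Suc \<gamma> * n + j) * B \<gamma> j) =
          (\<Sum>j<n. real (Suc \<gamma>) * x (Suc \<gamma> * n + j) * ?T (b - \<alpha> - \<gamma>) (partial_deriv j (partial_deriv i f)) x)"
          by (simp add: B_def)
      qed auto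
      then show ?thesis using True unfolding jet_taylor.simps by simp
    next
      case False
      then have "\<not> \<alpha> \<le> b - \<gamma>" for \<gamma> by simp
      then show ?thesis using False by (simp add: B_def)
    qed
    finally have "real (Suc b) * partial_deriv ?j (?T \<beta> f) x =
      real (Suc b) * (if \<alpha> \<le> \<beta> then ?T (\<beta> - \<alpha>) (partial_deriv i f) x else 0)"
    proof (rule trans)
      \<comment> \<open>In the middle range both parts are multiples of the same coefficient, with
        weights \<alpha> and \<open>\<beta> - \<alpha>\<close>, which add up to
        \<open>Suc b\<close>. At \<alpha> = 0 and at \<open>\<alpha> = Suc b\<close> one part alone
        carries the full weight.\<close>
      consider "\<alpha> = 0" | "1 \<le> \<alpha>" "\<alpha> \<le> b" | "\<alpha> = Suc b" | "\<alpha> > Suc b" by linarith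
      then show "(if 1 \<le> \<alpha> \<and> \<alpha> \<le> \<beta> then real \<alpha> * ?T (\<beta> - \<alpha>) (partial_deriv i f) x else 0) +
         (if \<alpha> \<le> b then real (Suc (b - \<alpha>)) * ?T (Suc (b - \<alpha>)) (partial_deriv i f) x else 0) =
         real (Suc b) * (if \<alpha> \<le> \<beta> then ?T (\<beta> - \<alpha>) (partial_deriv i f) x else 0)"
      proof cases
        case 2
        then have "Suc (b - \<alpha>) = \<beta> - \<alpha>" "real (\<beta> - \<alpha>) = real (Suc b) - real \<alpha>" using Suc by (auto simp: of_nat_diff)
        then show ?thesis using 2 Suc by (simp add: algebra_simps)
      qed (use Suc in auto)
    qed
    then show ?thesis by (rule mult_left_cancel[OF of_nat_neq_0, THEN iffD1])
  qed
qed


section \<open>Atlases and smooth maps\<close>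

declare mult_Suc [simp del]

text \<open>Isolates the conditions on charts, which suffice for all coordinate arguments. Whitney
  sums, restrictions and products enter only through this property; for jet bundles the two
  topological conditions are added later.\<close>

definition smooth_atlas :: "'a mfd \<Rightarrow> bool" where
  "smooth_atlas M \<longleftrightarrow>
     (\<forall>(U, \<phi>)\<in>atlas M. inj_on \<phi> U \<and> openin (Euclidean_space (mdim M)) (\<phi> ` U)) \<and>
     (\<forall>(U, \<phi>)\<in>atlas M. \<forall>(V, \<psi>)\<in>atlas M. \<forall>j<mdim M.
        smooth_fun_on (mdim M) (\<phi> ` (U \<inter> V)) (\<lambda>x. \<psi> (inv_into U \<phi> x) j)) \<and>
     (\<forall>(U, \<phi>)\<in>atlas M. \<forall>(V, \<psi>)\<in>atlas M.
        openin (Euclidean_space (mdim M)) (\<phi> ` (U \<inter> V)))"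

lemma smooth_manifold_iff:
  "smooth_manifold M \<longleftrightarrow> smooth_atlas M \<and> Hausdorff_space (mfd_topology M) \<and> second_countable (mfd_topology M)"
  by (simp only: smooth_manifold_def smooth_atlas_def conj_assoc)

lemma smooth_manifold_atlas: "smooth_manifold M \<Longrightarrow> smooth_atlas M"
  by (simp add: smooth_manifold_iff)

lemma chart_points: "(U, \<phi>) \<in> atlas M \<Longrightarrow> x \<in> U \<Longrightarrow> x \<in> points M"
  by (auto simp: points_def)

lemma points_chart:
  assumes "x \<in> points M" obtains U \<phi> where "(U, \<phi>) \<in> atlas M" "x \<in> U"
  using assms by (auto simp: points_def)

lemma chart_inj: "smooth_atlas M \<Longrightarrow> (U, \<phi>) \<in> atlas M \<Longrightarrow> inj_on \<phi> U"
  unfolding smooth_atlas_def by fast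

lemma chart_open: "smooth_atlas M \<Longrightarrow> (U, \<phi>) \<in> atlas M \<Longrightarrow> openin (Euclidean_space (mdim M)) (\<phi> ` U)"
  unfolding smooth_atlas_def by fast

lemma chart_overlap_open:
  "smooth_atlas M \<Longrightarrow> (U, \<phi>) \<in> atlas M \<Longrightarrow> (V, \<psi>) \<in> atlas M \<Longrightarrow>
    openin (Euclidean_space (mdim M)) (\<phi> ` (U \<inter> V))"
  unfolding smooth_atlas_def by fast

lemma chart_transition:
  "smooth_atlas M \<Longrightarrow> (U, \<phi>) \<in> atlas M \<Longrightarrow> (V, \<psi>) \<in> atlas M \<Longrightarrow> j < mdim M \<Longrightarrow>
    smooth_fun_on (mdim M) (\<phi> ` (U \<inter> V)) (\<lambda>x. \<psi> (inv_into U \<phi> x) j)"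
  unfolding smooth_atlas_def by fast

lemma chart_esp: "smooth_atlas M \<Longrightarrow> (U, \<phi>) \<in> atlas M \<Longrightarrow> x \<in> U \<Longrightarrow> \<phi> x \<in> esp (mdim M)"
  using openin_subset[OF chart_open] by (meson image_eqI subsetD)

lemma chart_inv: "smooth_atlas M \<Longrightarrow> (U, \<phi>) \<in> atlas M \<Longrightarrow> x \<in> U \<Longrightarrow> inv_into U \<phi> (\<phi> x) = x"
  by (rule inv_into_f_f[OF chart_inj])

text \<open>\<open>smooth_map\<close> speaks about all pairs of charts. One adapted pair around each
  point suffices, because any other pair differs from it by transition functions on both
  sides.\<close>

lemma smooth_map_local:
  assumes M: "smooth_atlas M" and N: "smooth_atlas N"
    and loc: "\<And>x. x \<in> points M \<Longrightarrow> \<exists>U \<phi> V \<psi>. (U, \<phi>) \<in> atlas M \<and> (V, \<psi>) \<in> atlas N \<and> x \<in> U \<and> f ` U \<subseteq> V \<and>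
       (\<forall>j<mdim N. smooth_fun_on (mdim M) (\<phi> ` U) (\<lambda>y. \<psi> (f (inv_into U \<phi> y)) j))"
  shows "smooth_map M N f"
proof -
  have pts: "f \<in> points M \<rightarrow> points N"
  proof
    fix x assume "x \<in> points M"
    from loc[OF this] obtain U V \<psi> where "x \<in> U" "f ` U \<subseteq> V" "(V, \<psi>) \<in> atlas N" by blast
    then show "f x \<in> points N" using chart_points by fastforce
  qed
  have key: "\<exists>B \<subseteq> \<phi>' ` (U' \<inter> f -` V'). a \<in> B \<and> openin (Euclidean_space (mdim M)) B \<and>
      (\<forall>j<mdim N. smooth_fun_on (mdim M) B (\<lambda>y. \<psi>' (f (inv_into U' \<phi>' y)) j))"
    if U': "(U', \<phi>') \<in> atlas M" and V': "(V', \<psi>') \<in> atlas N" and a: "a \<in> \<phi>' ` (U' \<inter> f -` V')"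
    for U' \<phi>' V' \<psi>' a
  proof -
    obtain x where x: "x \<in> U'" "f x \<in> V'" "a = \<phi>' x" using a by blast
    from loc[OF chart_points[OF U' x(1)]] obtain U \<phi> V \<psi> where U: "(U, \<phi>) \<in> atlas M" and V: "(V, \<psi>) \<in> atlas N"
      and xU: "x \<in> U" and fUV: "f ` U \<subseteq> V"
      and sm: "\<forall>j<mdim N. smooth_fun_on (mdim M) (\<phi> ` U) (\<lambda>y. \<psi> (f (inv_into U \<phi> y)) j)" by (elim exE conjE)
    define O' where "O' = \<phi>' ` (U' \<inter> U)"
    have O': "openin (Euclidean_space (mdim M)) O'"
      unfolding O'_def by (rule chart_overlap_open[OF M U' U])
    have inv': "inv_into U' \<phi>' y \<in> U' \<inter> U" "\<phi>' (inv_into U' \<phi>' y) = y" if "y \<in> O'" for y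
      using that chart_inv[OF M U'] by (auto simp: O'_def)
    define h where "h y = \<psi> (f (inv_into U' \<phi>' y))" for y
    have h: "smooth_fun_on (mdim M) O' (\<lambda>y. h y j)" if j: "j < mdim N" for j
    proof (rule smooth_fun_on_cong)
      show "smooth_fun_on (mdim M) O' (\<lambda>y. (\<lambda>z. \<psi> (f (inv_into U \<phi> z)) j) (\<phi> (inv_into U' \<phi>' y)))"
      proof (rule smooth_fun_on_compose[where V="\<phi> ` U" and f="\<lambda>z. \<psi> (f (inv_into U \<phi> z)) j"
            and G="\<lambda>y. \<phi> (inv_into U' \<phi>' y)", OF _ O'])
        show "smooth_fun_on (mdim M) (\<phi> ` U) (\<lambda>z. \<psi> (f (inv_into U \<phi> z)) j)" using sm j by blast
        show "smooth_fun_on (mdim M) O' (\<lambda>y. \<phi> (inv_into U' \<phi>' y) i)" if "i < mdim M" for i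
          unfolding O'_def by (rule chart_transition[OF M U' U that])
        show "(\<lambda>y. \<phi> (inv_into U' \<phi>' y)) \<in> O' \<rightarrow> \<phi> ` U" using inv' by blast
      qed
      show "\<And>y. y \<in> O' \<Longrightarrow> \<psi> (f (inv_into U \<phi> (\<phi> (inv_into U' \<phi>' y)))) j = h y j"
        using inv' chart_inv[OF M U] by (simp add: h_def)
    qed
    have hE: "h y \<in> \<psi> ` V" if "y \<in> O'" for y
      using inv'[OF that] fUV by (auto simp: h_def)
    \<comment> \<open>On \<open>B\<close> both transition functions apply: its points correspond to
      points of \<open>U\<close> and \<open>U'\<close> whose images lie in \<open>V\<close> and
      \<open>V'\<close>.\<close>
    define B where "B = {y \<in> O'. h y \<in> \<psi> ` (V \<inter> V')}"
    have Bop: "openin (Euclidean_space (mdim M)) B"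
      unfolding B_def
    proof (rule openin_smooth_preimage[OF O' chart_overlap_open[OF N V V'] h])
      show "h \<in> O' \<rightarrow> esp (mdim N)"
        using hE openin_subset[OF chart_open[OF N V]] by auto
    qed
    have inB: "f (inv_into U' \<phi>' y) \<in> V \<inter> V'" if y: "y \<in> B" for y
    proof -
      have "y \<in> O'" using y by (simp add: B_def)
      then have "f (inv_into U' \<phi>' y) \<in> V" using inv' fUV by auto
      moreover obtain w where "w \<in> V \<inter> V'" "\<psi> (f (inv_into U' \<phi>' y)) = \<psi> w"
        using y by (auto simp: B_def h_def)
      ultimately show ?thesis using chart_inj[OF N V] by (auto simp: inj_on_def)
    qed
    have "B \<subseteq> \<phi>' ` (U' \<inter> f -` V')"
    proof
      fix y assume y: "y \<in> B"
      then have "y \<in> O'" by (simp add: B_def)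
      then show "y \<in> \<phi>' ` (U' \<inter> f -` V')"
        using inv'[of y] inB[OF y] by (intro image_eqI[of _ _ "inv_into U' \<phi>' y"]) auto
    qed
    moreover have "a \<in> B"
    proof -
      have "a \<in> O'" using x xU by (auto simp: O'_def)
      moreover have "h a = \<psi> (f x)" using x chart_inv[OF M U'] by (simp add: h_def)
      moreover have "f x \<in> V" using xU fUV by auto
      ultimately show ?thesis using x by (auto simp: B_def)
    qed
    moreover have "smooth_fun_on (mdim M) B (\<lambda>y. \<psi>' (f (inv_into U' \<phi>' y)) j)" if j: "j < mdim N" for j
    proof (rule smooth_fun_on_cong)
      show "smooth_fun_on (mdim M) B (\<lambda>y. (\<lambda>w. \<psi>' (inv_into V \<psi> w) j) (h y))"
      proof (rule smooth_fun_on_compose[OF chart_transition[OF N V V' j] Bop])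
        show "smooth_fun_on (mdim M) B (\<lambda>y. h y i)" if "i < mdim N" for i
          by (rule smooth_fun_on_subset[OF h[OF that] _ Bop]) (auto simp: B_def)
        show "h \<in> B \<rightarrow> \<psi> ` (V \<inter> V')" by (auto simp: B_def)
      qed
      show "\<And>y. y \<in> B \<Longrightarrow> \<psi>' (inv_into V \<psi> (h y)) j = \<psi>' (f (inv_into U' \<phi>' y)) j"
        using inB chart_inv[OF N V] by (simp add: h_def)
    qed
    ultimately show ?thesis using Bop by blast
  qed
  show ?thesis
    unfolding smooth_map_def
  proof (intro conjI pts ballI, clarify, intro conjI allI impI)
    fix U \<phi> V \<psi> assume U: "(U, \<phi>) \<in> atlas M" and V: "(V, \<psi>) \<in> atlas N"
    show "openin (Euclidean_space (mdim M)) (\<phi> ` (U \<inter> f -` V))"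
    proof (subst openin_subopen, intro ballI)
      fix a assume "a \<in> \<phi> ` (U \<inter> f -` V)"
      from key[OF U V this] show "\<exists>T. openin (Euclidean_space (mdim M)) T \<and> a \<in> T \<and> T \<subseteq> \<phi> ` (U \<inter> f -` V)"
        by (elim exE conjE) (intro exI conjI)
    qed
    fix j assume j: "j < mdim N"
    show "smooth_fun_on (mdim M) (\<phi> ` (U \<inter> f -` V)) (\<lambda>x. \<psi> (f (inv_into U \<phi> x)) j)"
    proof (rule smooth_fun_on_local)
      fix a assume "a \<in> \<phi> ` (U \<inter> f -` V)"
      from key[OF U V this] obtain B where "B \<subseteq> \<phi> ` (U \<inter> f -` V)" "a \<in> B"
        "\<forall>j<mdim N. smooth_fun_on (mdim M) B (\<lambda>y. \<psi> (f (inv_into U \<phi> y)) j)" by (elim exE conjE)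
      then show "\<exists>B\<subseteq>\<phi> ` (U \<inter> f -` V). a \<in> B \<and> smooth_fun_on (mdim M) B (\<lambda>x. \<psi> (f (inv_into U \<phi> x)) j)"
        using j by (intro exI[of _ B]) simp
    qed
  qed
qed

text \<open>The common pattern of jet bundles, Whitney sums and products: charts are indexed by the
  charts of \<open>M\<close> and have cylinders as images, so openness is inherited from
  \<open>M\<close> and only the transition functions require work.\<close>

lemma smooth_atlas_cylI:
  fixes M :: "'a mfd" and E :: "'b mfd" and C :: "('a \<Rightarrow> nat \<Rightarrow> real) \<Rightarrow> 'b \<Rightarrow> nat \<Rightarrow> real"
  assumes M: "smooth_atlas M" and dim: "mdim M \<le> mdim E"
    and at: "atlas E = {(D U, C \<phi>) | U \<phi>. (U, \<phi>) \<in> atlas M}"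
    and D_Int: "\<And>U V. D U \<inter> D V = D (U \<inter> V)"
    and inj: "\<And>U \<phi>. (U, \<phi>) \<in> atlas M \<Longrightarrow> inj_on (C \<phi>) (D U)"
    and image: "\<And>U \<phi> V. (U, \<phi>) \<in> atlas M \<Longrightarrow> V \<subseteq> U \<Longrightarrow> C \<phi> ` D V = cyl (mdim M) (mdim E) (\<phi> ` V)"
    and trans: "\<And>U \<phi> V \<psi> j. (U, \<phi>) \<in> atlas M \<Longrightarrow> (V, \<psi>) \<in> atlas M \<Longrightarrow> j < mdim E \<Longrightarrow>
      \<exists>g. smooth_fun_on (mdim E) (cyl (mdim M) (mdim E) (\<phi> ` (U \<inter> V))) g \<and> (\<forall>u\<in>D (U \<inter> V). C \<psi> u j = g (C \<phi> u))"
  shows "smooth_atlas E"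
proof -
  have op: "openin (Euclidean_space (mdim E)) (C \<phi> ` (D U \<inter> D V))"
    if "(U, \<phi>) \<in> atlas M" "(V, \<psi>) \<in> atlas M" for U \<phi> V \<psi>
    unfolding D_Int image[OF that(1) Int_lower1] by (rule openin_cyl[OF chart_overlap_open[OF M that] dim])
  have sm: "smooth_fun_on (mdim E) (C \<phi> ` (D U \<inter> D V)) (\<lambda>x. C \<psi> (inv_into (D U) (C \<phi>) x) j)"
    if U: "(U, \<phi>) \<in> atlas M" and V: "(V, \<psi>) \<in> atlas M" and j: "j < mdim E" for U \<phi> V \<psi> j
  proof -
    obtain g where g: "smooth_fun_on (mdim E) (cyl (mdim M) (mdim E) (\<phi> ` (U \<inter> V))) g"
      "\<forall>u\<in>D (U \<inter> V). C \<psi> u j = g (C \<phi> u)" using trans[OF U V j] by blast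
    show ?thesis
      unfolding D_Int
    proof (rule smooth_fun_on_cong)
      show "smooth_fun_on (mdim E) (C \<phi> ` D (U \<inter> V)) g" unfolding image[OF U Int_lower1] by (rule g(1))
      fix x assume "x \<in> C \<phi> ` D (U \<inter> V)"
      then obtain u where u: "u \<in> D (U \<inter> V)" "x = C \<phi> u" by blast
      then have "u \<in> D U" using D_Int by blast
      then show "g x = C \<psi> (inv_into (D U) (C \<phi>) x) j"
        using u g(2) inv_into_f_f[OF inj[OF U]] by simp
    qed
  qed
  show ?thesis
    unfolding smooth_atlas_def
  proof (intro conjI; clarify)
    fix U' \<phi>' assume "(U', \<phi>') \<in> atlas E"
    then obtain U \<phi> where U: "(U, \<phi>) \<in> atlas M" "U' = D U" "\<phi>' = C \<phi>" unfolding at by blast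
    show "inj_on \<phi>' U' \<and> openin (Euclidean_space (mdim E)) (\<phi>' ` U')"
      using inj[OF U(1)] op[OF U(1) U(1)] U(2,3) by simp
  next
    fix U' \<phi>' V' \<psi>' j assume "(U', \<phi>') \<in> atlas E" "(V', \<psi>') \<in> atlas E" "j < mdim E"
    then show "smooth_fun_on (mdim E) (\<phi>' ` (U' \<inter> V')) (\<lambda>x. \<psi>' (inv_into U' \<phi>' x) j)"
      unfolding at using sm by blast
  next
    fix U' \<phi>' V' \<psi>' assume "(U', \<phi>') \<in> atlas E" "(V', \<psi>') \<in> atlas E"
    then show "openin (Euclidean_space (mdim E)) (\<phi>' ` (U' \<inter> V'))"
      unfolding at using op by blast
  qed
qed

section \<open>Smooth curves in charts\<close>

lemma smooth_real_cong:
  assumes "smooth_real I f" "\<And>t. t \<in> I \<Longrightarrow> f t = g t" shows "smooth_real I g"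
proof -
  have I: "open I" using assms(1) by (rule smooth_real_open)
  show ?thesis
    using assms unfolding smooth_real_iff_smooth_fun_on[OF I] by (auto intro: smooth_fun_on_cong)
qed

lemma open_curve_preimage:
  assumes I: "open I" and c: "\<And>j. j < n \<Longrightarrow> smooth_real I (\<lambda>t. c t j)"
    and cE: "\<And>t. t \<in> I \<Longrightarrow> c t \<in> esp n" and W: "openin (Euclidean_space n) W"
  shows "open {t \<in> I. c t \<in> W}"
proof -
  have "continuous_on I (\<lambda>t. c t j)" for j
  proof (cases "j < n")
    case True
    show ?thesis
      by (rule continuous_at_imp_continuous_on) (metis True DERIV_isCont smooth_real_has_deriv[OF c])
  next
    case False
    have "continuous_on I (\<lambda>t. 0 :: real)" by simp
    then show ?thesis using cE False by (subst continuous_on_cong[OF refl, of _ _ "\<lambda>t. 0"]) (auto simp: mem_esp)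
  qed
  then have "continuous_on I c" by (rule continuous_on_coordinatewise_then_product)
  moreover obtain T where T: "open T" "W = T \<inter> esp n"
    using W unfolding openin_Euclidean_space_open by (elim exE conjE)
  ultimately have "open (c -` T \<inter> I)" using I continuous_on_open_vimage by blast
  moreover have "c -` T \<inter> I = {t \<in> I. c t \<in> W}" using T cE by auto
  ultimately show ?thesis by simp
qed

lemma curve_chartD:
  assumes "curve M q" "(U, \<phi>) \<in> atlas M" "q 0 \<in> U"
  obtains I where "open I" "0 \<in> I" "\<And>t. t \<in> I \<Longrightarrow> q t \<in> U" "\<And>i. i < mdim M \<Longrightarrow> smooth_real I (\<lambda>s. \<phi> (q s) i)"
proof -
  obtain e where "e > 0" and *: "smooth_curve_on M {-e<..<e} q" using assms(1) unfolding curve_def by blast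
  have "0 \<in> {-e<..<e}" using \<open>e > 0\<close> by simp
  from bspec[OF *[unfolded smooth_curve_on_def] this] assms(2,3)
  have "\<exists>\<delta>>0. \<forall>s. \<bar>s - 0\<bar> < \<delta> \<longrightarrow> q s \<in> U \<and>
           (\<forall>r. \<forall>i<mdim M. (deriv ^^ r) (\<lambda>s. \<phi> (q s) i) field_differentiable (at s))"
    by fast
  then obtain d where d: "d > 0" "\<forall>s. \<bar>s - 0\<bar> < d \<longrightarrow> q s \<in> U \<and>
           (\<forall>r. \<forall>i<mdim M. (deriv ^^ r) (\<lambda>s. \<phi> (q s) i) field_differentiable (at s))"
    by (elim exE conjE)
  show ?thesis
    using d by (intro that[of "{-d<..<d}"]) (auto simp: smooth_real_def)
qed

lemma curve_points: "curve M q \<Longrightarrow> q 0 \<in> points M"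
  unfolding curve_def smooth_curve_on_def by force

text \<open>\<open>smooth_curve_on\<close> refers to every chart at every time. Another chart is
  reached through a transition function, applied on the open set \<open>J\<close> of times at which
  the curve lies in both domains.\<close>

lemma curveI:
  assumes M: "smooth_atlas M" and U: "(U, \<phi>) \<in> atlas M" and I: "open I" "0 \<in> I"
    and qU: "\<And>t. t \<in> I \<Longrightarrow> q t \<in> U" and sm: "\<And>i. i < mdim M \<Longrightarrow> smooth_real I (\<lambda>s. \<phi> (q s) i)"
  shows "curve M q"
proof -
  obtain e where e: "e > 0" "\<And>t. \<bar>t\<bar> < e \<Longrightarrow> t \<in> I"
    using I unfolding open_dist by (auto simp: dist_real_def)
  have loc: "\<exists>\<delta>>0. \<forall>s. \<bar>s - t\<bar> < \<delta> \<longrightarrow> q s \<in> V \<and>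
           (\<forall>r. \<forall>i<mdim M. (deriv ^^ r) (\<lambda>s. \<psi> (q s) i) field_differentiable (at s))"
    if t: "t \<in> I" and V: "(V, \<psi>) \<in> atlas M" and qV: "q t \<in> V" for t V \<psi>
  proof -
    define J where "J = {s \<in> I. \<phi> (q s) \<in> \<phi> ` (U \<inter> V)}"
    have J: "open J"
      unfolding J_def using chart_esp[OF M U] qU
      by (intro open_curve_preimage[OF I(1) sm _ chart_overlap_open[OF M U V]]) auto
    have tJ: "t \<in> J" using t qU qV by (auto simp: J_def)
    have JV: "q s \<in> V" if "s \<in> J" for s
      using that qU chart_inj[OF M U] by (auto simp: J_def inj_on_def)
    have "smooth_real J (\<lambda>s. \<psi> (q s) i)" if i: "i < mdim M" for i
    proof (rule smooth_real_cong)
      show "smooth_real J (\<lambda>s. (\<lambda>x. \<psi> (inv_into U \<phi> x) i) (\<phi> (q s)))"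
      proof (rule smooth_real_compose[OF chart_transition[OF M U V i] J])
        show "smooth_real J (\<lambda>t. \<phi> (q t) j)" if "j < mdim M" for j
          by (rule smooth_real_subset[OF sm[OF that] J]) (auto simp: J_def)
      qed (simp add: J_def)
      show "\<psi> (inv_into U \<phi> (\<phi> (q s))) i = \<psi> (q s) i" if "s \<in> J" for s
        using that qU chart_inv[OF M U] by (simp add: J_def)
    qed
    moreover obtain d where "d > 0" "\<And>s. \<bar>s - t\<bar> < d \<Longrightarrow> s \<in> J"
      using J tJ unfolding open_dist by (auto simp: dist_real_def)
    ultimately show ?thesis
      using JV by (intro exI[of _ d]) (auto simp: smooth_real_def)
  qed
  have "smooth_curve_on M {-e<..<e} q"
    unfolding smooth_curve_on_def
  proof (intro ballI conjI, goal_cases)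
    case (1 t)
    then show ?case using e qU chart_points[OF U] by (simp add: abs_less_iff)
  next
    case (2 t A)
    then have "t \<in> I" using e by (simp add: abs_less_iff)
    then show ?case using 2(2) loc[of t] by (cases A) blast
  qed
  then show ?thesis using e unfolding curve_def by blast
qed

section \<open>Jet bundles\<close>

text \<open>\<open>jet_chart\<close> reads coordinates off the representative chosen by
  \<open>rep\<close>. Here the curve is arbitrary; \<open>jet_chart_jet\<close> then shows that the
  choice does not matter.\<close>

definition curve_coords :: "'a mfd \<Rightarrow> nat \<Rightarrow> ('a \<Rightarrow> nat \<Rightarrow> real) \<Rightarrow> (real \<Rightarrow> 'a) \<Rightarrow> nat \<Rightarrow> real" where
  "curve_coords M k \<phi> q j =
     (if j < Suc k * mdim M then taylor (j div mdim M) (\<lambda>t. \<phi> (q t) (j mod mdim M)) 0 else 0)"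

lemma jet_chart_rep: "jet_chart M k \<phi> u = curve_coords M k \<phi> (rep u)"
  by (simp add: fun_eq_iff jet_chart_def curve_coords_def taylor_def)

lemma curve_coords_index:
  "i < mdim M \<Longrightarrow> \<alpha> \<le> k \<Longrightarrow> curve_coords M k \<phi> q (\<alpha> * mdim M + i) = taylor \<alpha> (\<lambda>t. \<phi> (q t) i) 0"
  using index_less[of i "mdim M" \<alpha> k] by (simp add: curve_coords_def)

lemma curve_coords_esp: "curve_coords M k \<phi> q \<in> esp (Suc k * mdim M)"
  by (simp add: mem_esp curve_coords_def)

lemma index_cases:
  assumes "j < Suc k * (n::nat)"
  obtains \<alpha> i where "\<alpha> \<le> k" "i < n" "j = \<alpha> * n + i"
proof
  have "n > 0" using assms by (cases n) auto
  then show "j mod n < n" by simp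
  show "j div n \<le> k" using assms by (metis less_mult_imp_div_less less_Suc_eq_le)
  show "j = j div n * n + j mod n" by simp
qed

lemma curve_coords_eq_iff:
  "curve_coords M k \<phi> q = curve_coords M k \<psi> r \<longleftrightarrow>
     (\<forall>\<alpha>\<le>k. \<forall>i<mdim M. taylor \<alpha> (\<lambda>t. \<phi> (q t) i) 0 = taylor \<alpha> (\<lambda>t. \<psi> (r t) i) 0)" (is "?l \<longleftrightarrow> ?r")
proof
  assume ?l then show ?r by (metis curve_coords_index)
next
  assume r: ?r
  show ?l
  proof
    fix j
    show "curve_coords M k \<phi> q j = curve_coords M k \<psi> r j"
    proof (cases "j < Suc k * mdim M")
      case True
      then obtain \<alpha> i where "\<alpha> \<le> k" "i < mdim M" "j = \<alpha> * mdim M + i" by (rule index_cases)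
      then show ?thesis using r by (simp add: curve_coords_index)
    qed (simp add: curve_coords_def)
  qed
qed

lemma trunc_curve_coords:
  assumes "\<alpha> \<le> k"
  shows "trunc (Suc \<alpha> * mdim M) (curve_coords M k \<phi> q) = curve_coords M \<alpha> \<phi> q"
proof
  fix j
  have "Suc \<alpha> * mdim M \<le> Suc k * mdim M" using assms by (intro mult_le_mono1) simp
  then have "j < Suc \<alpha> * mdim M \<Longrightarrow> j < Suc k * mdim M" by (rule order_less_le_trans[rotated])
  then show "trunc (Suc \<alpha> * mdim M) (curve_coords M k \<phi> q) j = curve_coords M \<alpha> \<phi> q j"
    by (auto simp only: trunc_def curve_coords_def if_True if_False split: if_split)
qed

lemma curve_coords_0:
  assumes "smooth_atlas M" "(U, \<phi>) \<in> atlas M" "q 0 \<in> U"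
  shows "curve_coords M 0 \<phi> q = \<phi> (q 0)"
  using chart_esp[OF assms] by (auto simp: fun_eq_iff curve_coords_def mem_esp)

lemma trunc_curve_coords_0:
  assumes "smooth_atlas M" "(U, \<phi>) \<in> atlas M" "q 0 \<in> U"
  shows "trunc (mdim M) (curve_coords M k \<phi> q) = \<phi> (q 0)"
  using trunc_curve_coords[of 0 k M \<phi> q] curve_coords_0[where q=q] assms by (simp add: mult_Suc)

text \<open>Near 0 the curve in the second chart is the transition function composed with the curve
  in the first one, so its Taylor coefficients depend only on those of the first.\<close>

lemma curve_coords_transition:
  assumes M: "smooth_atlas M" and U: "(U, \<phi>) \<in> atlas M" and V: "(V, \<psi>) \<in> atlas M"
    and q: "curve M q" "q 0 \<in> U" "q 0 \<in> V" and j: "j < mdim M" and b: "b \<le> k"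
  shows "taylor b (\<lambda>t. \<psi> (q t) j) 0 =
     jet_taylor (mdim M) b (\<lambda>x. \<psi> (inv_into U \<phi> x) j) (curve_coords M k \<phi> q)"
proof -
  obtain I where I: "open I" "0 \<in> I" "\<And>t. t \<in> I \<Longrightarrow> q t \<in> U" "\<And>i. i < mdim M \<Longrightarrow> smooth_real I (\<lambda>s. \<phi> (q s) i)"
    by (rule curve_chartD[OF q(1) U q(2)]) (rule that)
  obtain J where J: "open J" "0 \<in> J" "\<And>t. t \<in> J \<Longrightarrow> q t \<in> V"
    by (rule curve_chartD[OF q(1) V q(3)]) (rule that)
  let ?f = "\<lambda>x. \<psi> (inv_into U \<phi> x) j"
  have IJ: "open (I \<inter> J)" "0 \<in> I \<inter> J" using I J by auto
  have "taylor b (\<lambda>t. \<psi> (q t) j) 0 = taylor b (\<lambda>t. ?f (\<phi> (q t))) 0"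
    by (rule taylor_cong[OF IJ]) (use I chart_inv[OF M U] in auto)
  also have "\<dots> = jet_taylor (mdim M) b ?f (curve_coords M k \<phi> q)"
  proof (rule taylor_compose_curve[OF chart_transition[OF M U V j] _ IJ(1) _ IJ(2)])
    show "smooth_real (I \<inter> J) (\<lambda>t. \<phi> (q t) i)" if "i < mdim M" for i
      by (rule smooth_real_subset[OF I(4)[OF that] IJ(1)]) simp
    show "\<phi> (q t) \<in> \<phi> ` (U \<inter> V)" if "t \<in> I \<inter> J" for t using that I(3) J(3) by blast
  qed (use b in \<open>simp add: curve_coords_index\<close>)
  finally show ?thesis .
qed

text \<open>\<open>jet_equiv\<close> asks for agreement in some chart; the transition formula
  carries it to any chart at the base point.\<close>

lemma jet_equiv_iff:
  assumes M: "smooth_atlas M" and U: "(U, \<phi>) \<in> atlas M" and q: "curve M q" and r: "curve M r" and qU: "q 0 \<in> U"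
  shows "jet_equiv M k q r \<longleftrightarrow> q 0 = r 0 \<and> curve_coords M k \<phi> q = curve_coords M k \<phi> r"
proof
  assume "jet_equiv M k q r"
  then obtain V \<psi> where V: "(V, \<psi>) \<in> atlas M" "q 0 \<in> V" and eq: "q 0 = r 0"
    "\<forall>\<alpha>\<le>k. \<forall>i<mdim M. (deriv ^^ \<alpha>) (\<lambda>t. \<psi> (q t) i) 0 = (deriv ^^ \<alpha>) (\<lambda>t. \<psi> (r t) i) 0"
    unfolding jet_equiv_def by blast
  then have *: "curve_coords M k \<psi> q = curve_coords M k \<psi> r"
    unfolding curve_coords_eq_iff by (simp add: taylor_def)
  have "curve_coords M k \<phi> q = curve_coords M k \<phi> r"
    unfolding curve_coords_eq_iff
    using curve_coords_transition[OF M V(1) U q V(2) qU] curve_coords_transition[OF M V(1) U r] V(2) qU eq(1) *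
    by simp
  then show "q 0 = r 0 \<and> curve_coords M k \<phi> q = curve_coords M k \<phi> r" using eq(1) by simp
next
  assume *: "q 0 = r 0 \<and> curve_coords M k \<phi> q = curve_coords M k \<phi> r"
  then have "\<forall>\<alpha>\<le>k. \<forall>i<mdim M. (deriv ^^ \<alpha>) (\<lambda>t. \<phi> (q t) i) 0 = (deriv ^^ \<alpha>) (\<lambda>t. \<phi> (r t) i) 0"
    unfolding curve_coords_eq_iff by (simp add: taylor_def)
  then show "jet_equiv M k q r" unfolding jet_equiv_def using * U qU by blast
qed

lemma jet_eq_iff:
  assumes M: "smooth_atlas M" and U: "(U, \<phi>) \<in> atlas M" and q: "curve M q" and r: "curve M r" and qU: "q 0 \<in> U"
  shows "jet M k q = jet M k r \<longleftrightarrow> q 0 = r 0 \<and> curve_coords M k \<phi> q = curve_coords M k \<phi> r"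
proof
  assume eq: "jet M k q = jet M k r"
  have "q \<in> jet M k q" using q jet_equiv_iff[OF M U q q qU] by (simp add: jet_def)
  then have "q \<in> jet M k r" unfolding eq .
  then have e: "jet_equiv M k r q" by (simp add: jet_def)
  then have "r 0 = q 0" by (simp add: jet_equiv_def)
  then show "q 0 = r 0 \<and> curve_coords M k \<phi> q = curve_coords M k \<phi> r"
    using jet_equiv_iff[OF M U r q] qU e by simp
next
  assume "q 0 = r 0 \<and> curve_coords M k \<phi> q = curve_coords M k \<phi> r"
  then have "jet_equiv M k q s \<longleftrightarrow> jet_equiv M k r s" if "curve M s" for s
    using jet_equiv_iff[OF M U q that] jet_equiv_iff[OF M U r that] qU by simp
  then show "jet M k q = jet M k r" by (auto simp: jet_def)
qed

lemma mdim_jet_bundle [simp]: "mdim (jet_bundle M k) = Suc k * mdim M"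
  by (simp add: jet_bundle_def)

definition jet_dom :: "'a mfd \<Rightarrow> nat \<Rightarrow> 'a set \<Rightarrow> 'a jet set" where
  "jet_dom M k U = {jet M k q | q. curve M q \<and> q 0 \<in> U}"

lemma atlas_jet_bundle: "atlas (jet_bundle M k) = {(jet_dom M k U, jet_chart M k \<phi>) | U \<phi>. (U, \<phi>) \<in> atlas M}"
  by (simp add: jet_bundle_def jet_dom_def)

lemma jet_bundle_chart: "(U, \<phi>) \<in> atlas M \<Longrightarrow> (jet_dom M k U, jet_chart M k \<phi>) \<in> atlas (jet_bundle M k)"
  unfolding atlas_jet_bundle by blast

lemma points_jet_bundle: "points (jet_bundle M k) = {jet M k q | q. curve M q}"
proof -
  have "points (jet_bundle M k) = (\<Union>(U, \<phi>)\<in>atlas M. jet_dom M k U)"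
    unfolding points_def atlas_jet_bundle by blast
  also have "\<dots> = {jet M k q | q. curve M q \<and> q 0 \<in> points M}"
    unfolding points_def jet_dom_def by blast
  finally show ?thesis using curve_points by blast
qed

text \<open>A curve belongs to its own jet, so the choice made by \<open>rep\<close> stays within
  the class.\<close>

lemma jet_rep:
  assumes M: "smooth_atlas M" and q: "curve M q"
  shows "curve M (rep (jet M k q))" "jet M k (rep (jet M k q)) = jet M k q" "rep (jet M k q) 0 = q 0"
proof -
  obtain U \<phi> where U: "(U, \<phi>) \<in> atlas M" "q 0 \<in> U" using curve_points[OF q] points_chart by metis
  have "q \<in> jet M k q" using q jet_equiv_iff[OF M U(1) q q U(2)] by (simp add: jet_def)
  then have "rep (jet M k q) \<in> jet M k q" unfolding rep_def by (rule someI[where P="\<lambda>r. r \<in> jet M k q"])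
  then have r: "curve M (rep (jet M k q))" "jet_equiv M k q (rep (jet M k q))" by (simp_all add: jet_def)
  then show "curve M (rep (jet M k q))" by simp
  show "rep (jet M k q) 0 = q 0" using r(2) by (simp add: jet_equiv_def)
  show "jet M k (rep (jet M k q)) = jet M k q"
    using jet_eq_iff[OF M U(1) q r(1) U(2)] jet_equiv_iff[OF M U(1) q r(1) U(2)] r(2) by metis
qed

lemma jet_bundle_rep:
  assumes M: "smooth_atlas M" and u: "u \<in> points (jet_bundle M k)"
  shows "curve M (rep u)" "jet M k (rep u) = u" "rep u 0 = jet_base u"
  using u jet_rep[OF M] by (auto simp: points_jet_bundle jet_base_def)

lemma jet_base_jet: "smooth_atlas M \<Longrightarrow> curve M q \<Longrightarrow> jet_base (jet M k q) = q 0"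
  by (simp add: jet_base_def jet_rep)

lemma jet_chart_jet:
  assumes M: "smooth_atlas M" and q: "curve M q" and U: "(U, \<phi>) \<in> atlas M" "q 0 \<in> U"
  shows "jet_chart M k \<phi> (jet M k q) = curve_coords M k \<phi> q"
  using jet_eq_iff[OF M U(1) q jet_rep(1)[OF M q, of k] U(2), of k] jet_rep[OF M q, of k]
  by (simp add: jet_chart_rep)

lemma jet_points: "curve M q \<Longrightarrow> jet M k q \<in> points (jet_bundle M k)"
  unfolding points_jet_bundle by blast

lemma jet_base_points: "smooth_atlas M \<Longrightarrow> u \<in> points (jet_bundle M k) \<Longrightarrow> jet_base u \<in> points M"
  using jet_bundle_rep curve_points by metis

lemma mem_jet_dom:
  assumes "smooth_atlas M"
  shows "u \<in> jet_dom M k U \<longleftrightarrow> u \<in> points (jet_bundle M k) \<and> jet_base u \<in> U"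
proof
  assume "u \<in> jet_dom M k U"
  then obtain q where "u = jet M k q" "curve M q" "q 0 \<in> U" unfolding jet_dom_def by blast
  then show "u \<in> points (jet_bundle M k) \<and> jet_base u \<in> U"
    using jet_base_jet[OF assms] jet_points by metis
next
  assume *: "u \<in> points (jet_bundle M k) \<and> jet_base u \<in> U"
  then show "u \<in> jet_dom M k U"
    using jet_bundle_rep[OF assms, of u k] unfolding jet_dom_def by (intro CollectI exI[of _ "rep u"]) simp
qed

text \<open>The block of order 0 determines the base point, as the chart of \<open>M\<close> is
  injective; then agreement of the Taylor coefficients in this one chart is equality of
  jets.\<close>

lemma jet_chart_eq_iff:
  assumes M: "smooth_atlas M" and U: "(U, \<phi>) \<in> atlas M" and u: "u \<in> jet_dom M k U" and w: "w \<in> jet_dom M k U"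
  shows "jet_chart M k \<phi> u = jet_chart M k \<phi> w \<longleftrightarrow> u = w"
proof
  assume eq: "jet_chart M k \<phi> u = jet_chart M k \<phi> w"
  have u': "u \<in> points (jet_bundle M k)" "jet_base u \<in> U" and w': "w \<in> points (jet_bundle M k)" "jet_base w \<in> U"
    using u w by (simp_all add: mem_jet_dom[OF M])
  note ru = jet_bundle_rep[OF M u'(1)] and rw = jet_bundle_rep[OF M w'(1)]
  have cc: "curve_coords M k \<phi> (rep u) = curve_coords M k \<phi> (rep w)" using eq by (simp add: jet_chart_rep)
  then have "\<phi> (jet_base u) = \<phi> (jet_base w)"
    using trunc_curve_coords_0[OF M U, of "rep u" k] trunc_curve_coords_0[OF M U, of "rep w" k] ru(3) rw(3) u'(2) w'(2) by simp
  then have "jet_base u = jet_base w" using chart_inj[OF M U] u'(2) w'(2) by (auto simp: inj_on_def)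
  then have "jet M k (rep u) = jet M k (rep w)"
    using jet_eq_iff[OF M U ru(1) rw(1)] cc ru(3) rw(3) u'(2) by simp
  then show "u = w" using ru(2) rw(2) by simp
qed simp

lemma jet_chart_esp: "jet_chart M k \<phi> u \<in> esp (Suc k * mdim M)"
  by (simp only: jet_chart_rep curve_coords_esp)

lemma trunc_jet_chart:
  assumes M: "smooth_atlas M" and U: "(U, \<phi>) \<in> atlas M" and u: "u \<in> jet_dom M k U"
  shows "trunc (mdim M) (jet_chart M k \<phi> u) = \<phi> (jet_base u)"
proof -
  have u': "u \<in> points (jet_bundle M k)" "jet_base u \<in> U" using u by (simp_all add: mem_jet_dom[OF M])
  show ?thesis
    using trunc_curve_coords_0[OF M U] jet_bundle_rep[OF M u'(1)] u'(2) by (simp add: jet_chart_rep)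
qed

text \<open>The curve is, in the chart, the polynomial whose coefficients are the prescribed
  coordinates.\<close>

lemma curve_with_coords:
  assumes M: "smooth_atlas M" and U: "(U, \<phi>) \<in> atlas M" and x: "x \<in> cyl (mdim M) (Suc k * mdim M) (\<phi> ` U)"
  obtains q where "curve M q" "q 0 \<in> U" "curve_coords M k \<phi> q = x"
proof -
  let ?n = "mdim M"
  define c where "c t = (\<lambda>i. if i < ?n then (\<Sum>\<alpha><Suc k. x (\<alpha> * ?n + i) * t ^ \<alpha>) else 0)" for t
  \<comment> \<open>The polynomial need stay in the chart image only near 0, which is all that
    \<open>curve\<close> asks for.\<close>
  define I where "I = {t \<in> UNIV. c t \<in> \<phi> ` U}"
  have csm: "smooth_real UNIV (\<lambda>t. c t j)" if "j < ?n" for j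
  proof -
    have "smooth_real UNIV (\<lambda>t. \<Sum>\<alpha><Suc k. x (\<alpha> * ?n + j) * t ^ \<alpha>)"
      by (intro smooth_real_sum smooth_real_mult smooth_real_const smooth_real_power open_UNIV)
    then show ?thesis using that by (simp add: c_def)
  qed
  have I: "open I"
    unfolding I_def using csm chart_open[OF M U] by (intro open_curve_preimage) (auto simp: mem_esp c_def)
  have c0: "c 0 = trunc ?n x"
    by (auto simp: c_def trunc_def fun_eq_iff sum.lessThan_Suc_shift simp del: sum.lessThan_Suc)
  then have I0: "0 \<in> I" using x by (simp add: I_def cyl_def)
  define q where "q t = inv_into U \<phi> (c t)" for t
  have qU: "q t \<in> U" if "t \<in> I" for t
    using that unfolding q_def I_def by (simp add: inv_into_into)
  have \<phi>q: "\<phi> (q t) = c t" if "t \<in> I" for t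
    using that unfolding q_def I_def by (simp add: f_inv_into_f)
  have q: "curve M q"
  proof (rule curveI[OF M U I I0 qU])
    show "smooth_real I (\<lambda>s. \<phi> (q s) i)" if "i < ?n" for i
      by (rule smooth_real_cong[OF smooth_real_subset[OF csm[OF that] I]]) (simp_all add: \<phi>q)
  qed
  have "curve_coords M k \<phi> q j = x j" for j
  proof (cases "j < Suc k * ?n")
    case True
    then obtain \<alpha> i where j: "\<alpha> \<le> k" "i < ?n" "j = \<alpha> * ?n + i" by (rule index_cases)
    have "taylor \<alpha> (\<lambda>t. \<phi> (q t) i) 0 = taylor \<alpha> (\<lambda>t. \<Sum>\<beta><Suc k. x (\<beta> * ?n + i) * t ^ \<beta>) 0"
      by (rule taylor_cong[OF I I0]) (use j in \<open>simp add: \<phi>q c_def\<close>)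
    then show ?thesis
      using j taylor_polynomial[of \<alpha> "\<lambda>\<beta>. x (\<beta> * ?n + i)" "Suc k"] by (simp add: curve_coords_index del: sum.lessThan_Suc)
  next
    case False
    then show ?thesis using x by (simp add: curve_coords_def cyl_def mem_esp)
  qed
  then show ?thesis using q qU[OF I0] by (intro that[of q]) auto
qed

lemma jet_with_coords:
  assumes M: "smooth_atlas M" and U: "(U, \<phi>) \<in> atlas M" and x: "x \<in> cyl (mdim M) (Suc k * mdim M) (\<phi> ` U)"
  obtains u where "u \<in> jet_dom M k U" "jet_chart M k \<phi> u = x"
proof -
  obtain q where q: "curve M q" "q 0 \<in> U" "curve_coords M k \<phi> q = x"
    using curve_with_coords[OF assms] by blast
  then show ?thesis using jet_chart_jet[OF M q(1) U q(2)] by (intro that[of "jet M k q"]) (auto simp: jet_dom_def)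
qed

lemma jet_chart_image:
  assumes M: "smooth_atlas M" and U: "(U, \<phi>) \<in> atlas M" and VU: "V \<subseteq> U"
  shows "jet_chart M k \<phi> ` jet_dom M k V = cyl (mdim M) (Suc k * mdim M) (\<phi> ` V)"
proof
  show "jet_chart M k \<phi> ` jet_dom M k V \<subseteq> cyl (mdim M) (Suc k * mdim M) (\<phi> ` V)"
  proof
    fix x assume "x \<in> jet_chart M k \<phi> ` jet_dom M k V"
    then obtain u where u: "u \<in> jet_dom M k V" "x = jet_chart M k \<phi> u" by blast
    then have "u \<in> jet_dom M k U" "jet_base u \<in> V" using VU by (auto simp: mem_jet_dom[OF M])
    then show "x \<in> cyl (mdim M) (Suc k * mdim M) (\<phi> ` V)"
      using trunc_jet_chart[OF M U] u(2) jet_chart_esp by (simp add: cyl_def)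
  qed
  show "cyl (mdim M) (Suc k * mdim M) (\<phi> ` V) \<subseteq> jet_chart M k \<phi> ` jet_dom M k V"
  proof
    fix x assume x: "x \<in> cyl (mdim M) (Suc k * mdim M) (\<phi> ` V)"
    then have "x \<in> cyl (mdim M) (Suc k * mdim M) (\<phi> ` U)" using VU by (auto simp: cyl_def)
    then obtain u where u: "u \<in> jet_dom M k U" "jet_chart M k \<phi> u = x" by (rule jet_with_coords[OF M U])
    have "\<phi> (jet_base u) \<in> \<phi> ` V" using x trunc_jet_chart[OF M U u(1)] u(2) by (simp add: cyl_def)
    then have "jet_base u \<in> V" using u(1) VU chart_inj[OF M U] by (auto simp: mem_jet_dom[OF M] inj_on_def)
    then have "u \<in> jet_dom M k V" using u(1) by (simp add: mem_jet_dom[OF M])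
    then show "x \<in> jet_chart M k \<phi> ` jet_dom M k V" using u(2) by blast
  qed
qed

lemma jet_dom_Int: "smooth_atlas M \<Longrightarrow> jet_dom M k U \<inter> jet_dom M k V = jet_dom M k (U \<inter> V)"
  by (auto simp: mem_jet_dom)

lemma jet_chart_inj: "smooth_atlas M \<Longrightarrow> (U, \<phi>) \<in> atlas M \<Longrightarrow> inj_on (jet_chart M k \<phi>) (jet_dom M k U)"
  by (meson inj_onI jet_chart_eq_iff)

lemma jet_transition:
  assumes M: "smooth_atlas M" and U: "(U, \<phi>) \<in> atlas M" and V: "(V, \<psi>) \<in> atlas M"
    and u: "u \<in> jet_dom M k (U \<inter> V)" and b: "b \<le> k" and i: "i < mdim M"
  shows "jet_chart M k \<psi> u (b * mdim M + i) =
     jet_taylor (mdim M) b (\<lambda>x. \<psi> (inv_into U \<phi> x) i) (jet_chart M k \<phi> u)"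
proof -
  have u': "u \<in> points (jet_bundle M k)" "jet_base u \<in> U" "jet_base u \<in> V" using u by (simp_all add: mem_jet_dom[OF M])
  show ?thesis
    using curve_coords_transition[OF M U V jet_bundle_rep(1)[OF M u'(1)] _ _ i b] u' jet_bundle_rep(3)[OF M u'(1)] i b
    by (simp add: jet_chart_rep curve_coords_index)
qed

lemma smooth_atlas_jet_bundle:
  assumes M: "smooth_atlas M" shows "smooth_atlas (jet_bundle M k)"
proof (rule smooth_atlas_cylI[OF M _ atlas_jet_bundle jet_dom_Int[OF M] jet_chart_inj[OF M]], unfold mdim_jet_bundle)
  let ?n = "mdim M" and ?N = "Suc k * mdim M"
  show "?n \<le> ?N" by (simp add: mult_Suc)
  show "jet_chart M k \<phi> ` jet_dom M k V = cyl ?n ?N (\<phi> ` V)" if "(U, \<phi>) \<in> atlas M" "V \<subseteq> U" for U \<phi> V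
    by (rule jet_chart_image[OF M that])
  fix U \<phi> V \<psi> j assume U: "(U, \<phi>) \<in> atlas M" and V: "(V, \<psi>) \<in> atlas M" and j: "j < ?N"
  obtain b i where bi: "b \<le> k" "i < ?n" "j = b * ?n + i" using j by (rule index_cases)
  have "Suc b * ?n \<le> ?N" using bi by (intro mult_le_mono1) simp
  from smooth_jet_taylor[OF chart_transition[OF M U V bi(2)] this]
  show "\<exists>g. smooth_fun_on ?N (cyl ?n ?N (\<phi> ` (U \<inter> V))) g \<and>
      (\<forall>u\<in>jet_dom M k (U \<inter> V). jet_chart M k \<psi> u j = g (jet_chart M k \<phi> u))"
    using jet_transition[OF M U V _ bi(1,2)] unfolding bi(3) by blast
qed

section \<open>Topology of jet bundles\<close>

lemma openin_mfd_topology_iff: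
  assumes "smooth_atlas M" shows "openin (mfd_topology M) W \<longleftrightarrow> mfd_open M W"
proof -
  have "istopology (mfd_open M)"
    using chart_inj[OF assms] by (intro istopology_mfd_open) auto
  then show ?thesis by (simp add: mfd_topology_def)
qed

lemma topspace_mfd_topology:
  assumes M: "smooth_atlas M" shows "topspace (mfd_topology M) = points M"
proof
  show "topspace (mfd_topology M) \<subseteq> points M"
    using openin_topspace[of "mfd_topology M"] unfolding openin_mfd_topology_iff[OF M] mfd_open_def by blast
  have "mfd_open M (points M)"
    unfolding mfd_open_def
  proof (intro conjI order_refl; clarify)
    fix U \<phi> assume U: "(U, \<phi>) \<in> atlas M"
    then have "U \<inter> points M = U" using chart_points[OF U] by auto
    then show "openin (Euclidean_space (mdim M)) (\<phi> ` (U \<inter> points M))" using chart_open[OF M U] by simp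
  qed
  then show "points M \<subseteq> topspace (mfd_topology M)"
    unfolding openin_mfd_topology_iff[OF M, symmetric] by (rule openin_subset)
qed

lemma openin_chart_preimage:
  assumes M: "smooth_atlas M" and U: "(U, \<phi>) \<in> atlas M" and B: "openin (Euclidean_space (mdim M)) B"
  shows "openin (mfd_topology M) {x \<in> U. \<phi> x \<in> B}"
  unfolding openin_mfd_topology_iff[OF M] mfd_open_def
proof (intro conjI; clarify)
  fix x assume "x \<in> U" then show "x \<in> points M" using chart_points U by metis
next
  fix V \<psi> assume V: "(V, \<psi>) \<in> atlas M"
  have "\<psi> ` (V \<inter> {x \<in> U. \<phi> x \<in> B}) = {y \<in> \<psi> ` (V \<inter> U). \<phi> (inv_into V \<psi> y) \<in> B}"
    using chart_inv[OF M V] by auto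
  moreover have "openin (Euclidean_space (mdim M)) {y \<in> \<psi> ` (V \<inter> U). \<phi> (inv_into V \<psi> y) \<in> B}"
  proof (rule openin_smooth_preimage[OF chart_overlap_open[OF M V U] B chart_transition[OF M V U]])
    show "(\<lambda>y. \<phi> (inv_into V \<psi> y)) \<in> \<psi> ` (V \<inter> U) \<rightarrow> esp (mdim M)"
      using chart_inv[OF M V] chart_esp[OF M U] by auto
  qed
  ultimately show "openin (Euclidean_space (mdim M)) (\<psi> ` (V \<inter> {x \<in> U. \<phi> x \<in> B}))" by simp
qed

lemma openin_chart_dom:
  assumes M: "smooth_atlas M" and U: "(U, \<phi>) \<in> atlas M" shows "openin (mfd_topology M) U"
proof -
  have "{x \<in> U. \<phi> x \<in> esp (mdim M)} = U" using chart_esp[OF M U] by auto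
  then show ?thesis using openin_chart_preimage[OF M U openin_topspace] by simp
qed

lemma openin_jet_base_preimage:
  assumes M: "smooth_atlas M" and A: "openin (mfd_topology M) A"
  shows "openin (mfd_topology (jet_bundle M k)) {u \<in> points (jet_bundle M k). jet_base u \<in> A}"
  unfolding openin_mfd_topology_iff[OF smooth_atlas_jet_bundle[OF M]] mfd_open_def mdim_jet_bundle
proof (intro conjI; clarify)
  fix U' \<phi>' assume "(U', \<phi>') \<in> atlas (jet_bundle M k)"
  then obtain U \<phi> where U: "(U, \<phi>) \<in> atlas M" "U' = jet_dom M k U" "\<phi>' = jet_chart M k \<phi>"
    unfolding atlas_jet_bundle by blast
  have "U' \<inter> {u \<in> points (jet_bundle M k). jet_base u \<in> A} = jet_dom M k (U \<inter> A)"
    unfolding U(2) by (auto simp: mem_jet_dom[OF M])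
  then have "\<phi>' ` (U' \<inter> {u \<in> points (jet_bundle M k). jet_base u \<in> A}) = cyl (mdim M) (Suc k * mdim M) (\<phi> ` (U \<inter> A))"
    using jet_chart_image[OF M U(1), of "U \<inter> A" k] U(3) by simp
  moreover have "openin (Euclidean_space (mdim M)) (\<phi> ` (U \<inter> A))"
    using A U(1) unfolding openin_mfd_topology_iff[OF M] mfd_open_def by blast
  ultimately show "openin (Euclidean_space (Suc k * mdim M)) (\<phi>' ` (U' \<inter> {u \<in> points (jet_bundle M k). jet_base u \<in> A}))"
    using openin_cyl[of "mdim M" "\<phi> ` (U \<inter> A)" "Suc k * mdim M"] by simp
qed

text \<open>Jets with different base points are separated by preimages of open sets of
  \<open>M\<close>. Jets with the same base point lie in one chart domain, where the model space
  separates them.\<close>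

lemma Hausdorff_jet_bundle:
  assumes M: "smooth_atlas M" and H: "Hausdorff_space (mfd_topology M)"
  shows "Hausdorff_space (mfd_topology (jet_bundle M k))"
  unfolding Hausdorff_space_def topspace_mfd_topology[OF smooth_atlas_jet_bundle[OF M]]
proof (intro allI impI)
  let ?E = "jet_bundle M k"
  have E: "smooth_atlas ?E" by (rule smooth_atlas_jet_bundle[OF M])
  fix u w assume *: "u \<in> points ?E \<and> w \<in> points ?E \<and> u \<noteq> w"
  have bu: "jet_base u \<in> points M" and bw: "jet_base w \<in> points M" using * jet_base_points[OF M] by blast+
  show "\<exists>A B. openin (mfd_topology ?E) A \<and> openin (mfd_topology ?E) B \<and> u \<in> A \<and> w \<in> B \<and> disjnt A B"
  proof (cases "jet_base u = jet_base w")
    case False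
    then obtain A B where AB: "openin (mfd_topology M) A" "openin (mfd_topology M) B"
        "jet_base u \<in> A" "jet_base w \<in> B" "disjnt A B"
      using H bu bw unfolding Hausdorff_space_def topspace_mfd_topology[OF M] by metis
    show ?thesis
    proof (intro exI conjI)
      show "openin (mfd_topology ?E) {u \<in> points ?E. jet_base u \<in> A}" "openin (mfd_topology ?E) {u \<in> points ?E. jet_base u \<in> B}"
        using AB openin_jet_base_preimage[OF M] by blast+
    qed (use AB * in \<open>auto simp: disjnt_def\<close>)
  next
    case True
    obtain U \<phi> where U: "(U, \<phi>) \<in> atlas M" "jet_base u \<in> U" using points_chart[OF bu] .
    have d: "u \<in> jet_dom M k U" "w \<in> jet_dom M k U" using U(2) True * by (simp_all add: mem_jet_dom[OF M])
    then have ne: "jet_chart M k \<phi> u \<noteq> jet_chart M k \<phi> w" using jet_chart_eq_iff[OF M U(1)] * by blast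
    obtain A B where AB: "openin (Euclidean_space (Suc k * mdim M)) A" "openin (Euclidean_space (Suc k * mdim M)) B"
       "jet_chart M k \<phi> u \<in> A" "jet_chart M k \<phi> w \<in> B" "disjnt A B"
      using Hausdorff_Euclidean_space ne jet_chart_esp unfolding Hausdorff_space_def by metis
    note ch = openin_chart_preimage[OF E jet_bundle_chart[OF U(1)], unfolded mdim_jet_bundle]
    show ?thesis
    proof (intro exI conjI)
      show "openin (mfd_topology ?E) {v \<in> jet_dom M k U. jet_chart M k \<phi> v \<in> A}"
        "openin (mfd_topology ?E) {v \<in> jet_dom M k U. jet_chart M k \<phi> v \<in> B}"
        using AB ch by blast+
    qed (use AB d in \<open>auto simp: disjnt_def\<close>)
  qed
qed

text \<open>A countable basis of the sequence space, pulled back through countably many covering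
  charts, is a basis of the manifold topology.\<close>

lemma second_countable_atlas:
  fixes E :: "'a mfd"
  assumes E: "smooth_atlas E" and C: "countable C" "C \<subseteq> atlas E" and cov: "\<And>x. x \<in> points E \<Longrightarrow> \<exists>(U, \<phi>)\<in>C. x \<in> U"
  shows "second_countable (mfd_topology E)"
proof -
  obtain \<B> :: "(nat \<Rightarrow> real) set set" where B: "countable \<B>" "\<And>b. b \<in> \<B> \<Longrightarrow> open b"
    "\<And>S. open S \<Longrightarrow> \<exists>\<C>\<subseteq>\<B>. S = \<Union>\<C>"
    using univ_second_countable by metis
  define S :: "'a chart \<times> (nat \<Rightarrow> real) set \<Rightarrow> 'a set" where "S = (\<lambda>((U, \<phi>), b). {x \<in> U. \<phi> x \<in> b \<inter> esp (mdim E)})"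
  show ?thesis
    unfolding second_countable_def
  proof (intro exI conjI ballI allI impI)
    show "countable (S ` (C \<times> \<B>))" using B(1) C(1) by simp
  next
    fix V assume "V \<in> S ` (C \<times> \<B>)"
    then obtain U \<phi> b where V: "(U, \<phi>) \<in> C" "b \<in> \<B>" "V = {x \<in> U. \<phi> x \<in> b \<inter> esp (mdim E)}"
      unfolding S_def by force
    have "openin (Euclidean_space (mdim E)) (b \<inter> esp (mdim E))"
      using B(2)[OF V(2)] unfolding openin_Euclidean_space_open by blast
    then show "openin (mfd_topology E) V"
      using openin_chart_preimage[OF E, of U \<phi>] C(2) V by blast
  next
    fix W x assume Wx: "openin (mfd_topology E) W \<and> x \<in> W"
    then have W: "mfd_open E W" and xW: "x \<in> W" using openin_mfd_topology_iff[OF E] by blast+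
    then have "x \<in> points E" unfolding mfd_open_def by blast
    then obtain U \<phi> where U: "(U, \<phi>) \<in> C" "x \<in> U" using cov by blast
    then have UE: "(U, \<phi>) \<in> atlas E" using C(2) by blast
    then have "openin (Euclidean_space (mdim E)) (\<phi> ` (U \<inter> W))" using W unfolding mfd_open_def by blast
    then obtain T where T: "open T" "\<phi> ` (U \<inter> W) = T \<inter> esp (mdim E)"
      unfolding openin_Euclidean_space_open by blast
    have "\<phi> x \<in> T" using T(2) U(2) xW by blast
    then obtain b where b: "b \<in> \<B>" "\<phi> x \<in> b" "b \<subseteq> T" using B(3)[OF T(1)] by blast
    show "\<exists>V\<in>S ` (C \<times> \<B>). x \<in> V \<and> V \<subseteq> W"
    proof (intro bexI conjI)
      show "S ((U, \<phi>), b) \<in> S ` (C \<times> \<B>)" using U b by blast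
      show "x \<in> S ((U, \<phi>), b)" using U b chart_esp[OF E UE] by (simp add: S_def)
      show "S ((U, \<phi>), b) \<subseteq> W"
      proof
        fix y assume "y \<in> S ((U, \<phi>), b)"
        then have y: "y \<in> U" "\<phi> y \<in> \<phi> ` (U \<inter> W)" unfolding T(2) using b by (auto simp: S_def)
        then show "y \<in> W" using chart_inj[OF E UE] by (auto simp: inj_on_def)
      qed
    qed
  qed
qed

text \<open>A second countable space is Lindelof, so countably many chart domains cover
  \<open>M\<close>; the jet charts above them cover the bundle.\<close>

lemma second_countable_jet_bundle:
  assumes M: "smooth_atlas M" and S: "second_countable (mfd_topology M)"
  shows "second_countable (mfd_topology (jet_bundle M k))"
proof -
  have L: "Lindelof_space (mfd_topology M)" by (rule second_countable_imp_Lindelof_space[OF S])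
  have "(\<forall>V\<in>fst ` atlas M. openin (mfd_topology M) V) \<and> \<Union>(fst ` atlas M) = topspace (mfd_topology M)"
    using openin_chart_dom[OF M] unfolding topspace_mfd_topology[OF M] points_def by fastforce
  then obtain \<V> where V: "countable \<V>" "\<V> \<subseteq> fst ` atlas M" "\<Union>\<V> = points M"
    using L unfolding Lindelof_space_def topspace_mfd_topology[OF M] by meson
  \<comment> \<open>The covering consists of domains, and one domain may carry several charts; a
    single chart is chosen for each.\<close>
  define ch where "ch U = (SOME \<phi>. (U, \<phi>) \<in> atlas M)" for U
  have ch: "(U, ch U) \<in> atlas M" if "U \<in> \<V>" for U
  proof -
    have "U \<in> fst ` atlas M" using V(2) that by (rule subsetD)
    then obtain \<phi> where "(U, \<phi>) \<in> atlas M" by auto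
    then show ?thesis unfolding ch_def by (rule someI[where P="\<lambda>\<phi>. (U, \<phi>) \<in> atlas M"])
  qed
  show ?thesis
  proof (rule second_countable_atlas[OF smooth_atlas_jet_bundle[OF M]])
    show "countable ((\<lambda>U. (jet_dom M k U, jet_chart M k (ch U))) ` \<V>)" using V(1) by simp
    show "(\<lambda>U. (jet_dom M k U, jet_chart M k (ch U))) ` \<V> \<subseteq> atlas (jet_bundle M k)"
      using jet_bundle_chart[OF ch] by blast
    fix u assume u: "u \<in> points (jet_bundle M k)"
    then obtain U where "U \<in> \<V>" "jet_base u \<in> U" using jet_base_points[OF M] V(3) by blast
    then show "\<exists>(U, \<phi>)\<in>(\<lambda>U. (jet_dom M k U, jet_chart M k (ch U))) ` \<V>. u \<in> U"
      using u by (auto simp: mem_jet_dom[OF M])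
  qed
qed

lemma smooth_manifold_jet_bundle: "smooth_manifold M \<Longrightarrow> smooth_manifold (jet_bundle M k)"
  by (simp add: smooth_manifold_iff smooth_atlas_jet_bundle Hausdorff_jet_bundle second_countable_jet_bundle)


section \<open>Tangent vectors\<close>

lemma Suc_0_mult [simp]: "Suc 0 * n = n"
  by (simp add: mult_Suc)

lemma index_less_cancel: "a * n + i < b * n \<Longrightarrow> a < (b::nat)"
proof (rule ccontr)
  assume *: "a * n + i < b * n" and "\<not> a < b"
  then have "b * n \<le> a * n" by simp
  then show False using * by linarith
qed

lemma taylor_1: "taylor (Suc 0) h s = deriv h s"
  by (simp add: taylor_def)

lemma mem_tangent_space: "v \<in> tangent_space M x \<longleftrightarrow> v \<in> points (jet_bundle M 1) \<and> jet_base v = x"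
  by (simp add: tangent_space_def fibre_def)

lemma tangent_space_jet_dom:
  assumes "smooth_atlas M" shows "v \<in> tangent_space M x \<Longrightarrow> x \<in> U \<Longrightarrow> v \<in> jet_dom M 1 U"
  by (simp add: mem_tangent_space mem_jet_dom[OF assms])

lemma tangent_coord_jet_chart: "i < mdim M \<Longrightarrow> tangent_coord \<phi> v i = jet_chart M 1 \<phi> v (mdim M + i)"
  using curve_coords_index[of i M 1 1 \<phi> "rep v"]
  by (simp add: tangent_coord_def jet_chart_rep taylor_1)

lemma jet_chart_tangent:
  assumes M: "smooth_atlas M" and U: "(U, \<phi>) \<in> atlas M" and v: "v \<in> tangent_space M x" and x: "x \<in> U"
  shows "jet_chart M 1 \<phi> v = (\<lambda>j. if j < mdim M then \<phi> x j else if j < Suc 1 * mdim M then tangent_coord \<phi> v (j - mdim M) else 0)"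
proof
  fix j
  have "trunc (mdim M) (jet_chart M 1 \<phi> v) j = trunc (mdim M) (\<phi> x) j"
    using trunc_jet_chart[OF M U tangent_space_jet_dom[OF M v x]] v by (simp add: mem_tangent_space trunc_id[OF chart_esp[OF M U x]])
  moreover have "jet_chart M 1 \<phi> v j = 0" if "\<not> j < Suc 1 * mdim M"
    using that jet_chart_esp[of M 1 \<phi> v] by (simp add: mem_esp)
  ultimately show "jet_chart M 1 \<phi> v j = (if j < mdim M then \<phi> x j else if j < Suc 1 * mdim M then tangent_coord \<phi> v (j - mdim M) else 0)"
    using tangent_coord_jet_chart[of "j - mdim M" M \<phi> v] by (cases "j < mdim M") (auto simp: mult_Suc)
qed

lemma tangent_vector_eqI:
  assumes M: "smooth_atlas M" and U: "(U, \<phi>) \<in> atlas M" and x: "x \<in> U"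
    and v: "v \<in> tangent_space M x" and w: "w \<in> tangent_space M x"
    and eq: "\<And>i. i < mdim M \<Longrightarrow> tangent_coord \<phi> v i = tangent_coord \<phi> w i"
  shows "v = w"
proof -
  have "jet_chart M 1 \<phi> v = jet_chart M 1 \<phi> w"
    unfolding jet_chart_tangent[OF M U v x] jet_chart_tangent[OF M U w x]
    using eq by (auto simp: fun_eq_iff mult_Suc)
  then show ?thesis
    using jet_chart_eq_iff[OF M U tangent_space_jet_dom[OF M v x] tangent_space_jet_dom[OF M w x]] by simp
qed

lemma tangent_vector_exists:
  assumes M: "smooth_atlas M" and U: "(U, \<phi>) \<in> atlas M" and x: "x \<in> U"
  obtains v where "v \<in> tangent_space M x" "\<And>i. i < mdim M \<Longrightarrow> tangent_coord \<phi> v i = a i"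
proof -
  let ?n = "mdim M"
  define z where "z j = (if j < ?n then \<phi> x j else if j < Suc 1 * ?n then a (j - ?n) else 0)" for j
  have tz: "trunc ?n z = \<phi> x"
    using chart_esp[OF M U x] by (auto simp: z_def trunc_def mem_esp fun_eq_iff)
  then have "z \<in> cyl ?n (Suc 1 * ?n) (\<phi> ` U)"
    using x by (auto simp: cyl_def mem_esp z_def mult_Suc)
  then obtain v where v: "v \<in> jet_dom M 1 U" "jet_chart M 1 \<phi> v = z" by (rule jet_with_coords[OF M U])
  have "\<phi> (jet_base v) = \<phi> x" using trunc_jet_chart[OF M U v(1)] v(2) tz by simp
  then have "jet_base v = x" using v(1) x chart_inj[OF M U] by (auto simp: mem_jet_dom[OF M] inj_on_def)
  then have "v \<in> tangent_space M x" using v(1) by (simp add: mem_tangent_space mem_jet_dom[OF M])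
  moreover have "tangent_coord \<phi> v i = a i" if "i < ?n" for i
    using that v(2) by (simp add: tangent_coord_jet_chart z_def mult_Suc)
  ultimately show ?thesis by (rule that)
qed

text \<open>The order one case of the jet transition: the recursion of \<open>jet_taylor\<close> has
  a single step there and is linear in the components.\<close>

lemma tangent_coord_transition:
  assumes M: "smooth_atlas M" and U: "(U, \<phi>) \<in> atlas M" and V: "(V, \<psi>) \<in> atlas M"
    and x: "x \<in> U" "x \<in> V" and v: "v \<in> tangent_space M x" and j: "j < mdim M"
  shows "tangent_coord \<psi> v j =
    (\<Sum>i<mdim M. tangent_coord \<phi> v i * partial_deriv i (\<lambda>y. \<psi> (inv_into U \<phi> y) j) (\<phi> x))"
proof -
  let ?n = "mdim M" and ?f = "\<lambda>y. \<psi> (inv_into U \<phi> y) j"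
  have "v \<in> jet_dom M 1 (U \<inter> V)" using v x by (intro tangent_space_jet_dom[OF M]) auto
  from jet_transition[OF M U V this _ j, of 1]
  have "tangent_coord \<psi> v j = jet_taylor ?n (Suc 0) ?f (jet_chart M 1 \<phi> v)"
    using j by (simp add: tangent_coord_jet_chart)
  also have "\<dots> = (\<Sum>i<?n. jet_chart M 1 \<phi> v (?n + i) * partial_deriv i ?f (trunc ?n (jet_chart M 1 \<phi> v)))"
    by (simp add: jet_taylor.simps(2) mult_Suc)
  also have "trunc ?n (jet_chart M 1 \<phi> v) = \<phi> x"
    using trunc_jet_chart[OF M U tangent_space_jet_dom[OF M v x(1)]] v by (simp add: mem_tangent_space)
  finally show ?thesis by (simp add: tangent_coord_jet_chart)
qed

text \<open>Makes the description \<open>tangent_vector\<close> usable. A vector is built in one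
  chart, \<open>cons\<close> carries its components to all others, and the components in a single
  chart already determine it.\<close>

lemma tangent_vector_spec:
  assumes M: "smooth_atlas M" and x: "x \<in> points M"
    and cons: "\<And>U \<phi> V \<psi> j. (U, \<phi>) \<in> atlas M \<Longrightarrow> (V, \<psi>) \<in> atlas M \<Longrightarrow> x \<in> U \<Longrightarrow> x \<in> V \<Longrightarrow> j < mdim M \<Longrightarrow>
      a \<psi> j = (\<Sum>i<mdim M. a \<phi> i * partial_deriv i (\<lambda>y. \<psi> (inv_into U \<phi> y) j) (\<phi> x))"
  shows "tangent_vector M x a \<in> tangent_space M x"
    "\<And>U \<phi> i. (U, \<phi>) \<in> atlas M \<Longrightarrow> x \<in> U \<Longrightarrow> i < mdim M \<Longrightarrow> tangent_coord \<phi> (tangent_vector M x a) i = a \<phi> i"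
proof -
  obtain U \<phi> where U: "(U, \<phi>) \<in> atlas M" "x \<in> U" using points_chart[OF x] .
  obtain v where v: "v \<in> tangent_space M x" "\<And>i. i < mdim M \<Longrightarrow> tangent_coord \<phi> v i = a \<phi> i"
    by (rule tangent_vector_exists[OF M U(1,2), of "a \<phi>"]) (rule that)
  let ?P = "\<lambda>v. v \<in> tangent_space M x \<and> (\<forall>(U, \<phi>)\<in>atlas M. x \<in> U \<longrightarrow> (\<forall>i<mdim M. tangent_coord \<phi> v i = a \<phi> i))"
  have "?P v"
  proof (intro conjI v(1), clarify)
    fix V \<psi> j assume V: "(V, \<psi>) \<in> atlas M" "x \<in> V" and j: "j < mdim M"
    show "tangent_coord \<psi> v j = a \<psi> j"
      unfolding tangent_coord_transition[OF M U(1) V(1) U(2) V(2) v(1) j] cons[OF U(1) V(1) U(2) V(2) j]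
      using v(2) by simp
  qed
  moreover have "w = v" if w: "?P w" for w
  proof (rule tangent_vector_eqI[OF M U _ v(1)])
    show "w \<in> tangent_space M x" using w by simp
    show "tangent_coord \<phi> w i = tangent_coord \<phi> v i" if "i < mdim M" for i
      using bspec[OF conjunct2[OF w] U(1)] U(2) that v(2) by simp
  qed
  ultimately have *: "?P (tangent_vector M x a)"
    unfolding tangent_vector_def by (rule theI[where P="?P"])
  then show "tangent_vector M x a \<in> tangent_space M x"
    "\<And>U \<phi> i. (U, \<phi>) \<in> atlas M \<Longrightarrow> x \<in> U \<Longrightarrow> i < mdim M \<Longrightarrow> tangent_coord \<phi> (tangent_vector M x a) i = a \<phi> i"
    by blast+
qed

lemma tangent_space_points: "smooth_atlas M \<Longrightarrow> v \<in> tangent_space M x \<Longrightarrow> x \<in> points M"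
  using jet_base_points mem_tangent_space by metis

lemma tangent_add_coord:
  assumes M: "smooth_atlas M" and v: "v \<in> tangent_space M x" and w: "w \<in> tangent_space M x"
  shows "tangent_add M v w \<in> tangent_space M x"
    "\<And>U \<phi> i. (U, \<phi>) \<in> atlas M \<Longrightarrow> x \<in> U \<Longrightarrow> i < mdim M \<Longrightarrow>
       tangent_coord \<phi> (tangent_add M v w) i = tangent_coord \<phi> v i + tangent_coord \<phi> w i"
proof -
  have b: "jet_base v = x" using v by (simp add: mem_tangent_space)
  have "tangent_coord \<psi> v j + tangent_coord \<psi> w j = (\<Sum>i<mdim M. (tangent_coord \<phi> v i + tangent_coord \<phi> w i) *
      partial_deriv i (\<lambda>y. \<psi> (inv_into U \<phi> y) j) (\<phi> x))"
    if "(U, \<phi>) \<in> atlas M" "(V, \<psi>) \<in> atlas M" "x \<in> U" "x \<in> V" "j < mdim M" for U \<phi> V \<psi> j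
    unfolding tangent_coord_transition[OF M that(1-4) v that(5)] tangent_coord_transition[OF M that(1-4) w that(5)]
    by (simp only: distrib_right sum.distrib)
  from tangent_vector_spec[OF M tangent_space_points[OF M v], of "\<lambda>\<phi> i. tangent_coord \<phi> v i + tangent_coord \<phi> w i", OF this]
  show "tangent_add M v w \<in> tangent_space M x"
    "\<And>U \<phi> i. (U, \<phi>) \<in> atlas M \<Longrightarrow> x \<in> U \<Longrightarrow> i < mdim M \<Longrightarrow>
       tangent_coord \<phi> (tangent_add M v w) i = tangent_coord \<phi> v i + tangent_coord \<phi> w i"
    unfolding tangent_add_def b by simp_all
qed

lemma tangent_scale_coord:
  assumes M: "smooth_atlas M" and v: "v \<in> tangent_space M x"
  shows "tangent_scale M c v \<in> tangent_space M x"
    "\<And>U \<phi> i. (U, \<phi>) \<in> atlas M \<Longrightarrow> x \<in> U \<Longrightarrow> i < mdim M \<Longrightarrow>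
       tangent_coord \<phi> (tangent_scale M c v) i = c * tangent_coord \<phi> v i"
proof -
  have b: "jet_base v = x" using v by (simp add: mem_tangent_space)
  have "c * tangent_coord \<psi> v j = (\<Sum>i<mdim M. (c * tangent_coord \<phi> v i) *
      partial_deriv i (\<lambda>y. \<psi> (inv_into U \<phi> y) j) (\<phi> x))"
    if "(U, \<phi>) \<in> atlas M" "(V, \<psi>) \<in> atlas M" "x \<in> U" "x \<in> V" "j < mdim M" for U \<phi> V \<psi> j
    unfolding tangent_coord_transition[OF M that(1-4) v that(5)]
    by (simp only: mult.assoc sum_distrib_left)
  from tangent_vector_spec[OF M tangent_space_points[OF M v], of "\<lambda>\<phi> i. c * tangent_coord \<phi> v i", OF this]
  show "tangent_scale M c v \<in> tangent_space M x"
    "\<And>U \<phi> i. (U, \<phi>) \<in> atlas M \<Longrightarrow> x \<in> U \<Longrightarrow> i < mdim M \<Longrightarrow>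
       tangent_coord \<phi> (tangent_scale M c v) i = c * tangent_coord \<phi> v i"
    unfolding tangent_scale_def b by simp_all
qed

text \<open>The shifted components are those of a vector because the shift by one block commutes
  with the Jacobian \<open>P\<close> of a jet transition: the entries of \<open>P\<close> depend on
  target and source block only through their difference and vanish when it is negative.\<close>

lemma almost_tangent_coord:
  assumes M: "smooth_atlas M" and v: "v \<in> tangent_space (jet_bundle M k) u"
  shows "almost_tangent M k v \<in> tangent_space (jet_bundle M k) u"
    "\<And>U \<phi> j. (U, \<phi>) \<in> atlas M \<Longrightarrow> u \<in> jet_dom M k U \<Longrightarrow> j < Suc k * mdim M \<Longrightarrow>
       tangent_coord (jet_chart M k \<phi>) (almost_tangent M k v) j =
         (if j < mdim M then 0 else tangent_coord (jet_chart M k \<phi>) v (j - mdim M))"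
proof -
  let ?E = "jet_bundle M k" and ?n = "mdim M" and ?N = "Suc k * mdim M"
  have E: "smooth_atlas ?E" by (rule smooth_atlas_jet_bundle[OF M])
  have b: "jet_base v = u" using v by (simp add: mem_tangent_space)
  let ?a = "\<lambda>\<phi>' j. if j < ?n then 0 else tangent_coord \<phi>' v (j - ?n)"
  have cons: "?a \<psi>' j = (\<Sum>l<mdim ?E. ?a \<phi>' l * partial_deriv l (\<lambda>y. \<psi>' (inv_into U' \<phi>' y) j) (\<phi>' u))"
    if U'a: "(U', \<phi>') \<in> atlas ?E" and V'a: "(V', \<psi>') \<in> atlas ?E" and u: "u \<in> U'" "u \<in> V'" and j: "j < mdim ?E" for U' \<phi>' V' \<psi>' j
  proof -
    obtain U \<phi> where U: "(U, \<phi>) \<in> atlas M" and U': "U' = jet_dom M k U" "\<phi>' = jet_chart M k \<phi>"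
      using U'a unfolding atlas_jet_bundle by blast
    obtain V \<psi> where V: "(V, \<psi>) \<in> atlas M" and V': "V' = jet_dom M k V" "\<psi>' = jet_chart M k \<psi>"
      using V'a unfolding atlas_jet_bundle by blast
    define P where "P l j = partial_deriv l (\<lambda>y. \<psi>' (inv_into U' \<phi>' y) j) (\<phi>' u)" for l j
    define Q where "Q \<alpha> i \<beta> m = (if \<alpha> \<le> \<beta> then jet_taylor ?n (\<beta> - \<alpha>) (partial_deriv i (\<lambda>x. \<psi> (inv_into U \<phi> x) m)) (\<phi>' u) else 0)" for \<alpha> i \<beta> m
    have uUV: "u \<in> jet_dom M k (U \<inter> V)" using u U' V' by (auto simp: mem_jet_dom[OF M])
    have xc: "\<phi>' u \<in> cyl ?n ?N (\<phi> ` (U \<inter> V))"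
      using jet_chart_image[OF M U, of "U \<inter> V" k] uUV U'(2) by auto
    \<comment> \<open>In charts the transition is given by \<open>jet_taylor\<close>, whose partial
      derivatives have been computed.\<close>
    have PQ: "P (\<alpha> * ?n + i) (\<beta> * ?n + m) = Q \<alpha> i \<beta> m"
      if i: "i < ?n" and m: "m < ?n" and "\<alpha> \<le> k" "\<beta> \<le> k" for \<alpha> i \<beta> m
    proof -
      have l: "\<alpha> * ?n + i < ?N" using index_less[OF i, of \<alpha> k] that by simp
      have bN: "Suc \<beta> * ?n \<le> ?N" using that by (intro mult_le_mono1) simp
      have "P (\<alpha> * ?n + i) (\<beta> * ?n + m) = partial_deriv (\<alpha> * ?n + i) (jet_taylor ?n \<beta> (\<lambda>x. \<psi> (inv_into U \<phi> x) m)) (\<phi>' u)"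
        unfolding P_def
      proof (rule partial_deriv_cong[OF openin_cyl[OF chart_overlap_open[OF M U V]] xc l])
        show "?n \<le> ?N" by (simp add: mult_Suc)
        fix y assume "y \<in> cyl ?n ?N (\<phi> ` (U \<inter> V))"
        then obtain w where w: "w \<in> jet_dom M k (U \<inter> V)" "y = jet_chart M k \<phi> w"
          using jet_chart_image[OF M U, of "U \<inter> V" k] by blast
        then have "w \<in> jet_dom M k U" by (simp add: mem_jet_dom[OF M])
        then have "inv_into U' \<phi>' y = w"
          using w(2) inv_into_f_f[OF jet_chart_inj[OF M U]] U' by simp
        then show "\<psi>' (inv_into U' \<phi>' y) (\<beta> * ?n + m) = jet_taylor ?n \<beta> (\<lambda>x. \<psi> (inv_into U \<phi> x) m) y"
          using jet_transition[OF M U V w(1) \<open>\<beta> \<le> k\<close> m] w(2) V'(2) by simp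
      qed
      also have "\<dots> = Q \<alpha> i \<beta> m"
        unfolding Q_def by (rule partial_deriv_jet_taylor[OF chart_transition[OF M U V m] bN i l xc])
      finally show ?thesis .
    qed
    have Pshift: "P (l + ?n) (j + ?n) = P l j" if "l + ?n < ?N" "j + ?n < ?N" for l j
    proof -
      have "l < ?N" "j < ?N" using that by simp_all
      then obtain \<alpha> i \<beta> m where *: "i < ?n" "l = \<alpha> * ?n + i" "m < ?n" "j = \<beta> * ?n + m"
        using index_cases by metis
      have "\<alpha> < k" "\<beta> < k"
      proof -
        have "\<alpha> * ?n + i < k * ?n" "\<beta> * ?n + m < k * ?n" using that * by (simp_all add: mult_Suc)
        then show "\<alpha> < k" "\<beta> < k" using index_less_cancel by blast+
      qed
      then show ?thesis
        using PQ[OF *(1,3), of \<alpha> \<beta>] PQ[OF *(1,3), of "Suc \<alpha>" "Suc \<beta>"] *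
        by (simp add: Q_def mult_Suc add_ac)
    qed
    \<comment> \<open>Used with \<open>b = 1\<close>, to see that the first target block receives
      nothing from the shifted vector, and with \<open>b = k\<close>, to complete a sum by the last
      source block.\<close>
    have Pzero: "P l j = 0" if "l < ?N" "j < b * ?n" "b * ?n \<le> l" for l j b
    proof -
      have "j < ?N" using that by simp
      then obtain \<alpha> i \<beta> m where *: "\<alpha> \<le> k" "i < ?n" "l = \<alpha> * ?n + i" "\<beta> \<le> k" "m < ?n" "j = \<beta> * ?n + m"
        using \<open>l < ?N\<close> index_cases by metis
      have "\<beta> * ?n + m < b * ?n" using that(2) * by simp
      then have "\<beta> < b" by (rule index_less_cancel)
      have "b * ?n + 0 < Suc \<alpha> * ?n" using that(3) * by (simp add: mult_Suc)
      then have "b < Suc \<alpha>" by (rule index_less_cancel)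
      then show ?thesis using PQ[OF *(2,5,1,4)] * \<open>\<beta> < b\<close> by (simp add: Q_def)
    qed
    have N: "mdim ?E = ?n + k * ?n" by (simp add: mult_Suc)
    have "(\<Sum>l<mdim ?E. ?a \<phi>' l * P l j) = (\<Sum>l<k * ?n. tangent_coord \<phi>' v l * P (l + ?n) j)"
    proof -
      have "(\<Sum>l<mdim ?E. ?a \<phi>' l * P l j) = (\<Sum>l\<in>{?n..<mdim ?E}. tangent_coord \<phi>' v (l - ?n) * P l j)"
        by (rule sum.mono_neutral_cong_right) auto
      also have "{?n..<mdim ?E} = {0 + ?n..<k * ?n + ?n}" by (simp add: mult_Suc add.commute)
      also have "(\<Sum>l\<in>{0 + ?n..<k * ?n + ?n}. tangent_coord \<phi>' v (l - ?n) * P l j) = (\<Sum>l<k * ?n. tangent_coord \<phi>' v l * P (l + ?n) j)"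
        unfolding sum.shift_bounds_nat_ivl by (simp add: atLeast0LessThan)
      finally show ?thesis .
    qed
    also have "\<dots> = ?a \<psi>' j"
    proof (cases "j < ?n")
      case True
      have "P (l + ?n) j = 0" if "l < k * ?n" for l
        using Pzero[of "l + ?n" j 1] that True by (simp add: mult_Suc)
      then show ?thesis using True by simp
    next
      case False
      define j' where "j' = j - ?n"
      have j': "j = j' + ?n" "j' < k * ?n" using False j N by (simp_all add: j'_def)
      have "(\<Sum>l<k * ?n. tangent_coord \<phi>' v l * P (l + ?n) j) = (\<Sum>l<k * ?n. tangent_coord \<phi>' v l * P l j')"
        using Pshift j' by (intro sum.cong refl) (simp add: mult_Suc)
      also have "\<dots> = (\<Sum>l<mdim ?E. tangent_coord \<phi>' v l * P l j')"
        using Pzero[of _ j' k] j' by (intro sum.mono_neutral_left) (auto simp: mult_Suc)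
      also have "\<dots> = tangent_coord \<psi>' v j'"
        unfolding P_def using j' by (intro tangent_coord_transition[OF E U'a V'a u v, symmetric]) (simp add: mult_Suc)
      finally show ?thesis using False by (simp add: j'_def)
    qed
    finally show ?thesis unfolding P_def by simp
  qed
  have up: "u \<in> points ?E" by (rule tangent_space_points[OF E v])
  show "almost_tangent M k v \<in> tangent_space ?E u"
    unfolding almost_tangent_def b by (rule tangent_vector_spec(1)[OF E up]) (rule cons; assumption)
  have spec: "tangent_coord \<phi>' (tangent_vector ?E u ?a) j = ?a \<phi>' j"
    if "(U', \<phi>') \<in> atlas ?E" "u \<in> U'" "j < mdim ?E" for U' \<phi>' j
    using that by (rule tangent_vector_spec(2)[OF E up, rotated]) (rule cons; assumption)
  show "tangent_coord (jet_chart M k \<phi>) (almost_tangent M k v) j =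
         (if j < ?n then 0 else tangent_coord (jet_chart M k \<phi>) v (j - ?n))"
    if "(U, \<phi>) \<in> atlas M" "u \<in> jet_dom M k U" "j < ?N" for U \<phi> j
    unfolding almost_tangent_def b using spec[OF jet_bundle_chart[OF that(1)] that(2)] that(3) by simp
qed

text \<open>Serves \<open>jet_base\<close> and \<open>jet_proj\<close>, which in charts keep an
  initial segment of the coordinates; the tangent map then keeps the corresponding
  components.\<close>

lemma tangent_map_coord:
  assumes E: "smooth_atlas E" and B: "smooth_atlas B" and U: "(U, \<phi>) \<in> atlas E" and V: "(V, \<psi>) \<in> atlas B"
    and fUV: "f ` U \<subseteq> V" and le: "mdim B \<le> mdim E"
    and proj: "\<And>x j. x \<in> U \<Longrightarrow> j < mdim B \<Longrightarrow> \<psi> (f x) j = \<phi> x j"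
    and v: "v \<in> tangent_space E u" and u: "u \<in> U"
  shows "tangent_map B f v \<in> tangent_space B (f u)"
    "\<And>j. j < mdim B \<Longrightarrow> tangent_coord \<psi> (tangent_map B f v) j = tangent_coord \<phi> v j"
proof -
  have v': "v \<in> points (jet_bundle E 1)" "jet_base v = u" using v by (simp_all add: mem_tangent_space)
  note q = jet_bundle_rep[OF E v'(1)]
  have q0: "rep v 0 = u" using q(3) v'(2) by simp
  obtain I where I: "open I" "0 \<in> I" "\<And>t. t \<in> I \<Longrightarrow> rep v t \<in> U" "\<And>i. i < mdim E \<Longrightarrow> smooth_real I (\<lambda>s. \<phi> (rep v s) i)"
    by (rule curve_chartD[OF q(1) U, unfolded q0, OF u]) (rule that)
  have c: "curve B (f \<circ> rep v)"
  proof (rule curveI[OF B V I(1,2)])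
    show "(f \<circ> rep v) t \<in> V" if "t \<in> I" for t using I(3)[OF that] fUV by auto
    show "smooth_real I (\<lambda>s. \<psi> ((f \<circ> rep v) s) i)" if "i < mdim B" for i
      by (rule smooth_real_cong[OF I(4)[of i]]) (use that le I(3) proj in auto)
  qed
  have base: "(f \<circ> rep v) 0 = f u" using q0 by simp
  show "tangent_map B f v \<in> tangent_space B (f u)"
    unfolding tangent_map_def mem_tangent_space using jet_points[OF c] jet_base_jet[OF B c] base by simp
  show "tangent_coord \<psi> (tangent_map B f v) j = tangent_coord \<phi> v j" if j: "j < mdim B" for j
  proof -
    have fu: "f u \<in> V" using fUV u by auto
    have "tangent_coord \<psi> (tangent_map B f v) j = curve_coords B 1 \<psi> (f \<circ> rep v) (mdim B + j)"
      unfolding tangent_map_def tangent_coord_jet_chart[OF j]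
      using jet_chart_jet[OF B c V, of 1] base fu by simp
    also have "\<dots> = taylor 1 (\<lambda>t. \<psi> ((f \<circ> rep v) t) j) 0"
      using curve_coords_index[OF j, of 1 1 \<psi> "f \<circ> rep v"] by simp
    also have "\<dots> = taylor 1 (\<lambda>t. \<phi> (rep v t) j) 0"
      by (rule taylor_cong[OF I(1,2)]) (use I(3) proj j in simp)
    finally show ?thesis by (simp add: taylor_1 tangent_coord_def)
  qed
qed

section \<open>Jet projections and the Tulczyjew operator in coordinates\<close>

lemma jet_proj_dom:
  assumes M: "smooth_atlas M" and u: "u \<in> jet_dom M k U"
  shows "jet_proj M \<alpha> u \<in> jet_dom M \<alpha> U" "jet_base (jet_proj M \<alpha> u) = jet_base u"
proof -
  have u': "u \<in> points (jet_bundle M k)" "jet_base u \<in> U" using u by (simp_all add: mem_jet_dom[OF M])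
  note r = jet_bundle_rep[OF M u'(1)]
  show "jet_base (jet_proj M \<alpha> u) = jet_base u"
    unfolding jet_proj_def using jet_base_jet[OF M r(1)] r(3) by simp
  then show "jet_proj M \<alpha> u \<in> jet_dom M \<alpha> U"
    using u'(2) jet_points[OF r(1)] by (simp add: mem_jet_dom[OF M]) (simp add: jet_proj_def)
qed

lemma jet_chart_jet_proj:
  assumes M: "smooth_atlas M" and U: "(U, \<phi>) \<in> atlas M" and u: "u \<in> jet_dom M k U" and "\<alpha> \<le> k"
  shows "jet_chart M \<alpha> \<phi> (jet_proj M \<alpha> u) = trunc (Suc \<alpha> * mdim M) (jet_chart M k \<phi> u)"
proof -
  have u': "u \<in> points (jet_bundle M k)" "jet_base u \<in> U" using u by (simp_all add: mem_jet_dom[OF M])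
  note r = jet_bundle_rep[OF M u'(1)]
  have "rep u 0 \<in> U" using r(3) u'(2) by simp
  show ?thesis
    unfolding jet_proj_def jet_chart_jet[OF M r(1) U \<open>rep u 0 \<in> U\<close>] unfolding jet_chart_rep
    by (rule trunc_curve_coords[OF assms(4), symmetric])
qed

lemma taylor_shift: "taylor b (\<lambda>s. h (t + s)) 0 = taylor b h t"
proof -
  have "deriv (\<lambda>s. h (t + s)) s = deriv h (t + s)" for h :: "real \<Rightarrow> real" and s
    unfolding deriv_def using DERIV_at_within_shift[of h _ t s UNIV] by simp
  then have "(deriv ^^ b) (\<lambda>s. h (t + s)) = (\<lambda>s. (deriv ^^ b) h (t + s))"
    by (induction b) auto
  then show ?thesis by (simp add: taylor_def)
qed

lemma smooth_real_taylor: "smooth_real I h \<Longrightarrow> smooth_real I (taylor b h)"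
proof -
  assume h: "smooth_real I h"
  have "smooth_real I ((deriv ^^ b) h)" by (induction b) (simp_all add: h smooth_real_deriv)
  from smooth_real_mult[OF this smooth_real_const[OF smooth_real_open[OF h], of "1 / fact b"]]
  show ?thesis by (rule smooth_real_cong) (simp add: taylor_def)
qed

lemma deriv_taylor: 
  assumes "smooth_real I h" "s \<in> I" shows "deriv (taylor b h) s = real (Suc b) * taylor (Suc b) h s"
proof -
  have "smooth_real I ((deriv ^^ b) h)" by (induction b) (simp_all add: assms smooth_real_deriv)
  from smooth_real_has_deriv[OF this assms(2)]
  have "deriv (taylor b h) s = (deriv ^^ Suc b) h s / fact b"
    unfolding taylor_def by (intro DERIV_imp_deriv DERIV_cdivide) simp
  then show ?thesis by (simp add: taylor_def del: of_nat_Suc)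
qed

text \<open>Along the shifted curve, the coordinate of order \<beta> is the Taylor coefficient at
  time \<open>t\<close>; its derivative at 0 is \<open>Suc \<beta>\<close> times the next
  coefficient. This is the origin of the factor \<open>Suc \<mu>\<close> on the diagonal of
  \<open>F\<close>.\<close>

lemma tulczyjew_coord:
  assumes M: "smooth_atlas M" and U: "(U, \<phi>) \<in> atlas M" and w: "w \<in> jet_dom M (Suc \<mu>) U"
  shows "tulczyjew M (Suc \<mu>) w \<in> tangent_space (jet_bundle M \<mu>) (jet_proj M \<mu> w)"
    "\<And>\<beta> i. \<beta> \<le> \<mu> \<Longrightarrow> i < mdim M \<Longrightarrow> tangent_coord (jet_chart M \<mu> \<phi>) (tulczyjew M (Suc \<mu>) w) (\<beta> * mdim M + i) =
       real (Suc \<beta>) * jet_chart M (Suc \<mu>) \<phi> w (Suc \<beta> * mdim M + i)"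
proof -
  let ?B = "jet_bundle M \<mu>" and ?n = "mdim M"
  have B: "smooth_atlas ?B" by (rule smooth_atlas_jet_bundle[OF M])
  have w': "w \<in> points (jet_bundle M (Suc \<mu>))" "jet_base w \<in> U" using w by (simp_all add: mem_jet_dom[OF M])
  note r = jet_bundle_rep[OF M w'(1)]
  define q where "q = rep w"
  have q: "curve M q" "q 0 \<in> U" using r w' by (simp_all add: q_def)
  obtain I where I: "open I" "0 \<in> I" "\<And>t. t \<in> I \<Longrightarrow> q t \<in> U" "\<And>i. i < ?n \<Longrightarrow> smooth_real I (\<lambda>s. \<phi> (q s) i)"
    by (rule curve_chartD[OF q(1) U q(2)]) (rule that)
  have sh: "curve M (\<lambda>s. q (t + s))" if t: "t \<in> I" for t
  proof (rule curveI[OF M U])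
    have "{s. t + s \<in> I} = (\<lambda>s. t + s) -` I" by auto
    then show "open {s. t + s \<in> I}" using I(1) by (simp add: open_vimage continuous_intros)
    show "smooth_real {s. t + s \<in> I} (\<lambda>s. \<phi> (q (t + s)) i)" if "i < ?n" for i
      by (rule smooth_real_shift[OF I(4)[OF that]])
  qed (use t I(3) in auto)
  define p where "p t = jet M \<mu> (\<lambda>s. q (t + s))" for t
  have p_dom: "p t \<in> jet_dom M \<mu> U" if "t \<in> I" for t
    using sh[OF that] I(3)[OF that] unfolding p_def jet_dom_def by force
  have p_chart: "jet_chart M \<mu> \<phi> (p t) (\<beta> * ?n + i) = taylor \<beta> (\<lambda>s. \<phi> (q s) i) t"
    if "t \<in> I" "\<beta> \<le> \<mu>" "i < ?n" for t \<beta> i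
  proof -
    have "jet_chart M \<mu> \<phi> (p t) = curve_coords M \<mu> \<phi> (\<lambda>s. q (t + s))"
      unfolding p_def by (rule jet_chart_jet[OF M sh[OF that(1)] U]) (use I(3) that in simp)
    then show ?thesis using that(2,3) taylor_shift[of \<beta> "\<lambda>s. \<phi> (q s) i" t] by (simp add: curve_coords_index)
  qed
  have pc: "curve ?B p"
  proof (rule curveI[OF B jet_bundle_chart[OF U] I(1,2) p_dom])
    fix j assume "j < mdim ?B"
    then obtain \<beta> i where j: "\<beta> \<le> \<mu>" "i < ?n" "j = \<beta> * ?n + i" unfolding mdim_jet_bundle by (rule index_cases)
    show "smooth_real I (\<lambda>s. jet_chart M \<mu> \<phi> (p s) j)"
      by (rule smooth_real_cong[OF smooth_real_taylor[OF I(4)[OF j(2)], of \<beta>]]) (use p_chart j in simp)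
  qed
  have tul: "tulczyjew M (Suc \<mu>) w = jet ?B 1 p"
    unfolding tulczyjew_def p_def q_def by simp
  have p0: "p 0 = jet_proj M \<mu> w" by (simp add: p_def q_def jet_proj_def)
  show "tulczyjew M (Suc \<mu>) w \<in> tangent_space ?B (jet_proj M \<mu> w)"
    unfolding tul mem_tangent_space using jet_points[OF pc] jet_base_jet[OF B pc] p0 by simp
  show "tangent_coord (jet_chart M \<mu> \<phi>) (tulczyjew M (Suc \<mu>) w) (\<beta> * ?n + i) =
       real (Suc \<beta>) * jet_chart M (Suc \<mu>) \<phi> w (Suc \<beta> * ?n + i)" if b: "\<beta> \<le> \<mu>" and i: "i < ?n" for \<beta> i
  proof -
    let ?j = "\<beta> * ?n + i" and ?h = "\<lambda>s. \<phi> (q s) i"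
    have j: "?j < mdim ?B" using index_less[OF i b] by simp
    have "tangent_coord (jet_chart M \<mu> \<phi>) (tulczyjew M (Suc \<mu>) w) ?j = curve_coords ?B 1 (jet_chart M \<mu> \<phi>) p (mdim ?B + ?j)"
      unfolding tul tangent_coord_jet_chart[OF j]
      using jet_chart_jet[OF B pc jet_bundle_chart[OF U] p_dom[OF I(2)], of 1] by simp
    also have "\<dots> = taylor 1 (\<lambda>t. jet_chart M \<mu> \<phi> (p t) ?j) 0"
      using curve_coords_index[OF j, of 1 1] by simp
    also have "\<dots> = taylor 1 (taylor \<beta> ?h) 0"
      by (rule taylor_cong[OF I(1,2)]) (use p_chart b i in simp)
    also have "\<dots> = real (Suc \<beta>) * taylor (Suc \<beta>) ?h 0"
      using deriv_taylor[OF I(4)[OF i] I(2)] by (simp add: taylor_1)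
    also have "taylor (Suc \<beta>) ?h 0 = jet_chart M (Suc \<mu>) \<phi> w (Suc \<beta> * ?n + i)"
      using b i curve_coords_index[of i M "Suc \<beta>" "Suc \<mu>" \<phi> q] by (simp add: jet_chart_rep q_def)
    finally show ?thesis .
  qed
qed


section \<open>Whitney sums, restrictions and products\<close>

definition whitney_dom :: "'a mfd \<Rightarrow> nat \<Rightarrow> 'a set \<Rightarrow> 'a jet list set" where
  "whitney_dom M k U = {vs. length vs = k \<and> (\<exists>x\<in>U. set vs \<subseteq> tangent_space M x)}"

lemma mdim_whitney_sum [simp]: "mdim (whitney_sum M k) = Suc k * mdim M"
  by (simp add: whitney_sum_def)

lemma atlas_whitney_sum: "atlas (whitney_sum M k) = {(whitney_dom M k U, whitney_chart M k \<phi>) | U \<phi>. (U, \<phi>) \<in> atlas M}"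
  by (simp add: whitney_sum_def whitney_dom_def)

lemma whitney_sum_chart: "(U, \<phi>) \<in> atlas M \<Longrightarrow> (whitney_dom M k U, whitney_chart M k \<phi>) \<in> atlas (whitney_sum M k)"
  unfolding atlas_whitney_sum by blast

text \<open>With at least one summand the common base point can be read off the head of the list,
  which replaces the existential quantifier.\<close>

lemma mem_whitney_dom:
  assumes "k \<ge> 1"
  shows "vs \<in> whitney_dom M k U \<longleftrightarrow> length vs = k \<and> whitney_proj vs \<in> U \<and> (\<forall>m<k. vs ! m \<in> tangent_space M (whitney_proj vs))"
proof
  assume "vs \<in> whitney_dom M k U"
  then obtain x where x: "length vs = k" "x \<in> U" "set vs \<subseteq> tangent_space M x" by (auto simp: whitney_dom_def)
  then have "hd vs \<in> tangent_space M x" using assms by (cases vs) auto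
  then have "whitney_proj vs = x" by (simp add: whitney_proj_def mem_tangent_space)
  then show "length vs = k \<and> whitney_proj vs \<in> U \<and> (\<forall>m<k. vs ! m \<in> tangent_space M (whitney_proj vs))"
    using x nth_mem by blast
next
  assume *: "length vs = k \<and> whitney_proj vs \<in> U \<and> (\<forall>m<k. vs ! m \<in> tangent_space M (whitney_proj vs))"
  then have "set vs \<subseteq> tangent_space M (whitney_proj vs)" by (auto simp: set_conv_nth)
  then show "vs \<in> whitney_dom M k U" using * by (auto simp: whitney_dom_def)
qed

lemma whitney_domI:
  assumes "k \<ge> 1" "length vs = k" "x \<in> U" "\<And>m. m < k \<Longrightarrow> vs ! m \<in> tangent_space M x"
  shows "vs \<in> whitney_dom M k U" "whitney_proj vs = x"
proof -
  have "hd vs = vs ! 0" using assms by (intro hd_conv_nth) auto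
  then show "whitney_proj vs = x" using assms(1) assms(4)[of 0] by (simp add: whitney_proj_def mem_tangent_space)
  then show "vs \<in> whitney_dom M k U" using assms by (simp add: mem_whitney_dom)
qed

lemma mem_points_whitney_sum:
  assumes "k \<ge> 1"
  shows "vs \<in> points (whitney_sum M k) \<longleftrightarrow>
    length vs = k \<and> whitney_proj vs \<in> points M \<and> (\<forall>m<k. vs ! m \<in> tangent_space M (whitney_proj vs))"
proof -
  have "vs \<in> points (whitney_sum M k) \<longleftrightarrow> (\<exists>(U, \<phi>)\<in>atlas M. vs \<in> whitney_dom M k U)"
    unfolding points_def atlas_whitney_sum by blast
  then show ?thesis unfolding mem_whitney_dom[OF assms] points_def by blast
qed

lemma whitney_chart_base: "i < mdim M \<Longrightarrow> whitney_chart M k \<phi> vs i = \<phi> (whitney_proj vs) i"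
  by (simp add: whitney_chart_def)

text \<open>Block 0 holds the base point, so list entry \<open>m\<close> sits in block
  \<open>Suc m\<close>. The jet charts store
  \<open>q\<^sup>(\<^sup>m\<^sup>+\<^sup>1\<^sup>)\<close> in the same place, which makes
  \<open>F\<close> triangular without any reordering.\<close>

lemma whitney_chart_fibre:
  assumes "i < mdim M" "m < k"
  shows "whitney_chart M k \<phi> vs (Suc m * mdim M + i) = tangent_coord \<phi> (vs ! m) i"
proof -
  have "\<not> Suc m * mdim M + i < mdim M" by (simp add: mult_Suc)
  moreover have "Suc m * mdim M + i < (k + 1) * mdim M"
    using index_less[OF assms(1), of "Suc m" k "Suc k * mdim M"] assms(2) by simp
  moreover have "(Suc m * mdim M + i) div mdim M = Suc m" "(Suc m * mdim M + i) mod mdim M = i"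
    using assms(1) by simp_all
  ultimately show ?thesis unfolding whitney_chart_def by simp
qed

lemma whitney_chart_esp: "whitney_chart M k \<phi> vs \<in> esp (Suc k * mdim M)"
  by (simp add: mem_esp whitney_chart_def mult_Suc)

lemma block_cases:
  assumes "j < Suc k * (n::nat)"
  obtains "j < n" | m i where "m < k" "i < n" "j = Suc m * n + i"
proof -
  obtain \<alpha> i where *: "\<alpha> \<le> k" "i < n" "j = \<alpha> * n + i" using assms by (rule index_cases)
  show thesis
  proof (cases \<alpha>)
    case 0 then show ?thesis using * that(1) by simp
  next
    case (Suc m) then show ?thesis using * that(2)[of m i] by simp
  qed
qed

lemma trunc_whitney_chart:
  assumes M: "smooth_atlas M" and U: "(U, \<phi>) \<in> atlas M" and "whitney_proj vs \<in> U"
  shows "trunc (mdim M) (whitney_chart M k \<phi> vs) = \<phi> (whitney_proj vs)"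
  using chart_esp[OF assms] by (auto simp: trunc_def fun_eq_iff mem_esp whitney_chart_base)

lemma whitney_chart_inj:
  assumes M: "smooth_atlas M" and U: "(U, \<phi>) \<in> atlas M" and k: "k \<ge> 1"
  shows "inj_on (whitney_chart M k \<phi>) (whitney_dom M k U)"
proof (rule inj_onI)
  fix vs ws assume vs: "vs \<in> whitney_dom M k U" and ws: "ws \<in> whitney_dom M k U"
    and eq: "whitney_chart M k \<phi> vs = whitney_chart M k \<phi> ws"
  note v = vs[unfolded mem_whitney_dom[OF k]] and w = ws[unfolded mem_whitney_dom[OF k]]
  have "\<phi> (whitney_proj vs) = \<phi> (whitney_proj ws)"
    using trunc_whitney_chart[OF M U, of vs k] trunc_whitney_chart[OF M U, of ws k] eq v w by simp
  then have p: "whitney_proj vs = whitney_proj ws" using v w chart_inj[OF M U] by (auto simp: inj_on_def)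
  show "vs = ws"
  proof (rule nth_equalityI)
    show "length vs = length ws" using v w by simp
    fix m assume "m < length vs"
    then have m: "m < k" using v by simp
    show "vs ! m = ws ! m"
    proof (rule tangent_vector_eqI[OF M U])
      show "whitney_proj vs \<in> U" "vs ! m \<in> tangent_space M (whitney_proj vs)" using v m by blast+
      show "ws ! m \<in> tangent_space M (whitney_proj vs)" unfolding p using w m by blast
      show "tangent_coord \<phi> (vs ! m) i = tangent_coord \<phi> (ws ! m) i" if "i < mdim M" for i
        using eq whitney_chart_fibre[OF that m] by metis
    qed
  qed
qed

lemma whitney_with_coords:
  assumes M: "smooth_atlas M" and U: "(U, \<phi>) \<in> atlas M" and k: "k \<ge> 1"
    and x: "x \<in> cyl (mdim M) (Suc k * mdim M) (\<phi> ` U)"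
  obtains vs where "vs \<in> whitney_dom M k U" "whitney_chart M k \<phi> vs = x"
proof -
  let ?n = "mdim M"
  obtain y where y: "y \<in> U" "trunc ?n x = \<phi> y" using x by (auto simp: cyl_def)
  have "\<exists>v. v \<in> tangent_space M y \<and> (\<forall>i<?n. tangent_coord \<phi> v i = x (Suc m * ?n + i))" for m
    using tangent_vector_exists[OF M U y(1), of "\<lambda>i. x (Suc m * ?n + i)"] by blast
  then obtain v where v: "\<And>m. v m \<in> tangent_space M y" "\<And>m i. i < ?n \<Longrightarrow> tangent_coord \<phi> (v m) i = x (Suc m * ?n + i)"
    by metis
  let ?vs = "map v [0..<k]"
  have d: "?vs \<in> whitney_dom M k U" "whitney_proj ?vs = y"
    using whitney_domI[OF k _ y(1), of ?vs M] v(1) by simp_all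
  have "whitney_chart M k \<phi> ?vs j = x j" for j
  proof (cases "j < Suc k * ?n")
    case True
    then show ?thesis
    proof (cases rule: block_cases)
      case 1
      then have "trunc ?n x j = x j" by simp
      then show ?thesis using 1 d(2) y(2) by (simp add: whitney_chart_base)
    next
      case (2 m i)
      then show ?thesis using whitney_chart_fibre[OF 2(2,1), of \<phi> ?vs] v(2)[OF 2(2), of m] by simp
    qed
  next
    case False
    then show ?thesis using x whitney_chart_esp[of M k \<phi> ?vs] by (simp add: cyl_def mem_esp)
  qed
  then show ?thesis using d(1) that[of ?vs] by blast
qed

lemma whitney_chart_image:
  assumes M: "smooth_atlas M" and U: "(U, \<phi>) \<in> atlas M" and k: "k \<ge> 1" and VU: "V \<subseteq> U"
  shows "whitney_chart M k \<phi> ` whitney_dom M k V = cyl (mdim M) (Suc k * mdim M) (\<phi> ` V)"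
proof
  show "whitney_chart M k \<phi> ` whitney_dom M k V \<subseteq> cyl (mdim M) (Suc k * mdim M) (\<phi> ` V)"
  proof
    fix x assume "x \<in> whitney_chart M k \<phi> ` whitney_dom M k V"
    then obtain vs where u: "vs \<in> whitney_dom M k V" "x = whitney_chart M k \<phi> vs" by blast
    then have "whitney_proj vs \<in> V" by (simp add: mem_whitney_dom[OF k])
    then show "x \<in> cyl (mdim M) (Suc k * mdim M) (\<phi> ` V)"
      using trunc_whitney_chart[OF M U, of vs k] u(2) whitney_chart_esp VU by (auto simp: cyl_def)
  qed
  show "cyl (mdim M) (Suc k * mdim M) (\<phi> ` V) \<subseteq> whitney_chart M k \<phi> ` whitney_dom M k V"
  proof
    fix x assume x: "x \<in> cyl (mdim M) (Suc k * mdim M) (\<phi> ` V)"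
    then have "x \<in> cyl (mdim M) (Suc k * mdim M) (\<phi> ` U)" using VU by (auto simp: cyl_def)
    then obtain vs where vs: "vs \<in> whitney_dom M k U" "whitney_chart M k \<phi> vs = x" by (rule whitney_with_coords[OF M U k])
    note v = vs(1)[unfolded mem_whitney_dom[OF k]]
    have "\<phi> (whitney_proj vs) \<in> \<phi> ` V" using x trunc_whitney_chart[OF M U, of vs k] v vs(2) by (simp add: cyl_def)
    then have "whitney_proj vs \<in> V" using v VU chart_inj[OF M U] by (auto simp: inj_on_def)
    then have "vs \<in> whitney_dom M k V" using v by (simp add: mem_whitney_dom[OF k])
    then show "x \<in> whitney_chart M k \<phi> ` whitney_dom M k V" using vs(2) by blast
  qed
qed

lemma smooth_fun_on_trunc:
  assumes f: "smooth_fun_on n A f" and nm: "n \<le> m"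
  shows "smooth_fun_on m (cyl n m A) (\<lambda>x. f (trunc n x))"
proof -
  have X: "openin (Euclidean_space m) (cyl n m A)" by (rule openin_cyl[OF smooth_fun_on_openin[OF f] nm])
  show ?thesis
    by (rule smooth_fun_on_compose[OF f X]) (use X in \<open>auto simp: cyl_def smooth_fun_on_coord\<close>)
qed

lemma smooth_atlas_whitney_sum:
  assumes M: "smooth_atlas M" and k: "k \<ge> 1" shows "smooth_atlas (whitney_sum M k)"
proof (rule smooth_atlas_cylI[OF M _ atlas_whitney_sum _ whitney_chart_inj[OF M _ k]], unfold mdim_whitney_sum)
  let ?n = "mdim M" and ?N = "Suc k * mdim M"
  show nN: "?n \<le> ?N" by (simp add: mult_Suc)
  show "whitney_dom M k U \<inter> whitney_dom M k V = whitney_dom M k (U \<inter> V)" for U V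
    by (auto simp: mem_whitney_dom[OF k])
  show "whitney_chart M k \<phi> ` whitney_dom M k V = cyl ?n ?N (\<phi> ` V)" if "(U, \<phi>) \<in> atlas M" "V \<subseteq> U" for U \<phi> V
    by (rule whitney_chart_image[OF M that(1) k that(2)])
  fix U \<phi> V \<psi> j assume U: "(U, \<phi>) \<in> atlas M" and V: "(V, \<psi>) \<in> atlas M" and j: "j < ?N"
  let ?X = "cyl ?n ?N (\<phi> ` (U \<inter> V))"
  have X: "openin (Euclidean_space ?N) ?X" by (rule openin_cyl[OF chart_overlap_open[OF M U V] nN])
  show "\<exists>g. smooth_fun_on ?N ?X g \<and> (\<forall>vs\<in>whitney_dom M k (U \<inter> V). whitney_chart M k \<psi> vs j = g (whitney_chart M k \<phi> vs))"
    using j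
  proof (cases rule: block_cases)
    case 1
    have "whitney_chart M k \<psi> vs j = \<psi> (inv_into U \<phi> (trunc ?n (whitney_chart M k \<phi> vs))) j"
      if "vs \<in> whitney_dom M k (U \<inter> V)" for vs
      using that trunc_whitney_chart[OF M U, of vs k] chart_inv[OF M U] whitney_chart_base[OF 1]
      by (simp add: mem_whitney_dom[OF k])
    then show ?thesis using smooth_fun_on_trunc[OF chart_transition[OF M U V 1] nN] by blast
  next
    case (2 m i)
    let ?f = "\<lambda>y. \<psi> (inv_into U \<phi> y) i"
    \<comment> \<open>Fibre blocks transform by the Jacobian of the transition function of
      \<open>M\<close>, evaluated at the base block.\<close>
    let ?g = "\<lambda>x. \<Sum>l<?n. x (Suc m * ?n + l) * partial_deriv l ?f (trunc ?n x)"
    have "smooth_fun_on ?N ?X ?g"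
      using smooth_fun_on_trunc[OF smooth_fun_on_partial_deriv[OF chart_transition[OF M U V 2(2)]] nN]
      by (intro smooth_fun_on_sum[OF X] smooth_fun_on_mult smooth_fun_on_coord[OF X]) simp
    moreover have "whitney_chart M k \<psi> vs j = ?g (whitney_chart M k \<phi> vs)" if "vs \<in> whitney_dom M k (U \<inter> V)" for vs
    proof -
      have vs: "whitney_proj vs \<in> U" "whitney_proj vs \<in> V" "vs ! m \<in> tangent_space M (whitney_proj vs)"
        using that 2(1) by (simp_all add: mem_whitney_dom[OF k])
      show ?thesis
        unfolding 2(3) whitney_chart_fibre[OF 2(2,1)] tangent_coord_transition[OF M U V vs 2(2)] trunc_whitney_chart[OF M U vs(1)]
        using whitney_chart_fibre[OF _ 2(1), of _ M \<phi> vs] by simp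
    qed
    ultimately show ?thesis by blast
  qed
qed

section \<open>Restrictions, products with Euclidean spaces, and local criteria\<close>

lemma mdim_restrict_mfd [simp]: "mdim (restrict_mfd M W) = mdim M"
  by (simp add: restrict_mfd_def)

lemma atlas_restrict_mfd: "atlas (restrict_mfd M W) = {(U \<inter> W, \<phi>) | U \<phi>. (U, \<phi>) \<in> atlas M}"
  by (simp add: restrict_mfd_def)

lemma points_restrict_mfd: "points (restrict_mfd M W) = points M \<inter> W"
  unfolding points_def atlas_restrict_mfd by blast

lemma smooth_atlas_restrict_mfd:
  assumes M: "smooth_atlas M" and W: "\<And>U \<phi>. (U, \<phi>) \<in> atlas M \<Longrightarrow> openin (Euclidean_space (mdim M)) (\<phi> ` (U \<inter> W))"
  shows "smooth_atlas (restrict_mfd M W)"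
proof -
  have op: "openin (Euclidean_space (mdim M)) (\<phi> ` ((U \<inter> W) \<inter> (V \<inter> W)))"
    if U: "(U, \<phi>) \<in> atlas M" and V: "(V, \<psi>) \<in> atlas M" for U \<phi> V \<psi>
  proof -
    have "\<phi> ` ((U \<inter> W) \<inter> (V \<inter> W)) = \<phi> ` (U \<inter> V) \<inter> \<phi> ` (U \<inter> W)"
      using chart_inj[OF M U] by (auto simp: inj_on_def)
    then show ?thesis using openin_Int[OF chart_overlap_open[OF M U V] W[OF U]] by simp
  qed
  have sm: "smooth_fun_on (mdim M) (\<phi> ` ((U \<inter> W) \<inter> (V \<inter> W))) (\<lambda>x. \<psi> (inv_into (U \<inter> W) \<phi> x) j)"
    if U: "(U, \<phi>) \<in> atlas M" and V: "(V, \<psi>) \<in> atlas M" and j: "j < mdim M" for U \<phi> V \<psi> j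
  proof (rule smooth_fun_on_cong)
    show "smooth_fun_on (mdim M) (\<phi> ` ((U \<inter> W) \<inter> (V \<inter> W))) (\<lambda>x. \<psi> (inv_into U \<phi> x) j)"
      by (rule smooth_fun_on_subset[OF chart_transition[OF M U V j] _ op[OF U V]]) blast
    fix x assume "x \<in> \<phi> ` ((U \<inter> W) \<inter> (V \<inter> W))"
    then obtain y where y: "y \<in> U \<inter> W" "x = \<phi> y" by blast
    have "inj_on \<phi> (U \<inter> W)" using chart_inj[OF M U] by (rule inj_on_subset) simp
    then show "\<psi> (inv_into U \<phi> x) j = \<psi> (inv_into (U \<inter> W) \<phi> x) j"
      using y chart_inv[OF M U] by simp
  qed
  show ?thesis
    unfolding smooth_atlas_def mdim_restrict_mfd
  proof (intro conjI; clarify)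
    fix U' \<phi> assume "(U', \<phi>) \<in> atlas (restrict_mfd M W)"
    then obtain U where U: "(U, \<phi>) \<in> atlas M" "U' = U \<inter> W" unfolding atlas_restrict_mfd by blast
    show "inj_on \<phi> U' \<and> openin (Euclidean_space (mdim M)) (\<phi> ` U')"
      using inj_on_subset[OF chart_inj[OF M U(1)], of "U \<inter> W"] W[OF U(1)] U(2) by simp
  next
    fix U' \<phi> V' \<psi> j assume "(U', \<phi>) \<in> atlas (restrict_mfd M W)" "(V', \<psi>) \<in> atlas (restrict_mfd M W)" "j < mdim M"
    then show "smooth_fun_on (mdim M) (\<phi> ` (U' \<inter> V')) (\<lambda>x. \<psi> (inv_into U' \<phi> x) j)"
      unfolding atlas_restrict_mfd using sm by blast
  next
    fix U' \<phi> V' \<psi> assume "(U', \<phi>) \<in> atlas (restrict_mfd M W)" "(V', \<psi>) \<in> atlas (restrict_mfd M W)"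
    then show "openin (Euclidean_space (mdim M)) (\<phi> ` (U' \<inter> V'))"
      unfolding atlas_restrict_mfd using op by blast
  qed
qed

definition times_chart :: "nat \<Rightarrow> ('a \<Rightarrow> nat \<Rightarrow> real) \<Rightarrow> 'a \<times> (nat \<Rightarrow> real) \<Rightarrow> nat \<Rightarrow> real" where
  "times_chart n \<phi> = (\<lambda>(x, a) j. if j < n then \<phi> x j else a (j - n))"

lemma mdim_times_euclidean [simp]: "mdim (times_euclidean M r) = mdim M + r"
  by (simp add: times_euclidean_def)

lemma atlas_times_euclidean:
  "atlas (times_euclidean M r) = {(U \<times> esp r, times_chart (mdim M) \<phi>) | U \<phi>. (U, \<phi>) \<in> atlas M}"
  by (simp add: times_euclidean_def times_chart_def)

lemma points_times_euclidean: "points (times_euclidean M r) = points M \<times> esp r"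
  unfolding points_def atlas_times_euclidean by blast

lemma times_chart_image:
  assumes M: "smooth_atlas M" and U: "(U, \<phi>) \<in> atlas M" and VU: "V \<subseteq> U"
  shows "times_chart (mdim M) \<phi> ` (V \<times> esp r) = cyl (mdim M) (mdim M + r) (\<phi> ` V)"
proof
  have tr: "trunc (mdim M) (times_chart (mdim M) \<phi> (x, a)) = \<phi> x" if "x \<in> U" for x a
    using chart_esp[OF M U that] by (auto simp: trunc_def times_chart_def mem_esp fun_eq_iff)
  have es: "times_chart (mdim M) \<phi> (x, a) \<in> esp (mdim M + r)" if "a \<in> esp r" for x a
    using that by (auto simp: times_chart_def mem_esp)
  show "times_chart (mdim M) \<phi> ` (V \<times> esp r) \<subseteq> cyl (mdim M) (mdim M + r) (\<phi> ` V)"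
    using tr es VU by (auto simp: cyl_def)
  show "cyl (mdim M) (mdim M + r) (\<phi> ` V) \<subseteq> times_chart (mdim M) \<phi> ` (V \<times> esp r)"
  proof
    fix z assume z: "z \<in> cyl (mdim M) (mdim M + r) (\<phi> ` V)"
    then obtain x where x: "x \<in> V" "trunc (mdim M) z = \<phi> x" by (auto simp: cyl_def)
    have "z = times_chart (mdim M) \<phi> (x, \<lambda>j. z (mdim M + j))"
      unfolding times_chart_def by (auto simp: fun_eq_iff simp flip: x(2))
    moreover have "(\<lambda>j. z (mdim M + j)) \<in> esp r" using z by (auto simp: cyl_def mem_esp)
    ultimately show "z \<in> times_chart (mdim M) \<phi> ` (V \<times> esp r)" using x(1) by blast
  qed
qed

lemma times_chart_inj:
  assumes M: "smooth_atlas M" and U: "(U, \<phi>) \<in> atlas M"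
  shows "inj_on (times_chart (mdim M) \<phi>) (U \<times> esp r)"
proof (rule inj_onI, clarify)
  fix x a y b assume x: "x \<in> U" and y: "y \<in> U" and eq: "times_chart (mdim M) \<phi> (x, a) = times_chart (mdim M) \<phi> (y, b)"
  have "\<phi> x j = \<phi> y j" for j
    using fun_cong[OF eq, of j] chart_esp[OF M U x] chart_esp[OF M U y]
    by (cases "j < mdim M") (auto simp: times_chart_def mem_esp)
  then have "\<phi> x = \<phi> y" by (rule ext)
  then have "x = y" using x y chart_inj[OF M U] by (auto simp: inj_on_def)
  moreover have "a j = b j" for j using fun_cong[OF eq, of "mdim M + j"] by (simp add: times_chart_def)
  ultimately show "x = y \<and> a = b" by blast
qed

lemma smooth_atlas_times_euclidean:
  assumes M: "smooth_atlas M" shows "smooth_atlas (times_euclidean M r)"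
proof (rule smooth_atlas_cylI[OF M _ atlas_times_euclidean _ times_chart_inj[OF M]], unfold mdim_times_euclidean)
  let ?n = "mdim M" and ?N = "mdim M + r"
  show nN: "?n \<le> ?N" by simp
  show "(U \<times> esp r) \<inter> (V \<times> esp r) = (U \<inter> V) \<times> esp r" for U V :: "'a set" by blast
  show "times_chart ?n \<phi> ` (V \<times> esp r) = cyl ?n ?N (\<phi> ` V)" if "(U, \<phi>) \<in> atlas M" "V \<subseteq> U" for U \<phi> V
    by (rule times_chart_image[OF M that])
  fix U \<phi> V \<psi> j assume U: "(U, \<phi>) \<in> atlas M" and V: "(V, \<psi>) \<in> atlas M" and j: "j < ?N"
  let ?X = "cyl ?n ?N (\<phi> ` (U \<inter> V))"
  have X: "openin (Euclidean_space ?N) ?X" by (rule openin_cyl[OF chart_overlap_open[OF M U V] nN])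
  show "\<exists>g. smooth_fun_on ?N ?X g \<and> (\<forall>z\<in>(U \<inter> V) \<times> esp r. times_chart ?n \<psi> z j = g (times_chart ?n \<phi> z))"
  proof (cases "j < ?n")
    case True
    have "times_chart ?n \<psi> (x, a) j = \<psi> (inv_into U \<phi> (trunc ?n (times_chart ?n \<phi> (x, a)))) j" if "x \<in> U" for x a
    proof -
      have "trunc ?n (times_chart ?n \<phi> (x, a)) = \<phi> x"
        using chart_esp[OF M U that] by (auto simp: trunc_def times_chart_def mem_esp fun_eq_iff)
      then show ?thesis using chart_inv[OF M U that] True by (simp add: times_chart_def)
    qed
    then show ?thesis using smooth_fun_on_trunc[OF chart_transition[OF M U V True] nN] by blast
  next
    case False
    then show ?thesis
      using smooth_fun_on_coord[OF X, of j] by (intro exI[of _ "\<lambda>x. x j"]) (simp add: times_chart_def split_beta)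
  qed
qed

text \<open>Because the image of \<open>U\<close> is exactly \<open>V\<close>, the global inverse
  maps \<open>V\<close> into \<open>U\<close>; so one local statement, with both coordinate
  expressions, gives smoothness in both directions.\<close>

lemma diffeomorphism_local:
  assumes E: "smooth_atlas E" and N: "smooth_atlas N" and dim: "mdim N = mdim E"
    and bij: "bij_betw F (points E) (points N)"
    and loc: "\<And>x. x \<in> points E \<Longrightarrow> \<exists>U \<phi> V \<psi> S T. (U, \<phi>) \<in> atlas E \<and> (V, \<psi>) \<in> atlas N \<and> x \<in> U \<and> F ` U = V \<and>
       (\<forall>j<mdim E. smooth_fun_on (mdim E) (\<phi> ` U) (\<lambda>y. T y j)) \<and>
       (\<forall>j<mdim E. smooth_fun_on (mdim E) (\<psi> ` V) (\<lambda>y. S y j)) \<and>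
       (\<forall>u\<in>U. \<psi> (F u) = T (\<phi> u) \<and> S (\<psi> (F u)) = \<phi> u)"
  shows "diffeomorphism E N F"
  unfolding diffeomorphism_def
proof (intro conjI bij)
  show "smooth_map E N F"
  proof (rule smooth_map_local[OF E N])
    fix x assume "x \<in> points E"
    from loc[OF this] obtain U \<phi> V \<psi> S T where *: "(U, \<phi>) \<in> atlas E" "(V, \<psi>) \<in> atlas N" "x \<in> U" "F ` U = V"
      "\<forall>j<mdim E. smooth_fun_on (mdim E) (\<phi> ` U) (\<lambda>y. T y j)" "\<forall>u\<in>U. \<psi> (F u) = T (\<phi> u) \<and> S (\<psi> (F u)) = \<phi> u"
      by (elim exE conjE)
    have "smooth_fun_on (mdim E) (\<phi> ` U) (\<lambda>y. \<psi> (F (inv_into U \<phi> y)) j)" if "j < mdim N" for j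
    proof (rule smooth_fun_on_cong)
      show "smooth_fun_on (mdim E) (\<phi> ` U) (\<lambda>y. T y j)" using *(5) that dim by simp
      show "T y j = \<psi> (F (inv_into U \<phi> y)) j" if "y \<in> \<phi> ` U" for y
        using that *(6) chart_inv[OF E *(1)] by auto
    qed
    then show "\<exists>U \<phi> V \<psi>. (U, \<phi>) \<in> atlas E \<and> (V, \<psi>) \<in> atlas N \<and> x \<in> U \<and> F ` U \<subseteq> V \<and>
       (\<forall>j<mdim N. smooth_fun_on (mdim E) (\<phi> ` U) (\<lambda>y. \<psi> (F (inv_into U \<phi> y)) j))"
      using * by blast
  qed
  let ?G = "inv_into (points E) F"
  have inj: "inj_on F (points E)" using bij by (simp add: bij_betw_def)
  show "smooth_map N E ?G"
  proof (rule smooth_map_local[OF N E])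
    fix y assume "y \<in> points N"
    then obtain x where x: "x \<in> points E" "y = F x" using bij by (auto simp: bij_betw_def)
    from loc[OF x(1)] obtain U \<phi> V \<psi> S T where *: "(U, \<phi>) \<in> atlas E" "(V, \<psi>) \<in> atlas N" "x \<in> U" "F ` U = V"
      "\<forall>j<mdim E. smooth_fun_on (mdim E) (\<psi> ` V) (\<lambda>y. S y j)" "\<forall>u\<in>U. \<psi> (F u) = T (\<phi> u) \<and> S (\<psi> (F u)) = \<phi> u"
      by (elim exE conjE)
    have GF: "?G (F u) = u" if "u \<in> U" for u
      using that chart_points[OF *(1)] by (intro inv_into_f_f[OF inj])
    have "smooth_fun_on (mdim N) (\<psi> ` V) (\<lambda>y. \<phi> (?G (inv_into V \<psi> y)) j)" if "j < mdim E" for j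
    proof (rule smooth_fun_on_cong)
      show "smooth_fun_on (mdim N) (\<psi> ` V) (\<lambda>y. S y j)" using *(5) that dim by simp
      fix z assume "z \<in> \<psi> ` V"
      then obtain u where "u \<in> U" "z = \<psi> (F u)" using *(4) by blast
      then show "S z j = \<phi> (?G (inv_into V \<psi> z)) j"
        using *(4,6) GF chart_inv[OF N *(2), of "F u"] by auto
    qed
    moreover have "?G ` V \<subseteq> U" using GF *(4) by auto
    moreover have "y \<in> V" using *(3,4) x(2) by blast
    ultimately show "\<exists>V \<psi> U \<phi>. (V, \<psi>) \<in> atlas N \<and> (U, \<phi>) \<in> atlas E \<and> y \<in> V \<and> ?G ` V \<subseteq> U \<and>
       (\<forall>j<mdim E. smooth_fun_on (mdim N) (\<psi> ` V) (\<lambda>y. \<phi> (?G (inv_into V \<psi> y)) j))"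
      using * by blast
  qed
qed

text \<open>The axioms hold in \<open>esp r\<close> and are pulled back along the injective
  \<open>g\<close>. Zero is the preimage of the zero sequence, and \<open>smul (-1) v\<close> serves
  as the negative of \<open>v\<close>.\<close>

lemma real_vector_space_on_transport:
  assumes g: "bij_betw g V (esp r)"
    and add: "\<And>u w. u \<in> V \<Longrightarrow> w \<in> V \<Longrightarrow> add u w \<in> V \<and> g (add u w) = (\<lambda>i. g u i + g w i)"
    and smul: "\<And>c u. u \<in> V \<Longrightarrow> smul c u \<in> V \<and> g (smul c u) = (\<lambda>i. c * g u i)"
  shows "real_vector_space_on V add smul"
proof -
  have eq: "u = w" if "u \<in> V" "w \<in> V" "g u = g w" for u w
    using g that by (auto simp: bij_betw_def inj_on_def)
  have sur: "\<exists>u\<in>V. g u = a" if "a \<in> esp r" for a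
  proof -
    have "a \<in> g ` V" using g that by (simp add: bij_betw_def)
    then show ?thesis by blast
  qed
  have gE: "g u \<in> esp r" if "u \<in> V" for u using g that by (auto simp: bij_betw_def)
  have "(\<lambda>_. 0) \<in> esp r" by (simp add: mem_esp)
  then obtain z where z: "z \<in> V" "g z = (\<lambda>_. 0)" using sur by blast
  have neg: "\<exists>w\<in>V. add v w = z" if v: "v \<in> V" for v
  proof (rule bexI)
    show "smul (-1) v \<in> V" using smul v by blast
    then show "add v (smul (-1) v) = z"
      using add smul v z by (intro eq) simp_all
  qed
  have zero: "add z v = v" if "v \<in> V" for v
    using add z that by (intro eq) simp_all
  show ?thesis
    unfolding real_vector_space_on_def
  proof (intro conjI ballI allI)
    show "\<exists>z\<in>V. \<forall>v\<in>V. add z v = v \<and> (\<exists>w\<in>V. add v w = z)"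
      using z(1) zero neg by blast
  qed (use add smul in \<open>auto intro!: eq simp: fun_eq_iff algebra_simps\<close>)
qed


section \<open>Triangular maps\<close>

definition tri_map :: "nat \<Rightarrow> (nat \<Rightarrow> real) \<Rightarrow> (nat \<Rightarrow> (nat \<Rightarrow> real) \<Rightarrow> real) \<Rightarrow> (nat \<Rightarrow> real) \<Rightarrow> nat \<Rightarrow> real" where
  "tri_map m c h x j = (if j < m then c j * x j + h j x else 0)"

text \<open>Forward substitution. Padding the solved coordinates with 0 loses nothing when
  \<open>h j\<close> looks only at indices below \<open>j\<close>.\<close>

function tri_solve :: "(nat \<Rightarrow> real) \<Rightarrow> (nat \<Rightarrow> (nat \<Rightarrow> real) \<Rightarrow> real) \<Rightarrow> (nat \<Rightarrow> real) \<Rightarrow> nat \<Rightarrow> real" where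
  "tri_solve c h y j = (y j - h j (\<lambda>i. if i < j then tri_solve c h y i else 0)) / c j"
  by pat_completeness auto
termination by (relation "Wellfounded.measure (\<lambda>(c, h, y, j). j)") auto

declare tri_solve.simps [simp del]

text \<open>The first \<open>n\<close> coordinates are those of the base. The map is the identity on
  them, so that it preserves the cylinder over \<open>A\<close> even though \<open>A\<close> itself
  is an arbitrary open set.\<close>

locale triangular =
  fixes n m :: nat and A :: "(nat \<Rightarrow> real) set" and c :: "nat \<Rightarrow> real" and h :: "nat \<Rightarrow> (nat \<Rightarrow> real) \<Rightarrow> real"
  assumes A: "openin (Euclidean_space n) A" and nm: "n \<le> m"
    and c_base: "\<And>j. j < n \<Longrightarrow> c j = 1" and h_base: "\<And>j x. j < n \<Longrightarrow> h j x = 0"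
    and c_nz: "\<And>j. j < m \<Longrightarrow> c j \<noteq> 0"
    and h_smooth: "\<And>j. n \<le> j \<Longrightarrow> j < m \<Longrightarrow> smooth_fun_on m (cyl n m A) (h j)"
    and h_depends: "\<And>j x y. n \<le> j \<Longrightarrow> j < m \<Longrightarrow> (\<And>i. i < j \<Longrightarrow> x i = y i) \<Longrightarrow> h j x = h j y"
begin

definition tri_inv :: "(nat \<Rightarrow> real) \<Rightarrow> nat \<Rightarrow> real" where
  "tri_inv y j = (if j < m then tri_solve c h y j else 0)"

lemma openin_dom: "openin (Euclidean_space m) (cyl n m A)"
  by (rule openin_cyl[OF A nm])

lemma h_depends': "j < m \<Longrightarrow> (\<And>i. i < j \<Longrightarrow> x i = y i) \<Longrightarrow> h j x = h j y"
  using h_depends[of j x y] h_base[of j] by (cases "j < n") simp_all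

lemma tri_map_smooth: "j < m \<Longrightarrow> smooth_fun_on m (cyl n m A) (\<lambda>x. tri_map m c h x j)"
proof -
  assume j: "j < m"
  have "smooth_fun_on m (cyl n m A) (h j)"
  proof (cases "j < n")
    case True
    then have "h j = (\<lambda>x. 0)" using h_base by (simp add: fun_eq_iff)
    then show ?thesis using smooth_fun_on_const[OF openin_dom] by simp
  qed (use h_smooth j in simp)
  then have "smooth_fun_on m (cyl n m A) (\<lambda>x. c j * x j + h j x)"
    by (intro smooth_fun_on_add smooth_fun_on_cmult smooth_fun_on_coord[OF openin_dom])
  then show ?thesis using j by (simp add: tri_map_def)
qed

lemma tri_solve_base: "j < n \<Longrightarrow> tri_solve c h y j = y j"
  by (simp add: tri_solve.simps c_base h_base)

lemma tri_inv_map: "x \<in> cyl n m A \<Longrightarrow> tri_inv (tri_map m c h x) = x"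
proof -
  assume x: "x \<in> cyl n m A"
  have "tri_solve c h (tri_map m c h x) j = x j" if "j < m" for j
    using that
  proof (induction j rule: less_induct)
    case (less j)
    have "h j (\<lambda>i. if i < j then tri_solve c h (tri_map m c h x) i else 0) = h j x"
      using less by (intro h_depends') auto
    then show ?case
      using c_nz[OF less.prems] less.prems by (simp add: tri_solve.simps[of _ _ _ j] tri_map_def[of _ _ _ _ j])
  qed
  then show ?thesis using x by (auto simp: tri_inv_def fun_eq_iff cyl_def mem_esp)
qed

lemma tri_inv_cyl: "y \<in> cyl n m A \<Longrightarrow> tri_inv y \<in> cyl n m A"
proof -
  have "trunc n (tri_inv y) = trunc n y"
    using nm by (intro trunc_eqI) (simp add: tri_inv_def tri_solve_base)
  then show "y \<in> cyl n m A \<Longrightarrow> tri_inv y \<in> cyl n m A"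
    by (simp add: cyl_def mem_esp) (simp add: tri_inv_def)
qed

lemma tri_map_inv: "y \<in> cyl n m A \<Longrightarrow> tri_map m c h (tri_inv y) = y"
proof
  fix j assume y: "y \<in> cyl n m A"
  show "tri_map m c h (tri_inv y) j = y j"
  proof (cases "j < m")
    case True
    have "h j (tri_inv y) = h j (\<lambda>i. if i < j then tri_solve c h y i else 0)"
      using True by (intro h_depends') (auto simp: tri_inv_def)
    then show ?thesis
      using True c_nz by (simp add: tri_map_def tri_inv_def tri_solve.simps[of _ _ _ j])
  next
    case False
    then show ?thesis using y by (simp add: tri_map_def cyl_def mem_esp)
  qed
qed

text \<open>Induction along the substitution: each coordinate of the inverse is built from
  \<open>h j\<close> and the coordinates already known to be smooth.\<close>

lemma tri_inv_smooth: "j < m \<Longrightarrow> smooth_fun_on m (cyl n m A) (\<lambda>y. tri_inv y j)"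
proof (induction j rule: less_induct)
  case (less j)
  have eq: "(\<lambda>y. tri_inv y j) = (\<lambda>y. (y j - h j (\<lambda>i. if i < j then tri_inv y i else 0)) / c j)"
    using less.prems by (auto simp: fun_eq_iff tri_inv_def tri_solve.simps[of _ _ _ j] cong: if_cong intro!: arg_cong[of _ _ "h j"])
  have "smooth_fun_on m (cyl n m A) (\<lambda>y. h j (\<lambda>i. if i < j then tri_inv y i else 0))"
  proof (cases "j < n")
    case True
    then show ?thesis using smooth_fun_on_const[OF openin_dom] by (simp add: h_base)
  next
    case False
    then have hj: "smooth_fun_on m (cyl n m A) (h j)" using less.prems h_smooth by simp
    show ?thesis
    proof (rule smooth_fun_on_compose[OF hj openin_dom])
      show "smooth_fun_on m (cyl n m A) (\<lambda>y. if i < j then tri_inv y i else 0)" if "i < m" for i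
        using that less.IH smooth_fun_on_const[OF openin_dom] by (cases "i < j") simp_all
      \<comment> \<open>As \<open>n \<le> j\<close>, the padded vector contains all base
        coordinates, which \<open>tri_inv\<close> leaves unchanged; so it stays in the domain of
        smoothness of \<open>h j\<close>.\<close>
      show "(\<lambda>y i. if i < j then tri_inv y i else 0) \<in> cyl n m A \<rightarrow> cyl n m A"
      proof
        fix y assume y: "y \<in> cyl n m A"
        have "trunc n (\<lambda>i. if i < j then tri_inv y i else 0) = trunc n y"
          using False nm by (intro trunc_eqI) (simp add: tri_inv_def tri_solve_base)
        then show "(\<lambda>i. if i < j then tri_inv y i else 0) \<in> cyl n m A"
          using y less.prems by (simp add: cyl_def mem_esp)
      qed
    qed
  qed
  then show ?case unfolding eq by (intro smooth_fun_on_divide smooth_fun_on_diff smooth_fun_on_coord[OF openin_dom])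
qed

end

section \<open>Connection towers in coordinates\<close>

lemma connection_component_tangent:
  assumes M: "smooth_atlas M" and K: "connection_map M k K" and \<mu>: "1 \<le> \<mu>" "\<mu> \<le> k"
    and v: "v \<in> tangent_space (jet_bundle M k) u"
  shows "K \<mu> v \<in> tangent_space M (jet_base u)"
    "w \<in> tangent_space (jet_bundle M k) u \<Longrightarrow> K \<mu> (tangent_add (jet_bundle M k) v w) = tangent_add M (K \<mu> v) (K \<mu> w)"
proof -
  have "u \<in> points (jet_bundle M k)" by (rule tangent_space_points[OF smooth_atlas_jet_bundle[OF M] v])
  then have "tangent_linear (jet_bundle M k) u M (jet_base u) (K \<mu>)"
    using K \<mu> unfolding connection_map_def by simp
  then show "K \<mu> v \<in> tangent_space M (jet_base u)"
    "w \<in> tangent_space (jet_bundle M k) u \<Longrightarrow> K \<mu> (tangent_add (jet_bundle M k) v w) = tangent_add M (K \<mu> v) (K \<mu> w)"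
    using v unfolding tangent_linear_def by blast+
qed

lemma tangent_map_jet_base_coord:
  assumes M: "smooth_atlas M" and U: "(U, \<phi>) \<in> atlas M" and u: "u \<in> jet_dom M k U"
    and v: "v \<in> tangent_space (jet_bundle M k) u"
  shows "tangent_map M jet_base v \<in> tangent_space M (jet_base u)"
    "\<And>i. i < mdim M \<Longrightarrow> tangent_coord \<phi> (tangent_map M jet_base v) i = tangent_coord (jet_chart M k \<phi>) v i"
proof -
  have E: "smooth_atlas (jet_bundle M k)" by (rule smooth_atlas_jet_bundle[OF M])
  have im: "jet_base ` jet_dom M k U \<subseteq> U" by (auto simp: mem_jet_dom[OF M])
  have le: "mdim M \<le> mdim (jet_bundle M k)" by (simp add: mult_Suc)
  have pr: "\<phi> (jet_base x) j = jet_chart M k \<phi> x j" if "x \<in> jet_dom M k U" "j < mdim M" for x j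
    using trunc_jet_chart[OF M U that(1)] that(2) by (metis trunc_apply(1))
  show "tangent_map M jet_base v \<in> tangent_space M (jet_base u)"
    "\<And>i. i < mdim M \<Longrightarrow> tangent_coord \<phi> (tangent_map M jet_base v) i = tangent_coord (jet_chart M k \<phi>) v i"
    using tangent_map_coord[OF E M jet_bundle_chart[OF U] U im le pr v u] by blast+
qed

lemma tangent_map_jet_proj_coord:
  assumes M: "smooth_atlas M" and U: "(U, \<phi>) \<in> atlas M" and u: "u \<in> jet_dom M k U" and \<mu>: "\<mu> \<le> k"
    and v: "v \<in> tangent_space (jet_bundle M k) u"
  shows "tangent_map (jet_bundle M \<mu>) (jet_proj M \<mu>) v \<in> tangent_space (jet_bundle M \<mu>) (jet_proj M \<mu> u)"
    "\<And>j. j < Suc \<mu> * mdim M \<Longrightarrow> tangent_coord (jet_chart M \<mu> \<phi>) (tangent_map (jet_bundle M \<mu>) (jet_proj M \<mu>) v) j =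
       tangent_coord (jet_chart M k \<phi>) v j"
proof -
  have E: "smooth_atlas (jet_bundle M k)" and B: "smooth_atlas (jet_bundle M \<mu>)" by (rule smooth_atlas_jet_bundle[OF M])+
  have im: "jet_proj M \<mu> ` jet_dom M k U \<subseteq> jet_dom M \<mu> U" using jet_proj_dom(1)[OF M] by blast
  have le: "mdim (jet_bundle M \<mu>) \<le> mdim (jet_bundle M k)" using \<mu> by simp
  have pr: "jet_chart M \<mu> \<phi> (jet_proj M \<mu> x) j = jet_chart M k \<phi> x j" if "x \<in> jet_dom M k U" "j < mdim (jet_bundle M \<mu>)" for x j
    using jet_chart_jet_proj[OF M U that(1) \<mu>] that(2) by simp
  note * = tangent_map_coord[OF E B jet_bundle_chart[OF U] jet_bundle_chart[OF U] im le pr v u]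
  show "tangent_map (jet_bundle M \<mu>) (jet_proj M \<mu>) v \<in> tangent_space (jet_bundle M \<mu>) (jet_proj M \<mu> u)"
    by (rule *(1))
  show "\<And>j. j < Suc \<mu> * mdim M \<Longrightarrow> tangent_coord (jet_chart M \<mu> \<phi>) (tangent_map (jet_bundle M \<mu>) (jet_proj M \<mu>) v) j =
       tangent_coord (jet_chart M k \<phi>) v j"
    by (rule *(2)) simp_all
qed

text \<open>Each application of \<open>almost_tangent\<close> lowers the index of \<open>K\<close>
  by one, and the last one turns \<open>K 1\<close> into the tangent map of the projection.\<close>

lemma connection_power:
  assumes M: "smooth_atlas M" and K: "connection_map M k K" and v: "v \<in> tangent_space (jet_bundle M k) u"
    and \<mu>: "1 \<le> \<mu>" "\<mu> \<le> k"
  shows "K \<mu> ((almost_tangent M k ^^ \<mu>) v) = tangent_map M jet_base v"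
proof -
  have inT: "(almost_tangent M k ^^ \<mu>) v \<in> tangent_space (jet_bundle M k) u" for \<mu>
    by (induction \<mu>) (simp_all add: v almost_tangent_coord(1)[OF M])
  then have pts: "(almost_tangent M k ^^ \<mu>) v \<in> points (tangent_bundle (jet_bundle M k))" for \<mu>
    by (simp add: mem_tangent_space)
  show ?thesis
    using \<mu>
  proof (induction \<mu>)
    case (Suc \<mu>)
    show ?case
    proof (cases "\<mu> = 0")
      case True
      then show ?thesis using K pts[of 0] unfolding connection_map_def by simp
    next
      case False
      then have "K (Suc \<mu>) (almost_tangent M k ((almost_tangent M k ^^ \<mu>) v)) = K \<mu> ((almost_tangent M k ^^ \<mu>) v)"
        using K pts[of \<mu>] Suc.prems unfolding connection_map_def by simp
      then show ?thesis using Suc False by simp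
    qed
  qed simp
qed

text \<open>A vector whose first \<mu> blocks vanish is the \<mu>-fold shift of some
  \<open>w\<close>. So \<open>K \<mu>\<close> sends it to the projection of \<open>w\<close>, which
  is block 0 of \<open>w\<close> and hence block \<mu> of \<open>v\<close>.\<close>

lemma connection_top_block:
  assumes M: "smooth_atlas M" and K: "connection_map M k K" and \<mu>: "1 \<le> \<mu>" "\<mu> \<le> k"
    and U: "(U, \<phi>) \<in> atlas M" and u: "u \<in> jet_dom M k U" and v: "v \<in> tangent_space (jet_bundle M k) u"
    and low: "\<And>l. l < \<mu> * mdim M \<Longrightarrow> tangent_coord (jet_chart M k \<phi>) v l = 0" and i: "i < mdim M"
  shows "tangent_coord \<phi> (K \<mu> v) i = tangent_coord (jet_chart M k \<phi>) v (\<mu> * mdim M + i)"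
proof -
  let ?n = "mdim M" and ?N = "Suc k * mdim M" and ?E = "jet_bundle M k" and ?\<Phi> = "jet_chart M k \<phi>"
  have E: "smooth_atlas ?E" by (rule smooth_atlas_jet_bundle[OF M])
  note ch = jet_bundle_chart[OF U, of k]
  \<comment> \<open>The components of \<open>v\<close> moved down by \<mu> blocks, with 0 filled in
    at the top.\<close>
  obtain w where w: "w \<in> tangent_space ?E u"
    "\<And>l. l < mdim ?E \<Longrightarrow> tangent_coord ?\<Phi> w l = (if l + \<mu> * ?n < ?N then tangent_coord ?\<Phi> v (l + \<mu> * ?n) else 0)"
    by (rule tangent_vector_exists[OF E ch u, of "\<lambda>l. if l + \<mu> * ?n < ?N then tangent_coord ?\<Phi> v (l + \<mu> * ?n) else 0"]) (rule that)
  have inT: "(almost_tangent M k ^^ b) w \<in> tangent_space ?E u" for b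
    by (induction b) (simp_all add: w(1) almost_tangent_coord(1)[OF M])
  have pow: "tangent_coord ?\<Phi> ((almost_tangent M k ^^ b) w) l = (if l < b * ?n then 0 else tangent_coord ?\<Phi> w (l - b * ?n))"
    if "l < ?N" for b l
    using that
  proof (induction b arbitrary: l)
    case (Suc b)
    have "tangent_coord ?\<Phi> ((almost_tangent M k ^^ Suc b) w) l =
      (if l < ?n then 0 else tangent_coord ?\<Phi> ((almost_tangent M k ^^ b) w) (l - ?n))"
      using almost_tangent_coord(2)[OF M inT[of b] U u Suc.prems] by simp
    then show ?case
      using Suc.IH[of "l - ?n"] Suc.prems by (auto simp: mult_Suc)
  qed simp
  have "(almost_tangent M k ^^ \<mu>) w = v"
  proof (rule tangent_vector_eqI[OF E ch u inT v])
    fix l assume l: "l < mdim ?E"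
    then show "tangent_coord ?\<Phi> ((almost_tangent M k ^^ \<mu>) w) l = tangent_coord ?\<Phi> v l"
      using pow[of l \<mu>] low[of l] w(2)[of "l - \<mu> * ?n"] by auto
  qed
  then have "K \<mu> v = tangent_map M jet_base w" using connection_power[OF M K w(1) \<mu>] by simp
  then have "tangent_coord \<phi> (K \<mu> v) i = tangent_coord ?\<Phi> w i"
    using tangent_map_jet_base_coord(2)[OF M U u w(1) i] by simp
  also have "\<dots> = tangent_coord ?\<Phi> v (\<mu> * ?n + i)"
    using w(2)[of i] index_less[OF i \<mu>(2), of ?N] i by (simp add: add.commute mult_Suc)
  finally show ?thesis .
qed

text \<open>Taken on the tangent bundle of the order \<open>k\<close> jet bundle, because
  \<open>connection_map\<close> provides smoothness there, whereas \<open>tower_factor\<close> says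
  nothing about smoothness of \<open>tower_top\<close>.\<close>

definition connection_coord :: "'a mfd \<Rightarrow> nat \<Rightarrow> (nat \<Rightarrow> 'a jet jet \<Rightarrow> 'a jet) \<Rightarrow> 'a set \<Rightarrow> ('a \<Rightarrow> nat \<Rightarrow> real) \<Rightarrow>
    nat \<Rightarrow> nat \<Rightarrow> (nat \<Rightarrow> real) \<Rightarrow> real" where
  "connection_coord M k K U \<phi> \<mu> i z = tangent_coord \<phi>
     (K \<mu> (inv_into (jet_dom (jet_bundle M k) 1 (jet_dom M k U)) (jet_chart (jet_bundle M k) 1 (jet_chart M k \<phi>)) z)) i"

lemma connection_coord_jet_chart:
  assumes M: "smooth_atlas M" and U: "(U, \<phi>) \<in> atlas M" and u: "u \<in> jet_dom M k U" and v: "v \<in> tangent_space (jet_bundle M k) u"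
  shows "connection_coord M k K U \<phi> \<mu> i (jet_chart (jet_bundle M k) 1 (jet_chart M k \<phi>) v) = tangent_coord \<phi> (K \<mu> v) i"
  unfolding connection_coord_def
  using inv_into_f_f[OF jet_chart_inj[OF smooth_atlas_jet_bundle[OF M] jet_bundle_chart[OF U]]
      tangent_space_jet_dom[OF smooth_atlas_jet_bundle[OF M] v u]] by simp

text \<open>\<open>K\<close> respects base points, so it sends the chart domain over
  \<open>U\<close> into the Whitney chart domain over \<open>U\<close>. Smoothness can then be read
  off one component of the expression in these two charts.\<close>

lemma smooth_connection_coord:
  assumes M: "smooth_atlas M" and K: "connection_map M k K" and \<mu>: "1 \<le> \<mu>" "\<mu> \<le> k"
    and U: "(U, \<phi>) \<in> atlas M" and i: "i < mdim M"
  shows "smooth_fun_on (Suc 1 * (Suc k * mdim M)) (cyl (Suc k * mdim M) (Suc 1 * (Suc k * mdim M)) (cyl (mdim M) (Suc k * mdim M) (\<phi> ` U)))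
     (connection_coord M k K U \<phi> \<mu> i)"
proof -
  let ?E = "jet_bundle M k" and ?n = "mdim M" and ?f = "\<lambda>v. map (\<lambda>\<alpha>. K \<alpha> v) [1..<Suc k]"
  have E: "smooth_atlas ?E" by (rule smooth_atlas_jet_bundle[OF M])
  let ?D = "jet_dom ?E 1 (jet_dom M k U)" and ?C = "jet_chart ?E 1 (jet_chart M k \<phi>)"
  have k: "k \<ge> 1" using \<mu> by simp
  have fW: "?f v \<in> whitney_dom M k U" if v: "v \<in> ?D" for v
  proof -
    have v': "v \<in> tangent_space ?E (jet_base v)" "jet_base v \<in> jet_dom M k U"
      using v by (simp_all add: mem_tangent_space mem_jet_dom[OF E])
    have "jet_base (jet_base v) \<in> U" using v'(2) by (simp add: mem_jet_dom[OF M])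
    moreover have "?f v ! m \<in> tangent_space M (jet_base (jet_base v))" if "m < k" for m
      using connection_component_tangent(1)[OF M K _ _ v'(1), of "Suc m"] that by (simp del: upt_Suc)
    ultimately show ?thesis by (intro whitney_domI(1)[OF k]) (simp_all del: upt_Suc)
  qed
  have sm: "smooth_map (tangent_bundle ?E) (whitney_sum M k) ?f" using K unfolding connection_map_def by blast
  have dom: "?D \<inter> ?f -` whitney_dom M k U = ?D" using fW by blast
  have im: "?C ` ?D = cyl (Suc k * ?n) (Suc 1 * (Suc k * ?n)) (cyl ?n (Suc k * ?n) (\<phi> ` U))"
    using jet_chart_image[OF E jet_bundle_chart[OF U] order_refl, of 1] jet_chart_image[OF M U order_refl, of k] by simp
  have j: "\<mu> * ?n + i < mdim (whitney_sum M k)" using index_less[OF i \<mu>(2) order_refl] by simp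
  \<comment> \<open>\<open>K \<mu>\<close> is entry \<open>\<mu> - 1\<close> of the list and
    therefore occupies block \<mu>.\<close>
  have wc: "whitney_chart M k \<phi> (?f (inv_into ?D ?C z)) (\<mu> * ?n + i) = connection_coord M k K U \<phi> \<mu> i z" for z
    using whitney_chart_fibre[OF i, of "\<mu> - 1" k \<phi> "?f (inv_into ?D ?C z)"] \<mu>
    by (simp add: connection_coord_def del: upt_Suc)
  have "\<forall>j<mdim (whitney_sum M k). smooth_fun_on (mdim (tangent_bundle ?E)) (?C ` (?D \<inter> ?f -` whitney_dom M k U))
      (\<lambda>z. whitney_chart M k \<phi> (?f (inv_into ?D ?C z)) j)"
    using sm jet_bundle_chart[OF jet_bundle_chart[OF U]] whitney_sum_chart[OF U]
    unfolding smooth_map_def by fast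
  from this[rule_format, OF j] show ?thesis unfolding dom im wc mdim_jet_bundle .
qed

lemma tower_top_factor:
  assumes "connection_tower M k K" "1 \<le> \<mu>" "\<mu> \<le> k" "v \<in> points (tangent_bundle (jet_bundle M k))"
  shows "K \<mu> v = tower_top M k K \<mu> (tangent_map (jet_bundle M \<mu>) (jet_proj M \<mu>) v)"
proof -
  have "\<exists>!L. tower_factor M k K \<mu> L" using assms unfolding connection_tower_def by simp
  then have "tower_factor M k K \<mu> (tower_top M k K \<mu>)" unfolding tower_top_def by (rule theI')
  then show ?thesis using assms(4) unfolding tower_factor_def by blast
qed

text \<open>Coordinates of the tangent vector at the \<open>k\<close>-jet \<open>(x\<^sub>0, \<dots>, x\<^sub>\<mu>, 0, \<dots>)\<close> whose velocity consists
  of the components of index below \<open>b\<close> of the Tulczyjew operator.\<close>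

definition velocity_coords :: "nat \<Rightarrow> nat \<Rightarrow> nat \<Rightarrow> nat \<Rightarrow> (nat \<Rightarrow> real) \<Rightarrow> nat \<Rightarrow> real" where
  "velocity_coords n N \<mu> b x l = (if l < N then if l < Suc \<mu> * n then x l else 0
     else if l - N < b then real (Suc ((l - N) div n)) * x (l - N + n) else 0)"

text \<open>The Tulczyjew vector \<open>w\<close> lives over a \<mu>-jet, so it is lifted to a
  vector \<open>v\<close> over a \<open>k\<close>-jet \<open>u'\<close>, where
  \<open>K \<mu>\<close> is available. Linearity splits the value into the contribution of the
  blocks below \<mu> and that of block \<mu>, which is known explicitly.\<close>

lemma tower_top_coord:
  assumes M: "smooth_atlas M" and K: "connection_tower M k K" and \<mu>: "1 \<le> \<mu>" "\<mu> < \<alpha>" "\<alpha> \<le> k"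
    and U: "(U, \<phi>) \<in> atlas M" and u: "u \<in> jet_dom M \<alpha> U" and x: "x = jet_chart M \<alpha> \<phi> u"
    and w: "w = tulczyjew M (Suc \<mu>) (jet_proj M (Suc \<mu>) u)"
  shows "tower_top M k K \<mu> w \<in> tangent_space M (jet_base u)"
    "\<And>i. i < mdim M \<Longrightarrow> tangent_coord \<phi> (tower_top M k K \<mu> w) i =
       connection_coord M k K U \<phi> \<mu> i (velocity_coords (mdim M) (Suc k * mdim M) \<mu> (\<mu> * mdim M) x) +
       real (Suc \<mu>) * x (Suc \<mu> * mdim M + i)"
proof -
  let ?n = "mdim M" and ?N = "Suc k * mdim M" and ?E = "jet_bundle M k" and ?\<Phi> = "jet_chart M k \<phi>" and ?B = "jet_bundle M \<mu>"
  have Kc: "connection_map M k K" using K unfolding connection_tower_def by blast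
  have E: "smooth_atlas ?E" and B: "smooth_atlas ?B" by (rule smooth_atlas_jet_bundle[OF M])+
  note ch = jet_bundle_chart[OF U, of k] and chB = jet_bundle_chart[OF U, of \<mu>]
  have \<mu>k: "\<mu> \<le> k" using \<mu> by simp
  have \<mu>N: "Suc \<mu> * ?n \<le> ?N" using \<mu>k by (intro mult_le_mono1) simp
  have tx: "trunc ?n x = \<phi> (jet_base u)" unfolding x by (rule trunc_jet_chart[OF M U u])
  have bu: "jet_base u \<in> U" using u by (simp add: mem_jet_dom[OF M])
  have min: "min ?n (Suc \<mu> * ?n) = ?n" by (simp add: mult_Suc)
  have "trunc (Suc \<mu> * ?n) x \<in> esp ?N"
    unfolding mem_esp
  proof (intro allI impI)
    fix i assume "?N \<le> i"
    then have "\<not> i < Suc \<mu> * ?n" using \<mu>N by linarith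
    then show "trunc (Suc \<mu> * ?n) x i = 0" by simp
  qed
  then have "trunc (Suc \<mu> * ?n) x \<in> cyl ?n ?N (\<phi> ` U)"
    using tx bu by (simp add: cyl_def min)
  \<comment> \<open>Filling up with zeros makes \<open>u'\<close> depend on the blocks up to \<mu>
    of \<open>x\<close> alone.\<close>
  then obtain u' where u': "u' \<in> jet_dom M k U" "?\<Phi> u' = trunc (Suc \<mu> * ?n) x" by (rule jet_with_coords[OF M U])
  have "\<phi> (jet_base u') = \<phi> (jet_base u)"
    using trunc_jet_chart[OF M U u'(1)] u'(2) tx by (simp add: min)
  then have base: "jet_base u' = jet_base u"
    using u'(1) bu chart_inj[OF M U] by (auto simp: mem_jet_dom[OF M] inj_on_def)
  \<comment> \<open>Component \<open>l\<close> of the Tulczyjew vector: the coordinate one block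
    higher, times the index of that block.\<close>
  define a where "a l = real (Suc (l div ?n)) * x (l + ?n)" for l
  \<comment> \<open>\<open>v1\<close> involves only coordinates of blocks up to \<mu> and produces
    the remainder.\<close>
  obtain v1 where v1: "v1 \<in> tangent_space ?E u'" "\<And>l. l < mdim ?E \<Longrightarrow> tangent_coord ?\<Phi> v1 l = (if l < \<mu> * ?n then a l else 0)"
    by (rule tangent_vector_exists[OF E ch u'(1), of "\<lambda>l. if l < \<mu> * ?n then a l else 0"]) (rule that)
  \<comment> \<open>\<open>v2\<close> is block \<mu> of the velocity, the only place where block
    \<open>Suc \<mu>\<close> of \<open>x\<close> occurs. Its lower blocks vanish, so
    \<open>K \<mu>\<close> just reads it off.\<close>
  obtain v2 where v2: "v2 \<in> tangent_space ?E u'"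
    "\<And>l. l < mdim ?E \<Longrightarrow> tangent_coord ?\<Phi> v2 l = (if \<mu> * ?n \<le> l \<and> l < Suc \<mu> * ?n then a l else 0)"
    by (rule tangent_vector_exists[OF E ch u'(1), of "\<lambda>l. if \<mu> * ?n \<le> l \<and> l < Suc \<mu> * ?n then a l else 0"]) (rule that)
  define v where "v = tangent_add ?E v1 v2"
  note add = tangent_add_coord[OF E v1(1) v2(1), folded v_def]
  have pu: "jet_proj M (Suc \<mu>) u \<in> jet_dom M (Suc \<mu>) U" by (rule jet_proj_dom(1)[OF M u])
  have pchart: "jet_chart M (Suc \<mu>) \<phi> (jet_proj M (Suc \<mu>) u) = trunc (Suc (Suc \<mu>) * ?n) x"
    unfolding x using \<mu> by (intro jet_chart_jet_proj[OF M U u]) simp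
  note tul = tulczyjew_coord[OF M U pu, folded w]
  note tm = tangent_map_jet_proj_coord[OF M U u'(1) \<mu>k add(1)]
  \<comment> \<open>The vector \<open>w\<close> sits over the \<mu>-jet of \<open>u\<close>, the
    projection of \<open>v\<close> over that of \<open>u'\<close>. Both have the coordinates of
    \<open>x\<close> cut off after block \<mu>.\<close>
  have pp: "jet_proj M \<mu> (jet_proj M (Suc \<mu>) u) = jet_proj M \<mu> u'"
  proof (rule jet_chart_eq_iff[OF M U, THEN iffD1])
    show "jet_proj M \<mu> (jet_proj M (Suc \<mu>) u) \<in> jet_dom M \<mu> U" by (rule jet_proj_dom(1)[OF M pu])
    show "jet_proj M \<mu> u' \<in> jet_dom M \<mu> U" by (rule jet_proj_dom(1)[OF M u'(1)])
    have "min (Suc \<mu> * ?n) (Suc (Suc \<mu>) * ?n) = Suc \<mu> * ?n" by (simp add: mult_Suc)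
    then show "jet_chart M \<mu> \<phi> (jet_proj M \<mu> (jet_proj M (Suc \<mu>) u)) = jet_chart M \<mu> \<phi> (jet_proj M \<mu> u')"
      using jet_chart_jet_proj[OF M U pu, of \<mu>] jet_chart_jet_proj[OF M U u'(1) \<mu>k] pchart u'(2) by simp
  qed
  have "tangent_map ?B (jet_proj M \<mu>) v = w"
  proof (rule tangent_vector_eqI[OF B chB _ tm(1)])
    show "jet_proj M \<mu> u' \<in> jet_dom M \<mu> U" by (rule jet_proj_dom(1)[OF M u'(1)])
    show "w \<in> tangent_space ?B (jet_proj M \<mu> u')" using tul(1) pp by simp
    fix l assume "l < mdim ?B"
    then have l: "l < Suc \<mu> * ?n" by simp
    then obtain \<beta> i where bi: "\<beta> \<le> \<mu>" "i < ?n" "l = \<beta> * ?n + i" by (rule index_cases)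
    have lN: "l < mdim ?E" using l \<mu>N unfolding mdim_jet_bundle by linarith
    have "tangent_coord (jet_chart M \<mu> \<phi>) (tangent_map ?B (jet_proj M \<mu>) v) l = a l"
      using tm(2)[OF l] add(2)[OF ch u'(1) lN] v1(2)[OF lN] v2(2)[OF lN] l by simp
    also have "\<dots> = tangent_coord (jet_chart M \<mu> \<phi>) w l"
    proof -
      have "Suc \<beta> * ?n + i < Suc (Suc \<mu>) * ?n" using bi by (intro index_less[of i ?n "Suc \<beta>" "Suc \<mu>"]) simp_all
      moreover have "l + ?n = Suc \<beta> * ?n + i" "l div ?n = \<beta>" using bi by (simp_all add: mult_Suc)
      ultimately show ?thesis using tul(2)[OF bi(1,2)] pchart unfolding bi(3)[symmetric] a_def by simp
    qed
    finally show "tangent_coord (jet_chart M \<mu> \<phi>) (tangent_map ?B (jet_proj M \<mu>) v) l = tangent_coord (jet_chart M \<mu> \<phi>) w l" .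
  qed
  moreover have "v \<in> points (tangent_bundle ?E)" using add(1) by (simp add: mem_tangent_space)
  ultimately have Kv: "tower_top M k K \<mu> w = K \<mu> v"
    using tower_top_factor[OF K \<mu>(1) \<mu>k] by simp
  note Kt = connection_component_tangent[OF M Kc \<mu>(1) \<mu>k]
  show "tower_top M k K \<mu> w \<in> tangent_space M (jet_base u)"
    unfolding Kv using Kt(1)[OF add(1)] base by simp
  fix i assume i: "i < ?n"
  have "tower_top M k K \<mu> w = tangent_add M (K \<mu> v1) (K \<mu> v2)"
    unfolding Kv v_def by (rule Kt(2)[OF v1(1) v2(1)])
  then have "tangent_coord \<phi> (tower_top M k K \<mu> w) i = tangent_coord \<phi> (K \<mu> v1) i + tangent_coord \<phi> (K \<mu> v2) i"
    using tangent_add_coord(2)[OF M Kt(1)[OF v1(1)] Kt(1)[OF v2(1)] U _ i] base bu by simp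
  moreover have "tangent_coord \<phi> (K \<mu> v2) i = real (Suc \<mu>) * x (Suc \<mu> * ?n + i)"
  proof -
    have iN: "\<mu> * ?n + i < Suc \<mu> * ?n" using i by (simp add: mult_Suc)
    have "tangent_coord \<phi> (K \<mu> v2) i = tangent_coord ?\<Phi> v2 (\<mu> * ?n + i)"
    proof (rule connection_top_block[OF M Kc \<mu>(1) \<mu>k U u'(1) v2(1) _ i])
      fix l assume l: "l < \<mu> * ?n"
      then have "l < mdim ?E" using \<mu>N unfolding mdim_jet_bundle mult_Suc[of \<mu>] by linarith
      then show "tangent_coord ?\<Phi> v2 l = 0" using v2(2) l by simp
    qed
    also have "\<dots> = a (\<mu> * ?n + i)" using v2(2)[of "\<mu> * ?n + i"] iN order_less_le_trans[OF iN \<mu>N] by simp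
    finally show ?thesis using i by (simp add: a_def mult_Suc add_ac)
  qed
  moreover have "tangent_coord \<phi> (K \<mu> v1) i =
     connection_coord M k K U \<phi> \<mu> i (velocity_coords ?n ?N \<mu> (\<mu> * ?n) x)"
  proof -
    have "jet_chart ?E 1 ?\<Phi> v1 = velocity_coords ?n ?N \<mu> (\<mu> * ?n) x"
    proof
      fix l
      show "jet_chart ?E 1 ?\<Phi> v1 l = velocity_coords ?n ?N \<mu> (\<mu> * ?n) x l"
      proof (cases "l < ?N")
        case True
        then show ?thesis
          unfolding jet_chart_tangent[OF E ch v1(1) u'(1)] velocity_coords_def u'(2) by (simp add: trunc_def)
      next
        case False
        show ?thesis
        proof (cases "l < Suc 1 * ?N")
          case True
          then have "l - ?N < mdim ?E" using False by (simp add: mult_Suc[of 1])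
          from v1(2)[OF this] show ?thesis
            unfolding jet_chart_tangent[OF E ch v1(1) u'(1)] velocity_coords_def mdim_jet_bundle if_not_P[OF False] if_P[OF True] a_def .
        next
          case F2: False
          then have "\<not> l - ?N < \<mu> * ?n" using \<mu>N unfolding mult_Suc[of 1] mult_Suc[of \<mu>] by linarith
          then show ?thesis
            unfolding jet_chart_tangent[OF E ch v1(1) u'(1)] velocity_coords_def mdim_jet_bundle if_not_P[OF False] if_not_P[OF F2]
            by simp
        qed
      qed
    qed
    then show ?thesis using connection_coord_jet_chart[OF M U u'(1) v1(1), of K \<mu> i] by simp
  qed
  ultimately show "tangent_coord \<phi> (tower_top M k K \<mu> w) i =
       connection_coord M k K U \<phi> \<mu> i (velocity_coords ?n ?N \<mu> (\<mu> * ?n) x) + real (Suc \<mu>) * x (Suc \<mu> * ?n + i)"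
    by simp
qed

text \<open>In the charts, \<open>F\<close> is \<open>x\<^sub>j \<mapsto> c\<^sub>j * x\<^sub>j + h\<^sub>j x\<close> with \<open>c = tower_coeff\<close> and
  \<open>h = tower_remainder\<close>.  Component \<open>\<mu> + 1\<close> of the Tulczyjew operator's argument enters \<open>K \<mu>\<close>
  with the factor \<open>\<mu> + 1\<close>, which together with \<open>fact \<mu>\<close> gives \<open>fact (\<mu> + 1)\<close>.\<close>

definition tower_remainder :: "'a mfd \<Rightarrow> nat \<Rightarrow> (nat \<Rightarrow> 'a jet jet \<Rightarrow> 'a jet) \<Rightarrow> 'a set \<Rightarrow> ('a \<Rightarrow> nat \<Rightarrow> real) \<Rightarrow>
    nat \<Rightarrow> (nat \<Rightarrow> real) \<Rightarrow> real" where
  "tower_remainder M k K U \<phi> j x = (let n = mdim M; \<mu> = j div n - 1 in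
     if j < 2 * n then 0
     else fact \<mu> * connection_coord M k K U \<phi> \<mu> (j mod n) (velocity_coords n (Suc k * n) \<mu> (\<mu> * n) x))"

definition tower_coeff :: "'a mfd \<Rightarrow> nat \<Rightarrow> real" where
  "tower_coeff M j = (if j < 2 * mdim M then 1 else fact (j div mdim M))"

text \<open>\<open>velocity_coords\<close> reads blocks up to \<mu> only, so the remainder in block
  \<open>Suc \<mu>\<close> depends on strictly earlier blocks. It is smooth as
  \<open>connection_coord\<close> after a linear selection and scaling of coordinates.\<close>

lemma triangular_tower:
  assumes M: "smooth_atlas M" and K: "connection_map M k K" and \<alpha>: "\<alpha> \<le> k" and U: "(U, \<phi>) \<in> atlas M"
  shows "triangular (mdim M) (Suc \<alpha> * mdim M) (\<phi> ` U) (tower_coeff M) (tower_remainder M k K U \<phi>)"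
proof
  let ?n = "mdim M" and ?m = "Suc \<alpha> * mdim M" and ?N = "Suc k * mdim M" and ?V = "\<lambda>\<mu>. velocity_coords (mdim M) (Suc k * mdim M) \<mu> (\<mu> * mdim M)"
  show op: "openin (Euclidean_space ?n) (\<phi> ` U)" by (rule chart_open[OF M U])
  show nm: "?n \<le> ?m" by (simp add: mult_Suc)
  show "tower_coeff M j = 1" if "j < ?n" for j using that by (simp add: tower_coeff_def)
  show "tower_remainder M k K U \<phi> j x = 0" if "j < ?n" for j x using that by (simp add: tower_remainder_def Let_def)
  show "tower_coeff M j \<noteq> 0" for j by (simp add: tower_coeff_def)
  \<comment> \<open>From index \<open>2 * n\<close> on the block number is some
    \<open>Suc \<mu>\<close> with \<mu> between 1 and \<open>k\<close>, so that
    \<open>K \<mu>\<close> is a component of the connection map.\<close>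
  have blk: "\<exists>\<mu> i. 1 \<le> \<mu> \<and> \<mu> \<le> k \<and> i < ?n \<and> Suc \<mu> * ?n \<le> j \<and> j div ?n - 1 = \<mu> \<and> j mod ?n = i"
    if j: "j < ?m" "\<not> j < 2 * ?n" for j
  proof -
    obtain b i where bi: "b \<le> \<alpha>" "i < ?n" "j = b * ?n + i" using j(1) by (rule index_cases)
    have "b \<ge> 2"
    proof (rule ccontr)
      assume "\<not> 2 \<le> b"
      then have "Suc b * ?n \<le> 2 * ?n" by (intro mult_le_mono1) simp
      then show False using j(2) bi unfolding mult_Suc[of b] by linarith
    qed
    then show ?thesis using bi \<alpha> by (intro exI[of _ "b - 1"] exI[of _ i]) auto
  qed
  have X: "openin (Euclidean_space ?m) (cyl ?n ?m (\<phi> ` U))" by (rule openin_cyl[OF op nm])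
  show "smooth_fun_on ?m (cyl ?n ?m (\<phi> ` U)) (tower_remainder M k K U \<phi> j)" if "j < ?m" for j
  proof (cases "j < 2 * ?n")
    case True
    then have "tower_remainder M k K U \<phi> j = (\<lambda>x. 0)" by (simp add: tower_remainder_def Let_def fun_eq_iff)
    then show ?thesis using smooth_fun_on_const[OF X] by simp
  next
    case False
    obtain \<mu> i where b: "1 \<le> \<mu>" "\<mu> \<le> k" "i < ?n" "j div ?n - 1 = \<mu>" "j mod ?n = i"
      using blk[OF \<open>j < ?m\<close> False] by blast
    have \<mu>N: "Suc \<mu> * ?n \<le> ?N" using b by (intro mult_le_mono1) simp
    have "smooth_fun_on ?m (cyl ?n ?m (\<phi> ` U)) (\<lambda>x. connection_coord M k K U \<phi> \<mu> i (?V \<mu> x))"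
    proof (rule smooth_fun_on_compose[OF smooth_connection_coord[OF M K b(1,2) U b(3)] X])
      show "smooth_fun_on ?m (cyl ?n ?m (\<phi> ` U)) (\<lambda>x. ?V \<mu> x l)" for l
      proof -
        note sm = smooth_fun_on_coord[OF X] smooth_fun_on_const[OF X] smooth_fun_on_cmult[OF smooth_fun_on_coord[OF X]]
        show ?thesis
          unfolding velocity_coords_def
          by (cases "l < ?N"; cases "l < Suc \<mu> * ?n"; cases "l - ?N < \<mu> * ?n"; simp only: if_True if_False sm)
      qed
      show "?V \<mu> \<in> cyl ?n ?m (\<phi> ` U) \<rightarrow> cyl ?N (Suc 1 * ?N) (cyl ?n ?N (\<phi> ` U))"
      proof
        fix x assume x: "x \<in> cyl ?n ?m (\<phi> ` U)"
        \<comment> \<open>The base block is copied unchanged, so the point stays over the same chart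
          image.\<close>
        have "trunc ?n (trunc ?N (?V \<mu> x)) = trunc ?n x"
          by (rule trunc_eqI) (simp add: velocity_coords_def mult_Suc)
        moreover have "\<mu> * ?n \<le> ?N" using \<mu>N unfolding mult_Suc[of \<mu>] by linarith
        have "?V \<mu> x \<in> esp (Suc 1 * ?N)"
          unfolding mem_esp
        proof (intro allI impI)
          fix l assume "Suc 1 * ?N \<le> l"
          then have "\<not> l < ?N" "\<not> l - ?N < \<mu> * ?n" using \<open>\<mu> * ?n \<le> ?N\<close> unfolding mult_Suc[of 1] by linarith+
          then show "?V \<mu> x l = 0" by (simp only: velocity_coords_def if_False)
        qed
        moreover have "trunc ?N (?V \<mu> x) \<in> esp ?N" by simp
        ultimately show "?V \<mu> x \<in> cyl ?N (Suc 1 * ?N) (cyl ?n ?N (\<phi> ` U))"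
          using x unfolding cyl_def by simp
      qed
    qed
    from smooth_fun_on_cmult[OF this, of "fact \<mu>"] show ?thesis
      by (rule smooth_fun_on_cong) (use False b in \<open>simp add: tower_remainder_def Let_def\<close>)
  qed
  show "tower_remainder M k K U \<phi> j x = tower_remainder M k K U \<phi> j y"
    if "j < ?m" and xy: "\<And>i. i < j \<Longrightarrow> x i = y i" for j x y
  proof (cases "j < 2 * ?n")
    case False
    obtain \<mu> i where b: "1 \<le> \<mu>" "\<mu> \<le> k" "i < ?n" "Suc \<mu> * ?n \<le> j" "j div ?n - 1 = \<mu>" "j mod ?n = i"
      using blk[OF \<open>j < ?m\<close> False] by blast
    have "?V \<mu> x = ?V \<mu> y"
    proof
      fix l
      show "?V \<mu> x l = ?V \<mu> y l"
      proof (cases "l < ?N")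
        case True
        have "x l = y l" if "l < Suc \<mu> * ?n" using that b(4) by (intro xy) linarith
        then show ?thesis using True by (simp add: velocity_coords_def)
      next
        case False
        \<comment> \<open>The velocity reads one block higher than its own index, but still below
          block \<open>Suc \<mu>\<close> and hence below \<open>j\<close>.\<close>
        have "x (l - ?N + ?n) = y (l - ?N + ?n)" if "l - ?N < \<mu> * ?n"
          using that b(4) by (intro xy) (simp add: mult_Suc)
        then show ?thesis
          unfolding velocity_coords_def if_not_P[OF False] by (cases "l - ?N < \<mu> * ?n") (simp_all only: if_True if_False)
      qed
    qed
    then show ?thesis using b by (simp add: tower_remainder_def Let_def)
  qed (simp add: tower_remainder_def Let_def)
qed

text \<open>Block 0 is the base point, and block 1 is the velocity, which the first component of
  \<open>F\<close> returns unchanged; this explains the threshold \<open>2 * mdim M\<close> with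
  coefficient 1 and remainder 0. From block 2 on the computation of \<open>tower_top\<close>
  applies.\<close>

lemma tower_F_coord:
  assumes M: "smooth_atlas M" and K: "connection_tower M k K" and \<alpha>: "1 \<le> \<alpha>" "\<alpha> \<le> k"
    and U: "(U, \<phi>) \<in> atlas M" and u: "u \<in> jet_dom M \<alpha> U"
  shows "tower_F M k K \<alpha> u \<in> whitney_dom M \<alpha> U" "whitney_proj (tower_F M k K \<alpha> u) = jet_base u"
    "whitney_chart M \<alpha> \<phi> (tower_F M k K \<alpha> u) =
       tri_map (Suc \<alpha> * mdim M) (tower_coeff M) (tower_remainder M k K U \<phi>) (jet_chart M \<alpha> \<phi> u)"
proof -
  let ?n = "mdim M" and ?x = "jet_chart M \<alpha> \<phi> u" and ?F = "tower_F M k K \<alpha> u" and ?R = "tower_remainder M k K U \<phi>"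
  have bu: "jet_base u \<in> U" using u by (simp add: mem_jet_dom[OF M])
  have len: "length ?F = \<alpha>" by (simp add: tower_F_def)
  have comp: "?F ! m \<in> tangent_space M (jet_base u) \<and>
      (\<forall>i<?n. tangent_coord \<phi> (?F ! m) i = tower_coeff M (Suc m * ?n + i) * ?x (Suc m * ?n + i) + ?R (Suc m * ?n + i) ?x)"
    if m: "m < \<alpha>" for m
  proof -
    let ?w = "tulczyjew M (Suc m) (jet_proj M (Suc m) u)"
    have pu: "jet_proj M (Suc m) u \<in> jet_dom M (Suc m) U" by (rule jet_proj_dom(1)[OF M u])
    have pchart: "jet_chart M (Suc m) \<phi> (jet_proj M (Suc m) u) = trunc (Suc (Suc m) * ?n) ?x"
      using m by (intro jet_chart_jet_proj[OF M U u]) simp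
    show ?thesis
    proof (cases "m = 0")
      case True
      have Fm: "?F ! m = tangent_map M jet_base ?w" using m True by (simp add: tower_F_def Let_def)
      note tul = tulczyjew_coord[OF M U pu]
      have base: "jet_base (jet_proj M m (jet_proj M (Suc m) u)) = jet_base u"
        using jet_proj_dom(2)[OF M pu] jet_proj_dom(2)[OF M u] by simp
      note tm = tangent_map_jet_base_coord[OF M U jet_proj_dom(1)[OF M pu] tul(1)]
      have "tangent_coord \<phi> (?F ! m) i = tower_coeff M (Suc m * ?n + i) * ?x (Suc m * ?n + i) + ?R (Suc m * ?n + i) ?x"
        if i: "i < ?n" for i
        unfolding Fm using tm(2)[OF i] tul(2)[of 0 i] pchart i True
        by (simp add: tower_coeff_def tower_remainder_def Let_def mult_Suc)
      then show ?thesis using tm(1) Fm base by simp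
    next
      case False
      then have m1: "1 \<le> m" by simp
      have Fm: "?F ! m = tangent_scale M (fact m) (tower_top M k K m ?w)" using m False by (simp add: tower_F_def Let_def)
      note tt = tower_top_coord[OF M K m1 m \<alpha>(2) U u refl refl]
      have "tangent_coord \<phi> (?F ! m) i = tower_coeff M (Suc m * ?n + i) * ?x (Suc m * ?n + i) + ?R (Suc m * ?n + i) ?x"
        if i: "i < ?n" for i
      proof -
        have dm: "(Suc m * ?n + i) div ?n = Suc m" "(Suc m * ?n + i) mod ?n = i" using i by simp_all
        have "2 * ?n \<le> Suc m * ?n" using m1 by (intro mult_le_mono1) simp
        then have nl: "\<not> Suc m * ?n + i < 2 * ?n" by linarith
        have "tangent_coord \<phi> (?F ! m) i = fact m * tangent_coord \<phi> (tower_top M k K m ?w) i"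
          unfolding Fm by (rule tangent_scale_coord(2)[OF M tt(1) U bu i])
        also have "\<dots> = fact m * (connection_coord M k K U \<phi> m i (velocity_coords ?n (Suc k * ?n) m (m * ?n) ?x) +
          real (Suc m) * ?x (Suc m * ?n + i))" unfolding tt(2)[OF i] ..
        also have "\<dots> = tower_coeff M (Suc m * ?n + i) * ?x (Suc m * ?n + i) + ?R (Suc m * ?n + i) ?x"
          unfolding tower_coeff_def tower_remainder_def Let_def dm using nl by (simp add: algebra_simps)
        finally show ?thesis .
      qed
      then show ?thesis unfolding Fm using tangent_scale_coord(1)[OF M tt(1)] by simp
    qed
  qed
  show d: "?F \<in> whitney_dom M \<alpha> U" and p: "whitney_proj ?F = jet_base u"
    using whitney_domI[OF \<alpha>(1) len bu] comp by blast+
  show "whitney_chart M \<alpha> \<phi> ?F = tri_map (Suc \<alpha> * ?n) (tower_coeff M) ?R ?x"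
  proof
    fix j
    show "whitney_chart M \<alpha> \<phi> ?F j = tri_map (Suc \<alpha> * ?n) (tower_coeff M) ?R ?x j"
    proof (cases "j < Suc \<alpha> * ?n")
      case True
      then show ?thesis
      proof (cases rule: block_cases)
        case 1
        have "\<phi> (jet_base u) j = ?x j" using trunc_jet_chart[OF M U u] 1 by (metis trunc_apply(1))
        then show ?thesis using 1 True p by (simp add: whitney_chart_base tri_map_def tower_coeff_def tower_remainder_def Let_def)
      next
        case (2 m i)
        then show ?thesis using comp[OF 2(1)] True whitney_chart_fibre[OF 2(2,1), of \<phi> ?F] by (simp add: tri_map_def)
      qed
    next
      case False
      then show ?thesis using whitney_chart_esp[of M \<alpha> \<phi> ?F] by (simp add: tri_map_def mem_esp)
    qed
  qed
qed


section \<open>The maps F and the vector bundle structure\<close>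

lemma connection_tower_connection_map: "connection_tower M k K \<Longrightarrow> connection_map M k K"
  by (simp add: connection_tower_def)

text \<open>Solving the triangular system stays in the cylinder, a jet realises the solution, and
  injectivity of the Whitney chart identifies its image under \<open>F\<close> with the given
  point.\<close>

lemma tower_F_image:
  assumes M: "smooth_atlas M" and K: "connection_tower M k K" and \<alpha>: "1 \<le> \<alpha>" "\<alpha> \<le> k" and U: "(U, \<phi>) \<in> atlas M"
  shows "tower_F M k K \<alpha> ` jet_dom M \<alpha> U = whitney_dom M \<alpha> U"
proof
  show "tower_F M k K \<alpha> ` jet_dom M \<alpha> U \<subseteq> whitney_dom M \<alpha> U"
    using tower_F_coord(1)[OF M K \<alpha> U] by blast
  interpret triangular "mdim M" "Suc \<alpha> * mdim M" "\<phi> ` U" "tower_coeff M" "tower_remainder M k K U \<phi>"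
    by (rule triangular_tower[OF M connection_tower_connection_map[OF K] \<alpha>(2) U])
  show "whitney_dom M \<alpha> U \<subseteq> tower_F M k K \<alpha> ` jet_dom M \<alpha> U"
  proof
    fix vs assume vs: "vs \<in> whitney_dom M \<alpha> U"
    let ?y = "whitney_chart M \<alpha> \<phi> vs"
    have y: "?y \<in> cyl (mdim M) (Suc \<alpha> * mdim M) (\<phi> ` U)"
      using whitney_chart_image[OF M U \<alpha>(1) order_refl] vs by blast
    obtain u where u: "u \<in> jet_dom M \<alpha> U" "jet_chart M \<alpha> \<phi> u = tri_inv ?y"
      by (rule jet_with_coords[OF M U tri_inv_cyl[OF y]])
    note F = tower_F_coord[OF M K \<alpha> U u(1)]
    have "whitney_chart M \<alpha> \<phi> (tower_F M k K \<alpha> u) = ?y"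
      unfolding F(3) u(2) by (rule tri_map_inv[OF y])
    then have "tower_F M k K \<alpha> u = vs"
      using whitney_chart_inj[OF M U \<alpha>(1)] F(1) vs by (auto simp: inj_on_def)
    then show "vs \<in> tower_F M k K \<alpha> ` jet_dom M \<alpha> U" using u(1) by blast
  qed
qed

lemma tower_F_chart_inverse:
  assumes M: "smooth_atlas M" and K: "connection_tower M k K" and \<alpha>: "1 \<le> \<alpha>" "\<alpha> \<le> k" and U: "(U, \<phi>) \<in> atlas M"
  obtains S T where
    "\<And>j. j < Suc \<alpha> * mdim M \<Longrightarrow> smooth_fun_on (Suc \<alpha> * mdim M) (cyl (mdim M) (Suc \<alpha> * mdim M) (\<phi> ` U)) (\<lambda>y. T y j)"
    "\<And>j. j < Suc \<alpha> * mdim M \<Longrightarrow> smooth_fun_on (Suc \<alpha> * mdim M) (cyl (mdim M) (Suc \<alpha> * mdim M) (\<phi> ` U)) (\<lambda>y. S y j)"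
    "\<And>u. u \<in> jet_dom M \<alpha> U \<Longrightarrow> whitney_chart M \<alpha> \<phi> (tower_F M k K \<alpha> u) = T (jet_chart M \<alpha> \<phi> u)"
    "\<And>u. u \<in> jet_dom M \<alpha> U \<Longrightarrow> S (whitney_chart M \<alpha> \<phi> (tower_F M k K \<alpha> u)) = jet_chart M \<alpha> \<phi> u"
proof -
  interpret triangular "mdim M" "Suc \<alpha> * mdim M" "\<phi> ` U" "tower_coeff M" "tower_remainder M k K U \<phi>"
    by (rule triangular_tower[OF M connection_tower_connection_map[OF K] \<alpha>(2) U])
  let ?T = "tri_map (Suc \<alpha> * mdim M) (tower_coeff M) (tower_remainder M k K U \<phi>)"
  have T: "whitney_chart M \<alpha> \<phi> (tower_F M k K \<alpha> u) = ?T (jet_chart M \<alpha> \<phi> u)" if "u \<in> jet_dom M \<alpha> U" for u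
    by (rule tower_F_coord(3)[OF M K \<alpha> U that])
  have S: "tri_inv (whitney_chart M \<alpha> \<phi> (tower_F M k K \<alpha> u)) = jet_chart M \<alpha> \<phi> u" if "u \<in> jet_dom M \<alpha> U" for u
    unfolding T[OF that]
  proof (rule tri_inv_map)
    show "jet_chart M \<alpha> \<phi> u \<in> cyl (mdim M) (Suc \<alpha> * mdim M) (\<phi> ` U)"
      using jet_chart_image[OF M U order_refl, of \<alpha>] that by blast
  qed
  show ?thesis by (rule that[OF tri_map_smooth tri_inv_smooth T S])
qed

text \<open>\<open>F\<close> preserves base points, so jets with the same image lie over one chart
  domain, where the coordinate inverse \<open>S\<close> tells them apart.\<close>

lemma tower_F_inj:
  assumes M: "smooth_atlas M" and K: "connection_tower M k K" and \<alpha>: "1 \<le> \<alpha>" "\<alpha> \<le> k"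
  shows "inj_on (tower_F M k K \<alpha>) (points (jet_bundle M \<alpha>))"
proof (rule inj_onI)
  fix u w assume u: "u \<in> points (jet_bundle M \<alpha>)" and w: "w \<in> points (jet_bundle M \<alpha>)"
    and eq: "tower_F M k K \<alpha> u = tower_F M k K \<alpha> w"
  obtain U \<phi> where U: "(U, \<phi>) \<in> atlas M" "jet_base u \<in> U" using points_chart[OF jet_base_points[OF M u]] .
  obtain V \<psi> where V: "(V, \<psi>) \<in> atlas M" "jet_base w \<in> V" using points_chart[OF jet_base_points[OF M w]] .
  have ud: "u \<in> jet_dom M \<alpha> U" using u U by (simp add: mem_jet_dom[OF M])
  have "w \<in> jet_dom M \<alpha> V" using w V by (simp add: mem_jet_dom[OF M])
  then have "jet_base w = jet_base u"
    using tower_F_coord(2)[OF M K \<alpha> V(1)] tower_F_coord(2)[OF M K \<alpha> U(1) ud] eq by simp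
  then have wd: "w \<in> jet_dom M \<alpha> U" using w U by (simp add: mem_jet_dom[OF M])
  obtain S T where S: "\<And>u. u \<in> jet_dom M \<alpha> U \<Longrightarrow> S (whitney_chart M \<alpha> \<phi> (tower_F M k K \<alpha> u)) = jet_chart M \<alpha> \<phi> u"
    by (rule tower_F_chart_inverse[OF M K \<alpha> U(1)]) blast
  have "jet_chart M \<alpha> \<phi> u = jet_chart M \<alpha> \<phi> w" using S[OF ud] S[OF wd] eq by simp
  then show "u = w" using jet_chart_eq_iff[OF M U(1) ud wd] by simp
qed

lemma tower_F_bij:
  assumes M: "smooth_atlas M" and K: "connection_tower M k K" and \<alpha>: "1 \<le> \<alpha>" "\<alpha> \<le> k"
  shows "bij_betw (tower_F M k K \<alpha>) (points (jet_bundle M \<alpha>)) (points (whitney_sum M \<alpha>))"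
  unfolding bij_betw_def
proof (intro conjI tower_F_inj[OF assms])
  have "points (jet_bundle M \<alpha>) = (\<Union>(U, \<phi>)\<in>atlas M. jet_dom M \<alpha> U)"
    unfolding points_def atlas_jet_bundle by blast
  moreover have "points (whitney_sum M \<alpha>) = (\<Union>(U, \<phi>)\<in>atlas M. whitney_dom M \<alpha> U)"
    unfolding points_def atlas_whitney_sum by blast
  moreover have "tower_F M k K \<alpha> ` (\<Union>(U, \<phi>)\<in>atlas M. jet_dom M \<alpha> U) = (\<Union>(U, \<phi>)\<in>atlas M. whitney_dom M \<alpha> U)"
    unfolding image_UN by (rule SUP_cong[OF refl]) (use tower_F_image[OF M K \<alpha>] in auto)
  ultimately show "tower_F M k K \<alpha> ` points (jet_bundle M \<alpha>) = points (whitney_sum M \<alpha>)" by simp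
qed

lemma tower_F_diffeomorphism:
  assumes M: "smooth_atlas M" and K: "connection_tower M k K" and \<alpha>: "1 \<le> \<alpha>" "\<alpha> \<le> k"
  shows "diffeomorphism (jet_bundle M \<alpha>) (whitney_sum M \<alpha>) (tower_F M k K \<alpha>)"
proof (rule diffeomorphism_local[OF smooth_atlas_jet_bundle[OF M] smooth_atlas_whitney_sum[OF M \<alpha>(1)] _ tower_F_bij[OF assms]])
  show "mdim (whitney_sum M \<alpha>) = mdim (jet_bundle M \<alpha>)" by simp
  fix u assume u: "u \<in> points (jet_bundle M \<alpha>)"
  obtain U \<phi> where U: "(U, \<phi>) \<in> atlas M" "jet_base u \<in> U" using points_chart[OF jet_base_points[OF M u]] .
  have ud: "u \<in> jet_dom M \<alpha> U" using u U by (simp add: mem_jet_dom[OF M])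
  obtain S T where *:
    "\<And>j. j < Suc \<alpha> * mdim M \<Longrightarrow> smooth_fun_on (Suc \<alpha> * mdim M) (cyl (mdim M) (Suc \<alpha> * mdim M) (\<phi> ` U)) (\<lambda>y. T y j)"
    "\<And>j. j < Suc \<alpha> * mdim M \<Longrightarrow> smooth_fun_on (Suc \<alpha> * mdim M) (cyl (mdim M) (Suc \<alpha> * mdim M) (\<phi> ` U)) (\<lambda>y. S y j)"
    "\<And>u. u \<in> jet_dom M \<alpha> U \<Longrightarrow> whitney_chart M \<alpha> \<phi> (tower_F M k K \<alpha> u) = T (jet_chart M \<alpha> \<phi> u)"
    "\<And>u. u \<in> jet_dom M \<alpha> U \<Longrightarrow> S (whitney_chart M \<alpha> \<phi> (tower_F M k K \<alpha> u)) = jet_chart M \<alpha> \<phi> u"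
    by (rule tower_F_chart_inverse[OF M K \<alpha> U(1)]) (rule that)
  show "\<exists>U \<phi> V \<psi> S T. (U, \<phi>) \<in> atlas (jet_bundle M \<alpha>) \<and> (V, \<psi>) \<in> atlas (whitney_sum M \<alpha>) \<and> u \<in> U \<and> tower_F M k K \<alpha> ` U = V \<and>
       (\<forall>j<mdim (jet_bundle M \<alpha>). smooth_fun_on (mdim (jet_bundle M \<alpha>)) (\<phi> ` U) (\<lambda>y. T y j)) \<and>
       (\<forall>j<mdim (jet_bundle M \<alpha>). smooth_fun_on (mdim (jet_bundle M \<alpha>)) (\<psi> ` V) (\<lambda>y. S y j)) \<and>
       (\<forall>u\<in>U. \<psi> (tower_F M k K \<alpha> u) = T (\<phi> u) \<and> S (\<psi> (tower_F M k K \<alpha> u)) = \<phi> u)"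
  proof (rule exI[of _ "jet_dom M \<alpha> U"], rule exI[of _ "jet_chart M \<alpha> \<phi>"], rule exI[of _ "whitney_dom M \<alpha> U"],
      rule exI[of _ "whitney_chart M \<alpha> \<phi>"], rule exI[of _ S], rule exI[of _ T], intro conjI)
    show "(jet_dom M \<alpha> U, jet_chart M \<alpha> \<phi>) \<in> atlas (jet_bundle M \<alpha>)" by (rule jet_bundle_chart[OF U(1)])
    show "(whitney_dom M \<alpha> U, whitney_chart M \<alpha> \<phi>) \<in> atlas (whitney_sum M \<alpha>)" by (rule whitney_sum_chart[OF U(1)])
    show "tower_F M k K \<alpha> ` jet_dom M \<alpha> U = whitney_dom M \<alpha> U" by (rule tower_F_image[OF M K \<alpha> U(1)])
  qed (use ud * jet_chart_image[OF M U(1) order_refl, of \<alpha>] whitney_chart_image[OF M U(1) \<alpha>(1) order_refl] in simp_all)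
qed

lemma smooth_map_jet_base:
  assumes M: "smooth_atlas M" shows "smooth_map (jet_bundle M k) M jet_base"
proof (rule smooth_map_local[OF smooth_atlas_jet_bundle[OF M] M])
  fix u assume u: "u \<in> points (jet_bundle M k)"
  obtain U \<phi> where U: "(U, \<phi>) \<in> atlas M" "jet_base u \<in> U" using points_chart[OF jet_base_points[OF M u]] .
  have ud: "u \<in> jet_dom M k U" using u U by (simp add: mem_jet_dom[OF M])
  note ch = jet_bundle_chart[OF U(1), of k]
  have "smooth_fun_on (mdim (jet_bundle M k)) (jet_chart M k \<phi> ` jet_dom M k U)
     (\<lambda>y. \<phi> (jet_base (inv_into (jet_dom M k U) (jet_chart M k \<phi>) y)) j)" if j: "j < mdim M" for j
  proof (rule smooth_fun_on_cong[OF smooth_fun_on_coord[OF chart_open[OF smooth_atlas_jet_bundle[OF M] ch], of j]])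
    fix y assume "y \<in> jet_chart M k \<phi> ` jet_dom M k U"
    then obtain w where w: "w \<in> jet_dom M k U" "y = jet_chart M k \<phi> w" by blast
    have "trunc (mdim M) y j = \<phi> (jet_base w) j" using trunc_jet_chart[OF M U(1) w(1)] w(2) by simp
    then show "y j = \<phi> (jet_base (inv_into (jet_dom M k U) (jet_chart M k \<phi>) y)) j"
      using chart_inv[OF smooth_atlas_jet_bundle[OF M] ch w(1)] w(2) j by simp
  qed
  moreover have "jet_base ` jet_dom M k U \<subseteq> U" by (auto simp: mem_jet_dom[OF M])
  ultimately show "\<exists>U \<phi> V \<psi>. (U, \<phi>) \<in> atlas (jet_bundle M k) \<and> (V, \<psi>) \<in> atlas M \<and> u \<in> U \<and> jet_base ` U \<subseteq> V \<and>
       (\<forall>j<mdim M. smooth_fun_on (mdim (jet_bundle M k)) (\<phi> ` U) (\<lambda>y. \<psi> (jet_base (inv_into U \<phi> y)) j))"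
    using ch ud U(1) by blast
qed

section \<open>Fibrewise operations and local trivialisations\<close>

lemma whitney_add_coord:
  assumes M: "smooth_atlas M" and k: "k \<ge> 1" and vs: "vs \<in> points (whitney_sum M k)" and ws: "ws \<in> points (whitney_sum M k)"
    and p: "whitney_proj vs = x" "whitney_proj ws = x"
  shows "whitney_add M vs ws \<in> points (whitney_sum M k)" "whitney_proj (whitney_add M vs ws) = x"
    "\<And>U \<phi> j. (U, \<phi>) \<in> atlas M \<Longrightarrow> x \<in> U \<Longrightarrow> mdim M \<le> j \<Longrightarrow>
       whitney_chart M k \<phi> (whitney_add M vs ws) j = whitney_chart M k \<phi> vs j + whitney_chart M k \<phi> ws j"
proof -
  let ?s = "whitney_add M vs ws"
  note v = vs[unfolded mem_points_whitney_sum[OF k] p] and w = ws[unfolded mem_points_whitney_sum[OF k] p]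
  have len: "length ?s = k" using v w by (simp add: whitney_add_def)
  have nth: "?s ! m = tangent_add M (vs ! m) (ws ! m)" if "m < k" for m
    using that v w by (simp add: whitney_add_def)
  have inT: "?s ! m \<in> tangent_space M x" if "m < k" for m
    unfolding nth[OF that] using tangent_add_coord(1)[OF M] v w that by blast
  show p': "whitney_proj ?s = x" by (rule whitney_domI(2)[OF k len UNIV_I inT])
  show "?s \<in> points (whitney_sum M k)"
    unfolding mem_points_whitney_sum[OF k] p' using len inT v by blast
  show "whitney_chart M k \<phi> ?s j = whitney_chart M k \<phi> vs j + whitney_chart M k \<phi> ws j"
    if U: "(U, \<phi>) \<in> atlas M" "x \<in> U" and j: "mdim M \<le> j" for U \<phi> j
  proof (cases "j < Suc k * mdim M")
    case True
    then show ?thesis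
    proof (cases rule: block_cases)
      case (2 m i)
      then show ?thesis
        using whitney_chart_fibre[OF 2(2,1)] nth[OF 2(1)] tangent_add_coord(2)[OF M _ _ U 2(2), of "vs ! m" "ws ! m"] v w by simp
    qed (use j in simp)
  next
    case False
    then show ?thesis using whitney_chart_esp[of M k \<phi>] by (simp add: mem_esp)
  qed
qed

lemma whitney_scale_coord:
  assumes M: "smooth_atlas M" and k: "k \<ge> 1" and vs: "vs \<in> points (whitney_sum M k)" and p: "whitney_proj vs = x"
  shows "whitney_scale M c vs \<in> points (whitney_sum M k)" "whitney_proj (whitney_scale M c vs) = x"
    "\<And>U \<phi> j. (U, \<phi>) \<in> atlas M \<Longrightarrow> x \<in> U \<Longrightarrow> mdim M \<le> j \<Longrightarrow>
       whitney_chart M k \<phi> (whitney_scale M c vs) j = c * whitney_chart M k \<phi> vs j"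
proof -
  let ?s = "whitney_scale M c vs"
  note v = vs[unfolded mem_points_whitney_sum[OF k] p]
  have len: "length ?s = k" using v by (simp add: whitney_scale_def)
  have nth: "?s ! m = tangent_scale M c (vs ! m)" if "m < k" for m
    using that v by (simp add: whitney_scale_def)
  have inT: "?s ! m \<in> tangent_space M x" if "m < k" for m
    unfolding nth[OF that] using tangent_scale_coord(1)[OF M] v that by blast
  show p': "whitney_proj ?s = x" by (rule whitney_domI(2)[OF k len UNIV_I inT])
  show "?s \<in> points (whitney_sum M k)"
    unfolding mem_points_whitney_sum[OF k] p' using len inT v by blast
  show "whitney_chart M k \<phi> ?s j = c * whitney_chart M k \<phi> vs j"
    if U: "(U, \<phi>) \<in> atlas M" "x \<in> U" and j: "mdim M \<le> j" for U \<phi> j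
  proof (cases "j < Suc k * mdim M")
    case True
    then show ?thesis
    proof (cases rule: block_cases)
      case (2 m i)
      then show ?thesis
        using whitney_chart_fibre[OF 2(2,1)] nth[OF 2(1)] tangent_scale_coord(2)[OF M _ U 2(2), of "vs ! m"] v by simp
    qed (use j in simp)
  next
    case False
    then show ?thesis using whitney_chart_esp[of M k \<phi>] by (simp add: mem_esp)
  qed
qed

text \<open>The Whitney chart after \<open>F\<close>, with the base block replaced by the base point
  itself: the local trivialisation of the pulled back bundle over a chart domain.\<close>

definition tower_triv :: "'a mfd \<Rightarrow> nat \<Rightarrow> (nat \<Rightarrow> 'a jet jet \<Rightarrow> 'a jet) \<Rightarrow> nat \<Rightarrow> ('a \<Rightarrow> nat \<Rightarrow> real) \<Rightarrow>
    'a jet \<Rightarrow> 'a \<times> (nat \<Rightarrow> real)" where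
  "tower_triv M k K \<alpha> \<phi> u = (jet_base u, \<lambda>j. whitney_chart M \<alpha> \<phi> (tower_F M k K \<alpha> u) (mdim M + j))"

text \<open>Gives \<open>tower_triv\<close> the same coordinate expression as \<open>F\<close>, so
  that the smooth maps \<open>S\<close> and \<open>T\<close> found for \<open>F\<close> serve for
  the trivialisation as well.\<close>

lemma times_chart_tower_triv:
  assumes M: "smooth_atlas M" and K: "connection_tower M k K" and \<alpha>: "1 \<le> \<alpha>" "\<alpha> \<le> k" and U: "(U, \<phi>) \<in> atlas M"
    and u: "u \<in> jet_dom M \<alpha> U"
  shows "times_chart (mdim M) \<phi> (tower_triv M k K \<alpha> \<phi> u) = whitney_chart M \<alpha> \<phi> (tower_F M k K \<alpha> u)"
  using tower_F_coord(2)[OF M K \<alpha> U u]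
  by (auto simp: times_chart_def tower_triv_def fun_eq_iff whitney_chart_base)

lemma tower_triv_bij:
  assumes M: "smooth_atlas M" and K: "connection_tower M k K" and \<alpha>: "1 \<le> \<alpha>" "\<alpha> \<le> k" and U: "(U, \<phi>) \<in> atlas M"
  shows "bij_betw (tower_triv M k K \<alpha> \<phi>) (jet_dom M \<alpha> U) (U \<times> esp (\<alpha> * mdim M))"
proof -
  let ?n = "mdim M" and ?F = "tower_F M k K \<alpha>" and ?t = "tower_triv M k K \<alpha> \<phi>"
  note tc = times_chart_tower_triv[OF M K \<alpha> U]
  have inj: "inj_on ?t (jet_dom M \<alpha> U)"
  proof (rule inj_onI)
    fix u w assume u: "u \<in> jet_dom M \<alpha> U" and w: "w \<in> jet_dom M \<alpha> U" and "?t u = ?t w"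
    then have "whitney_chart M \<alpha> \<phi> (?F u) = whitney_chart M \<alpha> \<phi> (?F w)" using tc by metis
    then have "?F u = ?F w"
      using whitney_chart_inj[OF M U \<alpha>(1)] tower_F_coord(1)[OF M K \<alpha> U] u w by (auto simp: inj_on_def)
    then show "u = w" using tower_F_inj[OF M K \<alpha>] u w by (auto simp: inj_on_def mem_jet_dom[OF M])
  qed
  have into: "?t u \<in> U \<times> esp (\<alpha> * ?n)" if "u \<in> jet_dom M \<alpha> U" for u
    using that whitney_chart_esp[of M \<alpha> \<phi> "?F u"] by (simp add: tower_triv_def mem_jet_dom[OF M] mem_esp mult_Suc)
  have "z \<in> ?t ` jet_dom M \<alpha> U" if z: "z \<in> U \<times> esp (\<alpha> * ?n)" for z
  proof -
    \<comment> \<open>Product chart and Whitney chart have the same cylinder as image, so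
      \<open>z\<close> has a partner in the Whitney sum, which is \<open>F u\<close> for some
      \<open>u\<close>.\<close>
    have "times_chart ?n \<phi> z \<in> cyl ?n (Suc \<alpha> * ?n) (\<phi> ` U)"
      using times_chart_image[OF M U order_refl, of "\<alpha> * ?n"] z unfolding mult_Suc by blast
    then obtain u where u: "u \<in> jet_dom M \<alpha> U" "times_chart ?n \<phi> z = whitney_chart M \<alpha> \<phi> (?F u)"
      unfolding whitney_chart_image[OF M U \<alpha>(1) order_refl, symmetric] tower_F_image[OF M K \<alpha> U, symmetric] by blast
    then have "times_chart ?n \<phi> z = times_chart ?n \<phi> (?t u)" using tc by simp
    then have "z = ?t u" using times_chart_inj[OF M U, of "\<alpha> * ?n"] z into[OF u(1)] by (auto simp: inj_on_def)
    then show ?thesis using u(1) by blast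
  qed
  then show ?thesis using inj into unfolding bij_betw_def by blast
qed

lemma tower_triv_diffeomorphism:
  assumes M: "smooth_atlas M" and K: "connection_tower M k K" and \<alpha>: "1 \<le> \<alpha>" "\<alpha> \<le> k" and U: "(U, \<phi>) \<in> atlas M"
  shows "diffeomorphism (restrict_mfd (jet_bundle M \<alpha>) (jet_base -` U)) (times_euclidean (restrict_mfd M U) (\<alpha> * mdim M))
    (tower_triv M k K \<alpha> \<phi>)"
proof -
  let ?n = "mdim M" and ?F = "tower_F M k K \<alpha>" and ?t = "tower_triv M k K \<alpha> \<phi>"
  let ?E = "restrict_mfd (jet_bundle M \<alpha>) (jet_base -` U)" and ?N = "times_euclidean (restrict_mfd M U) (\<alpha> * ?n)"
  have dInt: "jet_dom M \<alpha> V \<inter> jet_base -` U = jet_dom M \<alpha> (V \<inter> U)" for V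
    by (auto simp: mem_jet_dom[OF M])
  have E: "smooth_atlas ?E"
  proof (rule smooth_atlas_restrict_mfd[OF smooth_atlas_jet_bundle[OF M]])
    fix V' \<psi>' assume "(V', \<psi>') \<in> atlas (jet_bundle M \<alpha>)"
    then obtain V \<psi> where V: "(V, \<psi>) \<in> atlas M" "V' = jet_dom M \<alpha> V" "\<psi>' = jet_chart M \<alpha> \<psi>"
      unfolding atlas_jet_bundle by blast
    show "openin (Euclidean_space (mdim (jet_bundle M \<alpha>))) (\<psi>' ` (V' \<inter> jet_base -` U))"
      unfolding V(2,3) dInt jet_chart_image[OF M V(1) Int_lower1] mdim_jet_bundle
      by (rule openin_cyl[OF chart_overlap_open[OF M V(1) U]]) (simp add: mult_Suc)
  qed
  have RU: "smooth_atlas (restrict_mfd M U)"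
    by (rule smooth_atlas_restrict_mfd[OF M chart_overlap_open[OF M _ U]])
  have N: "smooth_atlas ?N" by (rule smooth_atlas_times_euclidean[OF RU])
  have Epts: "points ?E = jet_dom M \<alpha> U"
    by (auto simp: points_restrict_mfd mem_jet_dom[OF M])
  have "points M \<inter> U = U" using chart_points[OF U] by auto
  then have Npts: "points ?N = U \<times> esp (\<alpha> * ?n)"
    by (simp add: points_times_euclidean points_restrict_mfd)
  note bij = tower_triv_bij[OF M K \<alpha> U]
  show ?thesis
  proof (rule diffeomorphism_local[OF E N])
    show "mdim ?N = mdim ?E" by (simp add: mult_Suc)
    show "bij_betw ?t (points ?E) (points ?N)" unfolding Epts Npts by (rule bij)
    fix u assume "u \<in> points ?E"
    then have u: "u \<in> jet_dom M \<alpha> U" by (simp add: Epts)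
    obtain S T where *:
      "\<And>j. j < Suc \<alpha> * mdim M \<Longrightarrow> smooth_fun_on (Suc \<alpha> * mdim M) (cyl (mdim M) (Suc \<alpha> * mdim M) (\<phi> ` U)) (\<lambda>y. T y j)"
      "\<And>j. j < Suc \<alpha> * mdim M \<Longrightarrow> smooth_fun_on (Suc \<alpha> * mdim M) (cyl (mdim M) (Suc \<alpha> * mdim M) (\<phi> ` U)) (\<lambda>y. S y j)"
      "\<And>u. u \<in> jet_dom M \<alpha> U \<Longrightarrow> whitney_chart M \<alpha> \<phi> (tower_F M k K \<alpha> u) = T (jet_chart M \<alpha> \<phi> u)"
      "\<And>u. u \<in> jet_dom M \<alpha> U \<Longrightarrow> S (whitney_chart M \<alpha> \<phi> (tower_F M k K \<alpha> u)) = jet_chart M \<alpha> \<phi> u"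
      by (rule tower_F_chart_inverse[OF M K \<alpha> U]) (rule that)
    have c1: "(jet_dom M \<alpha> U, jet_chart M \<alpha> \<phi>) \<in> atlas ?E"
      using jet_bundle_chart[OF U, of \<alpha>] dInt[of U] unfolding atlas_restrict_mfd by auto
    have "(U, \<phi>) \<in> atlas (restrict_mfd M U)" using U unfolding atlas_restrict_mfd by blast
    then have c2: "(U \<times> esp (\<alpha> * ?n), times_chart ?n \<phi>) \<in> atlas ?N"
      unfolding atlas_times_euclidean mdim_restrict_mfd by blast
    have im1: "jet_chart M \<alpha> \<phi> ` jet_dom M \<alpha> U = cyl ?n (Suc \<alpha> * ?n) (\<phi> ` U)"
      by (rule jet_chart_image[OF M U order_refl])
    have im2: "times_chart ?n \<phi> ` (U \<times> esp (\<alpha> * ?n)) = cyl ?n (Suc \<alpha> * ?n) (\<phi> ` U)"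
      unfolding mult_Suc by (rule times_chart_image[OF M U order_refl])
    have dimE: "mdim ?E = Suc \<alpha> * ?n" by simp
    have tU: "?t ` jet_dom M \<alpha> U = U \<times> esp (\<alpha> * ?n)" using bij by (simp add: bij_betw_def)
    show "\<exists>U \<phi> V \<psi> S T. (U, \<phi>) \<in> atlas ?E \<and> (V, \<psi>) \<in> atlas ?N \<and> u \<in> U \<and> ?t ` U = V \<and>
       (\<forall>j<mdim ?E. smooth_fun_on (mdim ?E) (\<phi> ` U) (\<lambda>y. T y j)) \<and>
       (\<forall>j<mdim ?E. smooth_fun_on (mdim ?E) (\<psi> ` V) (\<lambda>y. S y j)) \<and>
       (\<forall>u\<in>U. \<psi> (?t u) = T (\<phi> u) \<and> S (\<psi> (?t u)) = \<phi> u)"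
      unfolding dimE
    proof (rule exI[of _ "jet_dom M \<alpha> U"], rule exI[of _ "jet_chart M \<alpha> \<phi>"], rule exI[of _ "U \<times> esp (\<alpha> * ?n)"],
        rule exI[of _ "times_chart ?n \<phi>"], rule exI[of _ S], rule exI[of _ T], unfold im1 im2, intro conjI c1 c2 u tU)
    qed (use * times_chart_tower_triv[OF M K \<alpha> U] in simp_all)
  qed
qed

lemma pullback_tower_F:
  assumes M: "smooth_atlas M" and K: "connection_tower M k K" and \<alpha>: "1 \<le> \<alpha>" "\<alpha> \<le> k"
    and vs: "vs \<in> points (whitney_sum M \<alpha>)"
  defines "w \<equiv> inv_into (points (jet_bundle M \<alpha>)) (tower_F M k K \<alpha>) vs"
  shows "w \<in> points (jet_bundle M \<alpha>)" "tower_F M k K \<alpha> w = vs" "jet_base w = whitney_proj vs"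
proof -
  have im: "vs \<in> tower_F M k K \<alpha> ` points (jet_bundle M \<alpha>)"
    using tower_F_bij[OF M K \<alpha>] vs by (simp add: bij_betw_def)
  show w: "w \<in> points (jet_bundle M \<alpha>)" unfolding w_def by (rule inv_into_into[OF im])
  show F: "tower_F M k K \<alpha> w = vs" unfolding w_def by (rule f_inv_into_f[OF im])
  obtain U \<phi> where U: "(U, \<phi>) \<in> atlas M" "jet_base w \<in> U" using points_chart[OF jet_base_points[OF M w]] .
  then have "w \<in> jet_dom M \<alpha> U" using w by (simp add: mem_jet_dom[OF M])
  from tower_F_coord(2)[OF M K \<alpha> U(1) this] show "jet_base w = whitney_proj vs" unfolding F by simp
qed

lemma whitney_proj_tower_F:
  assumes M: "smooth_atlas M" and K: "connection_tower M k K" and \<alpha>: "1 \<le> \<alpha>" "\<alpha> \<le> k"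
    and u: "u \<in> points (jet_bundle M \<alpha>)"
  shows "whitney_proj (tower_F M k K \<alpha> u) = jet_base u" "tower_F M k K \<alpha> u \<in> points (whitney_sum M \<alpha>)"
proof -
  show F: "tower_F M k K \<alpha> u \<in> points (whitney_sum M \<alpha>)"
    using tower_F_bij[OF M K \<alpha>] u by (auto simp: bij_betw_def)
  have "inv_into (points (jet_bundle M \<alpha>)) (tower_F M k K \<alpha>) (tower_F M k K \<alpha> u) = u"
    by (rule inv_into_f_f[OF tower_F_inj[OF M K \<alpha>] u])
  then show "whitney_proj (tower_F M k K \<alpha> u) = jet_base u"
    using pullback_tower_F(3)[OF M K \<alpha> F] by simp
qed

text \<open>\<open>F\<close> undoes the \<open>inv_into\<close> in the pulled back operations. This
  reduces the claim to additivity and homogeneity of the fibre blocks of the Whitney chart.\<close>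

lemma tower_triv_linear:
  assumes M: "smooth_atlas M" and K: "connection_tower M k K" and \<alpha>: "1 \<le> \<alpha>" "\<alpha> \<le> k"
    and U: "(U, \<phi>) \<in> atlas M" "x \<in> U" and u: "u \<in> fibre (jet_bundle M \<alpha>) jet_base x"
  defines "P \<equiv> points (jet_bundle M \<alpha>)" and "F \<equiv> tower_F M k K \<alpha>"
  shows "w \<in> fibre (jet_bundle M \<alpha>) jet_base x \<Longrightarrow>
      pullback_add P F (whitney_add M) u w \<in> fibre (jet_bundle M \<alpha>) jet_base x \<and>
      snd (tower_triv M k K \<alpha> \<phi> (pullback_add P F (whitney_add M) u w)) =
      (\<lambda>i. snd (tower_triv M k K \<alpha> \<phi> u) i + snd (tower_triv M k K \<alpha> \<phi> w) i)"
    "pullback_scale P F (whitney_scale M) c u \<in> fibre (jet_bundle M \<alpha>) jet_base x \<and>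
      snd (tower_triv M k K \<alpha> \<phi> (pullback_scale P F (whitney_scale M) c u)) =
      (\<lambda>i. c * snd (tower_triv M k K \<alpha> \<phi> u) i)"
proof -
  have u': "u \<in> points (jet_bundle M \<alpha>)" "jet_base u = x" using u by (simp_all add: fibre_def)
  note Fu = whitney_proj_tower_F[OF M K \<alpha> u'(1), unfolded u'(2)]
  {
    assume "w \<in> fibre (jet_bundle M \<alpha>) jet_base x"
    then have w': "w \<in> points (jet_bundle M \<alpha>)" "jet_base w = x" by (simp_all add: fibre_def)
    note Fw = whitney_proj_tower_F[OF M K \<alpha> w'(1), unfolded w'(2)]
    note s = whitney_add_coord[OF M \<alpha>(1) Fu(2) Fw(2) Fu(1) Fw(1)]
    show "pullback_add P F (whitney_add M) u w \<in> fibre (jet_bundle M \<alpha>) jet_base x \<and>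
      snd (tower_triv M k K \<alpha> \<phi> (pullback_add P F (whitney_add M) u w)) =
      (\<lambda>i. snd (tower_triv M k K \<alpha> \<phi> u) i + snd (tower_triv M k K \<alpha> \<phi> w) i)"
      unfolding pullback_add_def P_def F_def tower_triv_def snd_conv fibre_def
      using pullback_tower_F[OF M K \<alpha> s(1)] s(2) s(3)[OF U] by simp
  }
  note s = whitney_scale_coord[OF M \<alpha>(1) Fu(2) Fu(1), where c=c]
  show "pullback_scale P F (whitney_scale M) c u \<in> fibre (jet_bundle M \<alpha>) jet_base x \<and>
      snd (tower_triv M k K \<alpha> \<phi> (pullback_scale P F (whitney_scale M) c u)) =
      (\<lambda>i. c * snd (tower_triv M k K \<alpha> \<phi> u) i)"
    unfolding pullback_scale_def P_def F_def tower_triv_def snd_conv fibre_def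
    using pullback_tower_F[OF M K \<alpha> s(1)] s(2) s(3)[OF U] by simp
qed

text \<open>Prepares the transport of the vector space axioms: the bijection over \<open>U\<close>
  respects base points and can be restricted to a single fibre.\<close>

lemma tower_triv_fibre_bij:
  assumes M: "smooth_atlas M" and K: "connection_tower M k K" and \<alpha>: "1 \<le> \<alpha>" "\<alpha> \<le> k"
    and U: "(U, \<phi>) \<in> atlas M" "x \<in> U"
  shows "bij_betw (\<lambda>u. snd (tower_triv M k K \<alpha> \<phi> u)) (fibre (jet_bundle M \<alpha>) jet_base x) (esp (\<alpha> * mdim M))"
proof -
  let ?t = "tower_triv M k K \<alpha> \<phi>" and ?V = "fibre (jet_bundle M \<alpha>) jet_base x"
  note bij = tower_triv_bij[OF M K \<alpha> U(1)]
  have V: "?V = {u \<in> jet_dom M \<alpha> U. fst (?t u) = x}"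
    using U(2) by (auto simp: fibre_def mem_jet_dom[OF M] tower_triv_def)
  have "inj_on (\<lambda>u. snd (?t u)) ?V"
    using bij unfolding V bij_betw_def inj_on_def by (auto simp: prod_eq_iff)
  moreover have "(\<lambda>u. snd (?t u)) ` ?V = esp (\<alpha> * mdim M)"
  proof
    show "(\<lambda>u. snd (?t u)) ` ?V \<subseteq> esp (\<alpha> * mdim M)"
    proof
      fix a assume "a \<in> (\<lambda>u. snd (?t u)) ` ?V"
      then obtain u where u: "u \<in> jet_dom M \<alpha> U" "a = snd (?t u)" unfolding V by blast
      have "?t u \<in> U \<times> esp (\<alpha> * mdim M)" by (rule bij_betwE[OF bij, rule_format, OF u(1)])
      then show "a \<in> esp (\<alpha> * mdim M)" using u(2) by (simp add: mem_Times_iff)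
    qed
    show "esp (\<alpha> * mdim M) \<subseteq> (\<lambda>u. snd (?t u)) ` ?V"
    proof
      fix a assume "a \<in> esp (\<alpha> * mdim M)"
      then have "(x, a) \<in> ?t ` jet_dom M \<alpha> U" using bij U(2) by (simp add: bij_betw_def)
      then obtain u where "u \<in> jet_dom M \<alpha> U" "?t u = (x, a)" by force
      then show "a \<in> (\<lambda>u. snd (?t u)) ` ?V" unfolding V by force
    qed
  qed
  ultimately show ?thesis unfolding bij_betw_def by blast
qed

lemma jet_base_surj:
  assumes M: "smooth_atlas M" shows "jet_base ` points (jet_bundle M k) = points M"
proof
  show "jet_base ` points (jet_bundle M k) \<subseteq> points M" using jet_base_points[OF M] by blast
  show "points M \<subseteq> jet_base ` points (jet_bundle M k)"
  proof
    fix x assume "x \<in> points M"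
    then obtain U \<phi> where U: "(U, \<phi>) \<in> atlas M" "x \<in> U" by (rule points_chart)
    \<comment> \<open>A curve through \<open>x\<close> is wanted. A representative of any tangent
      vector at \<open>x\<close> provides one, and its \<open>k\<close>-jet lies over
      \<open>x\<close>.\<close>
    obtain v where "v \<in> tangent_space M x" by (rule tangent_vector_exists[OF M U])
    then have v: "v \<in> points (jet_bundle M 1)" "jet_base v = x" by (simp_all add: mem_tangent_space)
    note r = jet_bundle_rep[OF M v(1)]
    then have "jet_base (jet M k (rep v)) = x" using jet_base_jet[OF M r(1)] v(2) by simp
    then show "x \<in> jet_base ` points (jet_bundle M k)" using jet_points[OF r(1)] by blast
  qed
qed

lemma tower_F_vector_bundle:
  assumes sM: "smooth_manifold M" and K: "connection_tower M k K" and \<alpha>: "1 \<le> \<alpha>" "\<alpha> \<le> k"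
  shows "smooth_vector_bundle (jet_bundle M \<alpha>) M jet_base (\<alpha> * mdim M)
      (pullback_add (points (jet_bundle M \<alpha>)) (tower_F M k K \<alpha>) (whitney_add M))
      (pullback_scale (points (jet_bundle M \<alpha>)) (tower_F M k K \<alpha>) (whitney_scale M))"
  unfolding smooth_vector_bundle_def
proof (intro conjI sM smooth_manifold_jet_bundle[OF sM] ballI)
  have M: "smooth_atlas M" by (rule smooth_manifold_atlas[OF sM])
  show "smooth_map (jet_bundle M \<alpha>) M jet_base" by (rule smooth_map_jet_base[OF M])
  show "jet_base ` points (jet_bundle M \<alpha>) = points M" by (rule jet_base_surj[OF M])
  fix x assume "x \<in> points M"
  then obtain U \<phi> where U: "(U, \<phi>) \<in> atlas M" "x \<in> U" by (rule points_chart)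
  show "real_vector_space_on (fibre (jet_bundle M \<alpha>) jet_base x)
      (pullback_add (points (jet_bundle M \<alpha>)) (tower_F M k K \<alpha>) (whitney_add M))
      (pullback_scale (points (jet_bundle M \<alpha>)) (tower_F M k K \<alpha>) (whitney_scale M))"
    by (rule real_vector_space_on_transport[OF tower_triv_fibre_bij[OF M K \<alpha> U] tower_triv_linear[OF M K \<alpha> U]])
  show "\<exists>W \<Phi>. openin (mfd_topology M) W \<and> x \<in> W \<and> local_trivialization (jet_bundle M \<alpha>) M jet_base (\<alpha> * mdim M)
      (pullback_add (points (jet_bundle M \<alpha>)) (tower_F M k K \<alpha>) (whitney_add M))
      (pullback_scale (points (jet_bundle M \<alpha>)) (tower_F M k K \<alpha>) (whitney_scale M)) W \<Phi>"
  proof (rule exI[of _ U], rule exI[of _ "tower_triv M k K \<alpha> \<phi>"], intro conjI U(2) openin_chart_dom[OF M U(1)])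
    show "local_trivialization (jet_bundle M \<alpha>) M jet_base (\<alpha> * mdim M)
      (pullback_add (points (jet_bundle M \<alpha>)) (tower_F M k K \<alpha>) (whitney_add M))
      (pullback_scale (points (jet_bundle M \<alpha>)) (tower_F M k K \<alpha>) (whitney_scale M)) U (tower_triv M k K \<alpha> \<phi>)"
      unfolding local_trivialization_def
      using tower_triv_diffeomorphism[OF M K \<alpha> U(1)] tower_triv_linear[OF M K \<alpha> U(1)]
      by (simp add: tower_triv_def)
  qed
qed

theorem theorem3:
  fixes M :: "'a mfd"
    and n k :: nat
    and K :: "nat \<Rightarrow> 'a jet jet \<Rightarrow> 'a jet"
  assumes "smooth_manifold M"
    and "mdim M = n"
    and "k \<ge> 1"
    and "connection_tower M k K"
  shows "\<forall>\<alpha>\<in>{1..k}.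
    diffeomorphism (jet_bundle M \<alpha>) (whitney_sum M \<alpha>) (tower_F M k K \<alpha>) \<and>
    (\<forall>u\<in>points (jet_bundle M \<alpha>). whitney_proj (tower_F M k K \<alpha> u) = jet_base u) \<and>
    smooth_vector_bundle (jet_bundle M \<alpha>) M jet_base (\<alpha> * n)
      (pullback_add (points (jet_bundle M \<alpha>)) (tower_F M k K \<alpha>) (whitney_add M))
      (pullback_scale (points (jet_bundle M \<alpha>)) (tower_F M k K \<alpha>) (whitney_scale M))"
proof
  fix \<alpha> assume "\<alpha> \<in> {1..k}"
  then have \<alpha>: "1 \<le> \<alpha>" "\<alpha> \<le> k" by simp_all
  have M: "smooth_atlas M" by (rule smooth_manifold_atlas[OF assms(1)])
  show "diffeomorphism (jet_bundle M \<alpha>) (whitney_sum M \<alpha>) (tower_F M k K \<alpha>) \<and>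
    (\<forall>u\<in>points (jet_bundle M \<alpha>). whitney_proj (tower_F M k K \<alpha> u) = jet_base u) \<and>
    smooth_vector_bundle (jet_bundle M \<alpha>) M jet_base (\<alpha> * n)
      (pullback_add (points (jet_bundle M \<alpha>)) (tower_F M k K \<alpha>) (whitney_add M))
      (pullback_scale (points (jet_bundle M \<alpha>)) (tower_F M k K \<alpha>) (whitney_scale M))"
    using tower_F_diffeomorphism[OF M assms(4) \<alpha>] whitney_proj_tower_F(1)[OF M assms(4) \<alpha>]
      tower_F_vector_bundle[OF assms(1,4) \<alpha>] assms(2) by simp
qed

end
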